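(* Assume that for all $1\le j\le i$, $\mathbb{E}(X_{ij}\mid\mathcal{F}_{ij}^{1})=0$ a.s., and that $$\sup_{n}\frac{1}{n^{2}}\sum_{1\le j\le i\le n}\sigma_{ij}^{2}<\infty .$$ Assume in addition that $$\lim_{a\to\infty}\limsup_{n\to\infty}\frac{1}{n^{2}}\sum_{1\le j\le i\le n}\big\Vert\mathbb{E}(X_{ij}^{2}-\sigma_{ij}^{2}\mid\mathcal{F}_{ij}^{a})\big\Vert_{1}=0,$$ and that for any $\varepsilon>0$, $$\frac{1}{n^{2}}\sum_{1\le j\le i\le n}\mathbb{E}\big(X_{ij}^{2}I(|X_{ij}|>\varepsilon n^{1/2})\big)\to 0\quad\text{as }n\to\infty .$$ Then, for all $z\in\mathbb{C}^{+}$, $$S^{\mathbb{X}_{n}}(z)-S^{\mathbb{Y}_{n}}(z)\to 0\quad\text{in probability as } n\to\infty .$$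
   Context: All random variables are defined on one probability space $(\Omega,\mathcal{F},\mathbb{P})$. $(X_{ij})_{(i,j)\in\mathbb{Z}^{2}}$ are real-valued random variables with $\mathbb{E}(X_{ij})=0$ and $\mathbb{E}(X_{ij}^{2})=\sigma_{ij}^{2}<\infty$. $(Y_{ij})_{(i,j)\in\mathbb{N}^{2}}$ is a family of independent centered real-valued Gaussian random variables with $\mathbb{E}(Y_{ij}^{2})=\sigma_{ij}^{2}$, independent of $(X_{ij})_{(i,j)\in\mathbb{Z}^2}$. $\mathbf{X}_{n}$ is the symmetric $n\times n$ matrix with $(\mathbf{X}_{n})_{ij}=X_{ij}$ for $i\ge j$ and $(\mathbf{X}_{n})_{ij}=X_{ji}$ for $i<j$; $\mathbb{X}_{n}=n^{-1/2}\mathbf{X}_{n}$. $\mathbf{Y}_{n}$ and $\mathbb{Y}_{n}=n^{-1/2}\mathbf{Y}_n$ are defined in the same way from the $Y_{ij}$. For a symmetric $n\times n$ matrix $A$ and $z\in\mathbb{C}^{+}=\{z\in\mathbb{C}:\operatorname{Im}z>0\}$, $S^{A}(z)=\frac1n\mathrm{Tr}(A-z\mathbf{I}_{n})^{-1}$ is the Stieltjes transform of its empirical spectral distribution. Lexicographic order on $\mathbb{Z}^{2}$: $(u,v)\le_{\mathrm{lex}}(i,j)$ means $u<i$, or $u=i$ and $v\le j$. For a non-negative integer $a$, let $B_{ij}^{a}=\{(u,v)\in\mathbb{Z}^{2}:\max(|u-i|,|v-j|)\ge a,\ (u,v)\le_{\mathrm{lex}}(i,j)\}$, and for $i\ge j$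 let $\mathcal{F}_{ij}^{a}=\sigma(X_{uv}:(u,v)\in B_{ij}^{a}\text{ and }v\le u)$ (the trivial $\sigma$-algebra if $B_{ij}^a=\emptyset$). $\Vert X\Vert_{p}=(\mathbb{E}|X|^{p})^{1/p}$, and $I(\cdot)$ is the indicator. *)

theory Defs
  imports
    "HOL-Probability.Probability"
    "Jordan_Normal_Form.Gauss_Jordan_Elimination"
begin

text \<open>
  The measure carried by a \<open>sigma\<close> space is irrelevant here: conditional expectations and
  independence only use its sets. For \<open>I = {}\<close> this is the trivial \<open>\<sigma>\<close>-algebra.
\<close>
definition gen_subalgebra :: "'a measure \<Rightarrow> ('i \<Rightarrow> 'a \<Rightarrow> real) \<Rightarrow> 'i set \<Rightarrow> 'a measure" where
  "gen_subalgebra M X I =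
     sigma (space M) (\<Union>i\<in>I. {X i -` A \<inter> space M | A. A \<in> sets borel})"

definition lex_le :: "int \<times> int \<Rightarrow> int \<times> int \<Rightarrow> bool" where
  "lex_le p q \<longleftrightarrow> fst p < fst q \<or> (fst p = fst q \<and> snd p \<le> snd q)"

definition past_set :: "nat \<Rightarrow> int \<Rightarrow> int \<Rightarrow> (int \<times> int) set" where
  "past_set a i j = {(u, v). max \<bar>u - i\<bar> \<bar>v - j\<bar> \<ge> int a \<and> lex_le (u, v) (i, j)}"

definition past_algebra ::
    "'a measure \<Rightarrow> (int \<Rightarrow> int \<Rightarrow> 'a \<Rightarrow> real) \<Rightarrow> nat \<Rightarrow> int \<Rightarrow> int \<Rightarrow> 'a measure" where
  "past_algebra M X a i j =
     gen_subalgebra M (\<lambda>(u, v). X u v) {(u, v). (u, v) \<in> past_set a i j \<and> v \<le> u}"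

definition Lp_norm :: "'a measure \<Rightarrow> real \<Rightarrow> ('a \<Rightarrow> real) \<Rightarrow> real" where
  "Lp_norm M p f = (\<integral>\<omega>. \<bar>f \<omega>\<bar> powr p \<partial>M) powr (1 / p)"

text \<open>The centered Gaussian law of variance \<open>v\<close>, which is the Dirac mass at \<open>0\<close> when \<open>v = 0\<close>.\<close>
definition centered_gaussian :: "real \<Rightarrow> real measure" where
  "centered_gaussian v =
     (if v = 0 then return borel 0 else density lborel (normal_density 0 (sqrt v)))"

text \<open>Matrices of type \<open>mat\<close> are indexed from \<open>0\<close>, the entry families below from \<open>1\<close>.\<close>
definition sym_matrix :: "nat \<Rightarrow> (nat \<Rightarrow> nat \<Rightarrow> real) \<Rightarrow> real mat" where
  "sym_matrix n x =
     mat n n (\<lambda>(i, j). if i \<ge> j then x (i + 1) (j + 1) else x (j + 1) (i + 1))"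

definition normalized_sym_matrix :: "nat \<Rightarrow> (nat \<Rightarrow> nat \<Rightarrow> real) \<Rightarrow> real mat" where
  "normalized_sym_matrix n x = (1 / sqrt (real n)) \<cdot>\<^sub>m sym_matrix n x"

definition mat_trace :: "'a :: comm_monoid_add mat \<Rightarrow> 'a" where
  "mat_trace A = (\<Sum>i<dim_row A. A $$ (i, i))"

text \<open>
  The inverse exists for symmetric \<open>A\<close> and non-real \<open>z\<close>, which is the only case of interest.
\<close>
definition stieltjes :: "real mat \<Rightarrow> complex \<Rightarrow> complex" where
  "stieltjes A z =
     1 / of_nat (dim_row A) *
     mat_trace (the (mat_inverse (map_mat complex_of_real A - z \<cdot>\<^sub>m 1\<^sub>m (dim_row A))))"

definition tendsto_in_probability ::
    "'a measure \<Rightarrow> (nat \<Rightarrow> 'a \<Rightarrow> complex) \<Rightarrow> ('a \<Rightarrow> complex) \<Rightarrow> bool" where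
  "tendsto_in_probability M Z L \<longleftrightarrow>
     (\<forall>n. Z n \<in> borel_measurable M) \<and> L \<in> borel_measurable M \<and>
     (\<forall>\<delta>>0. (\<lambda>n. measure M {\<omega> \<in> space M. cmod (Z n \<omega> - L \<omega>) > \<delta>}) \<longlonglongrightarrow> 0)"

end

theory Submission
  imports Defs "Jordan_Normal_Form.Determinant"
begin

text \<open>
  Let \<open>s\<close> be the Stieltjes transform as a function of the entries, \<open>c = E s(Y)\<close> and
  \<open>G = |s - c|\<^sup>2\<close>; it is enough that \<open>E G(X)\<close> and \<open>E G(Y)\<close> tend to \<open>0\<close>. The second is the
  variance of a Lipschitz function of independent variables. For \<open>E G(X) - E G(Y) \<rightarrow> 0\<close> the
  entries are exchanged one at a time in lexicographic order (Lindeberg). The iterated resolvent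
  identity gives the second-order expansion of \<open>G\<close> in one entry \<open>t\<close>, whose \<open>t\<^sup>2\<close>-coefficient is
  \<open>O(n\<^bsup>-2\<^esup>)\<close> and whose remainder is \<open>O(n\<^bsup>-2\<^esup> t\<^sup>2 min(1, |t| / \<surd>n))\<close>; keeping the minimum makes
  a truncation of the entries superfluous. The first-order term vanishes by the martingale
  difference condition. In the second-order term the entries at distance less than \<open>a\<close> are set to
  \<open>0\<close>, which costs only \<open>min(1, |X\<^sub>m| / \<surd>n)\<close> for each of them, and what remains is measurable
  with respect to the \<open>\<sigma>\<close>-algebra at distance \<open>a\<close>.
\<close>

subsection \<open>Resolvents of symmetric matrices\<close>

text \<open>Concentration is at hand only for the Gaussian matrix: the entries \<open>X\<close> are
  dependent, and closeness of the means of the two transforms would say nothing about their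
  fluctuations. So the exchanged function is the squared deviation from the Gaussian mean itself,
  and its smallness is carried over from \<open>Y\<close> to \<open>X\<close>. The powers of
  \<open>n\<close> balance exactly: the variances sum to O(n^2), so a t^2-coefficient of order n^-2
  gives a bounded total, and smallness must come from the conditional variances and from the minimum
  in the remainder. Each resolvent identity contributes n^(-1/2) and the normalized trace 1/n;
  nothing is lost because rows and columns of a resolvent are bounded in Euclidean norm, so that
  entries of products of resolvents are bounded uniformly in \<open>n\<close>. The two families are
  averaged over separate sample points, the Gaussian one inside. This leaves functions of the past
  \<open>X\<close> entries alone, to which the conditional expectations apply. The distance
  \<open>a\<close> is fixed before the tail level \<epsilon>, since the number of neighbours grows
  with \<open>a\<close>.\<close>

definition is_resolvent ::
    "nat \<Rightarrow> (nat \<Rightarrow> nat \<Rightarrow> real) \<Rightarrow> complex \<Rightarrow> (nat \<Rightarrow> nat \<Rightarrow> complex) \<Rightarrow> bool" where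
  "is_resolvent n h z R \<longleftrightarrow>
     (\<forall>i<n. \<forall>j<n. (\<Sum>l<n. (of_real (h i l) - (if i = l then z else 0)) * R l j)
        = (if i = j then 1 else 0)) \<and>
     (\<forall>i<n. \<forall>j<n. (\<Sum>l<n. R i l * (of_real (h l j) - (if l = j then z else 0)))
        = (if i = j then 1 else 0))"

text \<open>Pair the system with \<open>r\<close>: the quadratic form of a real symmetric matrix is
  real, so the imaginary part of the pairing is \<open>- Im z\<close> times the squared norm of
  \<open>r\<close>. With a unit vector for \<open>b\<close> this bounds the resolvent, with
  \<open>b = 0\<close> it gives invertibility.\<close>

lemma shifted_symmetric_system_bound:
  fixes r b :: "nat \<Rightarrow> complex"
  assumes sym: "\<And>i j. i < n \<Longrightarrow> j < n \<Longrightarrow> h i j = h j i" and z: "Im z > 0"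
    and eq: "\<And>i. i < n \<Longrightarrow> (\<Sum>l<n. (of_real (h i l) - (if i = l then z else 0)) * r l) = b i"
  shows "Im z * (\<Sum>i<n. (cmod (r i))\<^sup>2) \<le> cmod (\<Sum>i<n. cnj (r i) * b i)"
proof -
  define q where "q = (\<Sum>i<n. \<Sum>l<n. cnj (r i) * (of_real (h i l) * r l))"
  have "(\<Sum>i<n. cnj (r i) * b i)
      = (\<Sum>i<n. \<Sum>l<n. cnj (r i) * ((of_real (h i l) - (if i = l then z else 0)) * r l))"
    by (intro sum.cong refl) (simp add: eq[symmetric] sum_distrib_left)
  also have "\<dots> = q - (\<Sum>i<n. \<Sum>l<n. cnj (r i) * ((if i = l then z else 0) * r l))"
    unfolding q_def by (simp add: sum_subtractf[symmetric] algebra_simps)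
  also have "(\<Sum>i<n. \<Sum>l<n. cnj (r i) * ((if i = l then z else 0) * r l))
      = (\<Sum>i<n. z * of_real ((cmod (r i))\<^sup>2))"
  proof (intro sum.cong refl)
    fix i assume i: "i \<in> {..<n}"
    have "(\<Sum>l<n. cnj (r i) * ((if i = l then z else 0) * r l))
        = (\<Sum>l<n. if i = l then cnj (r i) * (z * r l) else 0)"
      by (intro sum.cong) auto
    also have "\<dots> = cnj (r i) * (z * r i)" using i by simp
    also have "\<dots> = z * (r i * cnj (r i))" by (simp add: mult_ac)
    also have "r i * cnj (r i) = of_real ((cmod (r i))\<^sup>2)" by (simp add: complex_norm_square[symmetric])
    finally show "(\<Sum>l<n. cnj (r i) * ((if i = l then z else 0) * r l))
      = z * of_real ((cmod (r i))\<^sup>2)" .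
  qed
  also have "\<dots> = z * of_real (\<Sum>i<n. (cmod (r i))\<^sup>2)"
    by (simp add: sum_distrib_left)
  finally have main: "(\<Sum>i<n. cnj (r i) * b i) = q - z * of_real (\<Sum>i<n. (cmod (r i))\<^sup>2)" .
  have "cnj q = (\<Sum>i<n. \<Sum>l<n. r i * (of_real (h i l) * cnj (r l)))"
    unfolding q_def by simp
  also have "\<dots> = (\<Sum>l<n. \<Sum>i<n. r i * (of_real (h i l) * cnj (r l)))"
    by (rule sum.swap)
  also have "\<dots> = q"
    unfolding q_def by (intro sum.cong refl) (auto simp: sym mult_ac)
  finally have "Im q = 0"
    by (metis Reals_cnj_iff complex_is_Real_iff)
  then have "\<bar>Im (\<Sum>i<n. cnj (r i) * b i)\<bar> = \<bar>Im z * (\<Sum>i<n. (cmod (r i))\<^sup>2)\<bar>"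
    unfolding main by simp
  also have "\<dots> = Im z * (\<Sum>i<n. (cmod (r i))\<^sup>2)"
    using z by (simp add: sum_nonneg)
  finally show ?thesis using abs_Im_le_cmod by metis
qed

text \<open>With a unit vector on the right the pairing is a single coordinate of \<open>r\<close>,
  at most the norm of \<open>r\<close>; one power of the norm then cancels.\<close>

lemma resolvent_column_L2:
  fixes r :: "nat \<Rightarrow> complex"
  assumes sym: "\<And>i j. i < n \<Longrightarrow> j < n \<Longrightarrow> h i j = h j i" and z: "Im z > 0" and j: "j < n"
    and eq: "\<And>i. i < n \<Longrightarrow> (\<Sum>l<n. (of_real (h i l) - (if i = l then z else 0)) * r l)
      = (if i = j then 1 else 0)"
  shows "L2_set (\<lambda>i. cmod (r i)) {..<n} \<le> 1 / Im z"
proof -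
  let ?S = "L2_set (\<lambda>i. cmod (r i)) {..<n}"
  have "Im z * (\<Sum>i<n. (cmod (r i))\<^sup>2) \<le> cmod (\<Sum>i<n. cnj (r i) * (if i = j then 1 else 0))"
    by (rule shifted_symmetric_system_bound[OF sym z eq])
  also have "(\<Sum>i<n. cnj (r i) * (if i = j then 1 else 0)) = (\<Sum>i<n. if i = j then cnj (r i) else 0)"
    by (intro sum.cong) auto
  also have "\<dots> = cnj (r j)" using j by simp
  also have "cmod (cnj (r j)) \<le> ?S"
    using member_le_L2_set[of "{..<n}" j "\<lambda>i. cmod (r i)"] j by simp
  finally have 1: "Im z * (\<Sum>i<n. (cmod (r i))\<^sup>2) \<le> ?S" .
  have "?S\<^sup>2 = (\<Sum>i<n. (cmod (r i))\<^sup>2)"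
    by (simp add: L2_set_def sum_nonneg)
  with 1 have 2: "(Im z * ?S) * ?S \<le> 1 * ?S" by (metis mult.assoc power2_eq_square mult_1)
  show ?thesis
  proof (cases "?S = 0")
    case True then show ?thesis using z by simp
  next
    case False
    then have "?S > 0" using L2_set_nonneg[of "\<lambda>i. cmod (r i)" "{..<n}"] by linarith
    then have "Im z * ?S \<le> 1" using 2 mult_le_cancel_right_pos by blast
    then show ?thesis using z by (simp add: field_simps)
  qed
qed

lemma norm_sum_mult_le_L2:
  fixes f g :: "nat \<Rightarrow> complex"
  assumes "L2_set (\<lambda>i. cmod (f i)) A \<le> w" "L2_set (\<lambda>i. cmod (g i)) A \<le> w'"
  shows "cmod (\<Sum>i\<in>A. f i * g i) \<le> w * w'"
proof -
  have "cmod (\<Sum>i\<in>A. f i * g i) \<le> (\<Sum>i\<in>A. cmod (f i * g i))" by (rule norm_sum)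
  also have "\<dots> = (\<Sum>i\<in>A. \<bar>cmod (f i)\<bar> * \<bar>cmod (g i)\<bar>)" by (simp add: norm_mult)
  also have "\<dots> \<le> L2_set (\<lambda>i. cmod (f i)) A * L2_set (\<lambda>i. cmod (g i)) A"
    by (rule L2_set_mult_ineq)
  also have "\<dots> \<le> w * w'"
    using assms L2_set_nonneg[of "\<lambda>i. cmod (f i)" A] L2_set_nonneg[of "\<lambda>i. cmod (g i)" A]
    by (intro mult_mono) linarith+
  finally show ?thesis .
qed

text \<open>By symmetry of \<open>h\<close> a row of \<open>R\<close> solves the same system as a
  column; this is read off from the left-inverse half of \<open>is_resolvent\<close>.\<close>

lemma resolvent_L2:
  assumes R: "is_resolvent n h z R"
    and sym: "\<And>i j. i < n \<Longrightarrow> j < n \<Longrightarrow> h i j = h j i" and z: "Im z > 0" and j: "j < n"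
  shows "L2_set (\<lambda>i. cmod (R i j)) {..<n} \<le> 1 / Im z"
    and "L2_set (\<lambda>i. cmod (R j i)) {..<n} \<le> 1 / Im z"
proof -
  show "L2_set (\<lambda>i. cmod (R i j)) {..<n} \<le> 1 / Im z"
    by (rule resolvent_column_L2[where h = h, OF sym z j]) (use R j in \<open>auto simp: is_resolvent_def\<close>)
  show "L2_set (\<lambda>i. cmod (R j i)) {..<n} \<le> 1 / Im z"
  proof (rule resolvent_column_L2[where h = h, OF sym z j])
    fix i assume i: "i < n"
    have "(\<Sum>l<n. (of_real (h i l) - (if i = l then z else 0)) * R j l)
        = (\<Sum>l<n. R j l * (of_real (h l i) - (if l = i then z else 0)))"
      using i by (intro sum.cong refl) (auto simp: sym mult_ac)
    also have "\<dots> = (if i = j then 1 else 0)"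
      using R i j by (auto simp: is_resolvent_def)
    finally show "(\<Sum>l<n. (of_real (h i l) - (if i = l then z else 0)) * R j l) = (if i = j then 1 else 0)" .
  qed
qed

lemma resolvent_entry_bound:
  assumes R: "is_resolvent n h z R"
    and sym: "\<And>i j. i < n \<Longrightarrow> j < n \<Longrightarrow> h i j = h j i" and z: "Im z > 0" and "i < n" "j < n"
  shows "cmod (R i j) \<le> 1 / Im z"
  using member_le_L2_set[of "{..<n}" i "\<lambda>i. cmod (R i j)"] resolvent_L2(1)[OF R sym z, of j] assms(4,5)
  by simp

text \<open>Cauchy-Schwarz on a row and a column. Bounding the \<open>n\<close> summands one by one
  would cost a factor \<open>n\<close>, which the expansion cannot afford.\<close>

lemma resolvent_product_bound:
  assumes R: "is_resolvent n h z R" and R': "is_resolvent n h' z R'"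
    and sym: "\<And>i j. i < n \<Longrightarrow> j < n \<Longrightarrow> h i j = h j i"
    and sym': "\<And>i j. i < n \<Longrightarrow> j < n \<Longrightarrow> h' i j = h' j i" and z: "Im z > 0" and "i < n" "j < n"
  shows "cmod (\<Sum>a<n. R i a * R' a j) \<le> (1 / Im z) * (1 / Im z)"
  by (rule norm_sum_mult_le_L2[OF resolvent_L2(2)[OF R sym z] resolvent_L2(1)[OF R' sym' z]])
     (use assms in auto)

text \<open>Write R' as R' (h - z) R and R as R' (h' - z) R; in the difference \<open>z\<close>
  cancels and only the positions in \<open>P\<close> survive. A set \<open>P\<close> treats the two
  mirror positions of an entry, or its one diagonal position, in a single step.\<close>

lemma resolvent_identity:
  assumes R: "is_resolvent n h z R" and R': "is_resolvent n h' z R'"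
    and P: "P \<subseteq> {..<n} \<times> {..<n}"
    and h': "\<And>i j. i < n \<Longrightarrow> j < n \<Longrightarrow> h' i j = h i j + (if (i, j) \<in> P then \<tau> else 0)"
    and a: "a < n" and b: "b < n"
  shows "R' a b - R a b = - of_real \<tau> * (\<Sum>\<pi>\<in>P. R' a (fst \<pi>) * R (snd \<pi>) b)"
proof -
  have "R' a b = (\<Sum>i<n. R' a i * (if i = b then 1 else 0))"
    using b by (simp add: if_distrib[of "\<lambda>x. _ * x"] cong: if_cong)
  also have "\<dots> = (\<Sum>i<n. \<Sum>l<n. R' a i * ((of_real (h i l) - (if i = l then z else 0)) * R l b))"
    using R b by (intro sum.cong refl) (simp add: is_resolvent_def sum_distrib_left[symmetric])
  finally have 1: "R' a b = \<dots>" .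
  have "R a b = (\<Sum>l<n. (if a = l then 1 else 0) * R l b)"
    using a by (simp add: if_distrib[of "\<lambda>x. x * _"] cong: if_cong)
  also have "\<dots> = (\<Sum>l<n. \<Sum>i<n. (R' a i * (of_real (h' i l) - (if i = l then z else 0))) * R l b)"
    using R' a by (intro sum.cong refl) (simp add: is_resolvent_def sum_distrib_right[symmetric])
  also have "\<dots> = (\<Sum>i<n. \<Sum>l<n. (R' a i * (of_real (h' i l) - (if i = l then z else 0))) * R l b)"
    by (rule sum.swap)
  finally have 2: "R a b = \<dots>" .
  have "R' a b - R a b
      = (\<Sum>i<n. \<Sum>l<n. if (i, l) \<in> P then - of_real \<tau> * (R' a i * R l b) else 0)"
    unfolding 1 2 sum_subtractf[symmetric]
    by (intro sum.cong refl) (auto simp: h' algebra_simps)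
  also have "\<dots> = (\<Sum>\<pi>\<in>{..<n}\<times>{..<n}. if \<pi> \<in> P then - of_real \<tau> * (R' a (fst \<pi>) * R (snd \<pi>) b) else 0)"
    by (simp add: sum.cartesian_product case_prod_beta)
  also have "\<dots> = (\<Sum>\<pi>\<in>P. - of_real \<tau> * (R' a (fst \<pi>) * R (snd \<pi>) b))"
    using P by (simp add: sum.inter_restrict[symmetric] Int_absorb1)
  finally show ?thesis by (simp add: sum_distrib_left)
qed

text \<open>The same identity with the roles exchanged and the opposite shift, so that the
  unperturbed factor stands on the left.\<close>

lemma resolvent_identity':
  assumes R: "is_resolvent n h z R" and R': "is_resolvent n h' z R'"
    and P: "P \<subseteq> {..<n} \<times> {..<n}"
    and h': "\<And>i j. i < n \<Longrightarrow> j < n \<Longrightarrow> h' i j = h i j + (if (i, j) \<in> P then \<tau> else 0)"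
    and a: "a < n" and b: "b < n"
  shows "R' a b - R a b = - of_real \<tau> * (\<Sum>\<pi>\<in>P. R a (fst \<pi>) * R' (snd \<pi>) b)"
  using resolvent_identity[OF R' R P, of "-\<tau>" a b] h' a b by (simp add: algebra_simps)

section \<open>The resolvent of the normalized matrix and its measurability\<close>

definition normalized_entry :: "nat \<Rightarrow> (int \<times> int \<Rightarrow> real) \<Rightarrow> nat \<Rightarrow> nat \<Rightarrow> real" where
  "normalized_entry n x i j =
     (if j \<le> i then x (int i + 1, int j + 1) else x (int j + 1, int i + 1)) / sqrt (real n)"

definition shifted_matrix :: "nat \<Rightarrow> complex \<Rightarrow> (int \<times> int \<Rightarrow> real) \<Rightarrow> complex mat" where
  "shifted_matrix n z x = map_mat complex_of_real
     (normalized_sym_matrix n (\<lambda>i j. x (int i, int j))) - z \<cdot>\<^sub>m 1\<^sub>m n"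

definition resolvent :: "nat \<Rightarrow> complex \<Rightarrow> (int \<times> int \<Rightarrow> real) \<Rightarrow> nat \<Rightarrow> nat \<Rightarrow> complex" where
  "resolvent n z x a b = the (mat_inverse (shifted_matrix n z x)) $$ (a, b)"

lemma normalized_entry_sym: "normalized_entry n x i j = normalized_entry n x j i"
  by (auto simp: normalized_entry_def)

lemma shifted_matrix_carrier: "shifted_matrix n z x \<in> carrier_mat n n"
  unfolding shifted_matrix_def by (rule minus_carrier_mat) simp

lemma shifted_matrix_entry:
  "i < n \<Longrightarrow> j < n \<Longrightarrow>
     shifted_matrix n z x $$ (i, j) = of_real (normalized_entry n x i j) - (if i = j then z else 0)"
  by (auto simp: shifted_matrix_def normalized_sym_matrix_def sym_matrix_def normalized_entry_def add_ac)

text \<open>A kernel vector solves the system with right-hand side 0, and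
  \<open>shifted_symmetric_system_bound\<close> then forces it to vanish.\<close>

lemma det_shifted_matrix_nonzero:
  assumes z: "Im z > 0"
  shows "Determinant.det (shifted_matrix n z x) \<noteq> 0"
proof
  assume "Determinant.det (shifted_matrix n z x) = 0"
  then obtain v where v: "v \<in> carrier_vec n" "v \<noteq> 0\<^sub>v n" "shifted_matrix n z x *\<^sub>v v = 0\<^sub>v n"
    using det_0_iff_vec_prod_zero[OF shifted_matrix_carrier] by blast
  have "Im z * (\<Sum>i<n. (cmod (v $ i))\<^sup>2) \<le> cmod (\<Sum>i<n. cnj (v $ i) * (\<lambda>_. 0) i)"
  proof (rule shifted_symmetric_system_bound[where h = "normalized_entry n x"])
    fix i assume i: "i < n"
    have "0 = (shifted_matrix n z x *\<^sub>v v) $ i" using v i by simp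
    also have "\<dots> = (\<Sum>l<n. shifted_matrix n z x $$ (i, l) * v $ l)"
      using i v(1) shifted_matrix_carrier[of n z x]
      by (simp add: mult_mat_vec_def scalar_prod_def atLeast0LessThan)
    also have "\<dots> = (\<Sum>l<n. (of_real (normalized_entry n x i l) - (if i = l then z else 0)) * v $ l)"
      using i by (intro sum.cong) (auto simp: shifted_matrix_entry)
    finally show "(\<Sum>l<n. (of_real (normalized_entry n x i l) - (if i = l then z else 0)) * v $ l) = 0"
      by simp
  qed (use z in \<open>auto simp: normalized_entry_sym\<close>)
  then have "(\<Sum>i<n. (cmod (v $ i))\<^sup>2) \<le> 0"
    using z by (simp add: mult_le_0_iff)
  then have "\<forall>i<n. v $ i = 0"
    using sum_nonneg_eq_0_iff[of "{..<n}" "\<lambda>i. (cmod (v $ i))\<^sup>2"]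
      sum_nonneg[of "{..<n}" "\<lambda>i. (cmod (v $ i))\<^sup>2"] by auto
  then show False using v by (metis carrier_vecD eq_vecI index_zero_vec(1,2))
qed

lemma mat_inverse_shifted_matrix:
  assumes z: "Im z > 0"
  obtains B where "mat_inverse (shifted_matrix n z x) = Some B" "B \<in> carrier_mat n n"
    "shifted_matrix n z x * B = 1\<^sub>m n" "B * shifted_matrix n z x = 1\<^sub>m n"
proof -
  have "shifted_matrix n z x \<in> Units (ring_mat TYPE(complex) n ())"
    by (rule det_non_zero_imp_unit[OF shifted_matrix_carrier det_shifted_matrix_nonzero[OF z]])
  then obtain B where "mat_inverse (shifted_matrix n z x) = Some B"
    using mat_inverse(1)[OF shifted_matrix_carrier] by (metis not_None_eq)
  then show ?thesis using that mat_inverse(2)[OF shifted_matrix_carrier] by blast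
qed

lemma resolvent_is_resolvent:
  assumes z: "Im z > 0"
  shows "is_resolvent n (normalized_entry n x) z (resolvent n z x)"
proof -
  obtain B where B: "mat_inverse (shifted_matrix n z x) = Some B" "B \<in> carrier_mat n n"
    "shifted_matrix n z x * B = 1\<^sub>m n" "B * shifted_matrix n z x = 1\<^sub>m n"
    by (rule mat_inverse_shifted_matrix[OF z])
  let ?A = "shifted_matrix n z x"
  have A: "?A \<in> carrier_mat n n" by (rule shifted_matrix_carrier)
  have mult: "(C * D) $$ (i, j) = (\<Sum>l<n. C $$ (i, l) * D $$ (l, j))"
    if "C \<in> carrier_mat n n" "D \<in> carrier_mat n n" "i < n" "j < n" for C D :: "complex mat" and i j
    using that by (simp add: times_mat_def scalar_prod_def atLeast0LessThan)
  show ?thesis unfolding is_resolvent_def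
  proof (intro conjI allI impI)
    fix i j assume ij: "i < n" "j < n"
    have "(\<Sum>l<n. (of_real (normalized_entry n x i l) - (if i = l then z else 0)) * resolvent n z x l j)
        = (?A * B) $$ (i, j)"
      using ij by (simp add: mult[OF A B(2)] shifted_matrix_entry resolvent_def B(1))
    then show "(\<Sum>l<n. (of_real (normalized_entry n x i l) - (if i = l then z else 0)) * resolvent n z x l j)
        = (if i = j then 1 else 0)"
      using ij by (simp add: B(3))
    have "(\<Sum>l<n. resolvent n z x i l * (of_real (normalized_entry n x l j) - (if l = j then z else 0)))
        = (B * ?A) $$ (i, j)"
      using ij by (simp add: mult[OF B(2) A] shifted_matrix_entry resolvent_def B(1))
    then show "(\<Sum>l<n. resolvent n z x i l * (of_real (normalized_entry n x l j) - (if l = j then z else 0)))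
        = (if i = j then 1 else 0)"
      using ij by (simp add: B(4))
  qed
qed

text \<open>Cramer's rule serves measurability: it shows each entry of the inverse to be a quotient
  of two polynomials in the matrix entries, whereas \<open>mat_inverse\<close> is given by an
  elimination procedure.\<close>

lemma resolvent_eq_cofactor:
  assumes z: "Im z > 0" and ab: "a < n" "b < n"
  shows "resolvent n z x a b =
    cofactor (shifted_matrix n z x) b a / Determinant.det (shifted_matrix n z x)"
proof -
  let ?A = "shifted_matrix n z x"
  obtain B where B: "mat_inverse ?A = Some B" "B \<in> carrier_mat n n"
    "?A * B = 1\<^sub>m n" "B * ?A = 1\<^sub>m n"
    by (rule mat_inverse_shifted_matrix[OF z])
  have A: "?A \<in> carrier_mat n n" by (rule shifted_matrix_carrier)
  have "adj_mat ?A = (B * ?A) * adj_mat ?A" using adj_mat(1)[OF A] B by simp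
  also have "\<dots> = B * (?A * adj_mat ?A)" using assoc_mult_mat B(2) A adj_mat(1)[OF A] by blast
  also have "\<dots> = Determinant.det ?A \<cdot>\<^sub>m B" 
    using B(2) mult_smult_distrib[OF B(2) one_carrier_mat] by (simp add: adj_mat(2)[OF A])
  finally have "adj_mat ?A $$ (a, b) = Determinant.det ?A * B $$ (a, b)"
    using B(2) ab by simp
  then show ?thesis
    using ab A det_shifted_matrix_nonzero[OF z, of n x]
    by (simp add: resolvent_def B(1) adj_mat_def field_simps)
qed

lemma measurable_det:
  fixes A :: "'b \<Rightarrow> complex mat"
  assumes "\<And>\<omega>. A \<omega> \<in> carrier_mat n n"
    and "\<And>i j. i < n \<Longrightarrow> j < n \<Longrightarrow> (\<lambda>\<omega>. A \<omega> $$ (i, j)) \<in> borel_measurable N"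
  shows "(\<lambda>\<omega>. Determinant.det (A \<omega>)) \<in> borel_measurable N"
  unfolding det_def'[OF assms(1)]
  by (intro borel_measurable_sum borel_measurable_times borel_measurable_const borel_measurable_prod
        assms(2)) (auto dest: permutes_in_image)

lemma measurable_shifted_matrix_entry:
  assumes "i < n" "j < n"
  shows "(\<lambda>x. shifted_matrix n z x $$ (i, j)) \<in> borel_measurable (PiM UNIV (\<lambda>_. borel))"
proof -
  have [measurable]: "(\<lambda>x. x p) \<in> borel_measurable (PiM UNIV (\<lambda>_. borel :: real measure))" for p :: "int \<times> int"
    by (rule measurable_component_singleton) simp
  show ?thesis
    unfolding shifted_matrix_entry[OF assms] normalized_entry_def by measurable
qed

lemma measurable_resolvent:
  assumes z: "Im z > 0" and ab: "a < n" "b < n"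
  shows "(\<lambda>x. resolvent n z x a b) \<in> borel_measurable (PiM UNIV (\<lambda>_. borel))"
  unfolding resolvent_eq_cofactor[OF assms] cofactor_def
proof (intro borel_measurable_divide borel_measurable_times borel_measurable_const)
  show "(\<lambda>x. Determinant.det (shifted_matrix n z x)) \<in> borel_measurable (PiM UNIV (\<lambda>_. borel))"
    by (rule measurable_det[OF shifted_matrix_carrier]) (rule measurable_shifted_matrix_entry)
  show "(\<lambda>x. Determinant.det (mat_delete (shifted_matrix n z x) b a)) \<in> borel_measurable (PiM UNIV (\<lambda>_. borel))"
  proof (rule measurable_det[where n = "n - 1"])
    show "mat_delete (shifted_matrix n z x) b a \<in> carrier_mat (n - 1) (n - 1)" for x
      using shifted_matrix_carrier[of n z x] by (simp add: mat_delete_def)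
    show "(\<lambda>x. mat_delete (shifted_matrix n z x) b a $$ (i, j)) \<in> borel_measurable (PiM UNIV (\<lambda>_. borel))"
      if "i < n - 1" "j < n - 1" for i j
    proof -
      \<comment> \<open>Deleting row \<open>b\<close> and column \<open>a\<close> shifts the later
        indices by one, independently of \<open>x\<close>.\<close>
      have "(\<lambda>x. mat_delete (shifted_matrix n z x) b a $$ (i, j))
        = (\<lambda>x. shifted_matrix n z x $$ (if i < b then i else Suc i, if j < a then j else Suc j))"
        using that carrier_matD[OF shifted_matrix_carrier[of n z]] by (simp add: mat_delete_def)
      then show ?thesis
        using that by (auto intro!: measurable_shifted_matrix_entry)
    qed
  qed
qed

subsection \<open>Expansion of the Stieltjes transform in one entry\<close>

definition lower_triangle :: "nat \<Rightarrow> (int \<times> int) set" where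
  "lower_triangle n = {(i, j). 1 \<le> j \<and> j \<le> i \<and> i \<le> int n}"

text \<open>A set, so that for a diagonal entry the two mirror positions collapse into one and are
  counted once. The shift by 1 passes from entries counted from 1 to matrix indices counted from
  0.\<close>

definition matrix_positions :: "int \<times> int \<Rightarrow> (nat \<times> nat) set" where
  "matrix_positions p =
     {(nat (fst p - 1), nat (snd p - 1)), (nat (snd p - 1), nat (fst p - 1))}"

text \<open>The square of the resolvent enters because the trace is cyclic: summing over the
  diagonal turns two resolvents on either side of the changed position into one entry of their
  product.\<close>

definition resolvent_square :: "nat \<Rightarrow> complex \<Rightarrow> (int \<times> int \<Rightarrow> real) \<Rightarrow> nat \<Rightarrow> nat \<Rightarrow> complex" where
  "resolvent_square n z x q p = (\<Sum>a<n. resolvent n z x q a * resolvent n z x a p)"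

definition stj :: "nat \<Rightarrow> complex \<Rightarrow> (int \<times> int \<Rightarrow> real) \<Rightarrow> complex" where
  "stj n z x = (\<Sum>a<n. resolvent n z x a a) / of_nat n"

text \<open>The coefficients of \<open>t\<close> and \<open>t\<^sup>2\<close> in the Neumann expansion of \<open>stj n z (x(p := x p + t))\<close>.\<close>
definition stj_coeff1 :: "nat \<Rightarrow> complex \<Rightarrow> int \<times> int \<Rightarrow> (int \<times> int \<Rightarrow> real) \<Rightarrow> complex" where
  "stj_coeff1 n z p x = - of_real (1 / (real n * sqrt (real n))) *
     (\<Sum>\<pi>\<in>matrix_positions p. resolvent_square n z x (snd \<pi>) (fst \<pi>))"

definition stj_coeff2 :: "nat \<Rightarrow> complex \<Rightarrow> int \<times> int \<Rightarrow> (int \<times> int \<Rightarrow> real) \<Rightarrow> complex" where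
  "stj_coeff2 n z p x = of_real (1 / (real n)\<^sup>2) *
     (\<Sum>\<pi>\<in>matrix_positions p. \<Sum>\<pi>'\<in>matrix_positions p.
        resolvent_square n z x (snd \<pi>) (fst \<pi>') * resolvent n z x (snd \<pi>') (fst \<pi>))"

definition sq_dev :: "nat \<Rightarrow> complex \<Rightarrow> complex \<Rightarrow> (int \<times> int \<Rightarrow> real) \<Rightarrow> real" where
  "sq_dev n z c x = (cmod (stj n z x - c))\<^sup>2"

definition sq_dev_coeff1 ::
    "nat \<Rightarrow> complex \<Rightarrow> complex \<Rightarrow> int \<times> int \<Rightarrow> (int \<times> int \<Rightarrow> real) \<Rightarrow> real" where
  "sq_dev_coeff1 n z c p x = 2 * Re (cnj (stj n z x - c) * stj_coeff1 n z p x)"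

text \<open>If a number u changes by \<alpha> t + \<beta> t^2, its squared modulus has the
  t^2-coefficient |\<alpha>|^2 + 2 Re (cnj u \<beta>); here u is the deviation of \<open>stj\<close>
  from \<open>c\<close>.\<close>

definition sq_dev_coeff2 ::
    "nat \<Rightarrow> complex \<Rightarrow> complex \<Rightarrow> int \<times> int \<Rightarrow> (int \<times> int \<Rightarrow> real) \<Rightarrow> real" where
  "sq_dev_coeff2 n z c p x =
     (cmod (stj_coeff1 n z p x))\<^sup>2 + 2 * Re (cnj (stj n z x - c) * stj_coeff2 n z p x)"

definition cutoff :: "nat \<Rightarrow> real \<Rightarrow> real" where
  "cutoff n t = min 1 (\<bar>t\<bar> / sqrt (real n))"

lemma cutoff_nonneg [simp]: "0 \<le> cutoff n t"
  and cutoff_le_1 [simp]: "cutoff n t \<le> 1"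
  by (simp_all add: cutoff_def)

lemma card_matrix_positions: "card (matrix_positions p) \<le> 2"
  by (simp add: matrix_positions_def card_insert_le_m1)

lemma matrix_positions_subset:
  "p \<in> lower_triangle n \<Longrightarrow> matrix_positions p \<subseteq> {..<n} \<times> {..<n}"
  by (auto simp: lower_triangle_def matrix_positions_def)

lemma matrix_positions_bound:
  "p \<in> lower_triangle n \<Longrightarrow> \<pi> \<in> matrix_positions p \<Longrightarrow> fst \<pi> < n \<and> snd \<pi> < n"
  using matrix_positions_subset[of p n] by auto

lemma norm_sum_matrix_positions:
  fixes f :: "nat \<times> nat \<Rightarrow> complex"
  assumes "\<And>\<pi>. \<pi> \<in> matrix_positions p \<Longrightarrow> cmod (f \<pi>) \<le> B" "0 \<le> B"
  shows "cmod (\<Sum>\<pi>\<in>matrix_positions p. f \<pi>) \<le> 2 * B"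
proof -
  have "cmod (\<Sum>\<pi>\<in>matrix_positions p. f \<pi>) \<le> of_nat (card (matrix_positions p)) * B"
    using assms(1) by (rule sum_norm_bound)
  also have "\<dots> \<le> 2 * B" using card_matrix_positions[of p] assms(2) by (intro mult_right_mono) auto
  finally show ?thesis .
qed

text \<open>All entries live in one function on \<open>int \<times> int\<close>, so changing one
  random variable is a function update, even though up to two matrix positions move.\<close>

lemma normalized_entry_update:
  assumes "p \<in> lower_triangle n"
  shows "normalized_entry n (x(p := t)) i j
    = normalized_entry n x i j + (if (i, j) \<in> matrix_positions p then (t - x p) / sqrt (real n) else 0)"
proof -
  obtain u v where p: "p = (u, v)" "1 \<le> v" "v \<le> u" using assms by (auto simp: lower_triangle_def)
  have 1: "(i, j) \<in> matrix_positions p \<longleftrightarrow> (if j \<le> i then (int i + 1, int j + 1) else (int j + 1, int i + 1)) = p"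
    using p by (auto simp: matrix_positions_def)
  show ?thesis unfolding 1 by (auto simp: normalized_entry_def diff_divide_distrib)
qed

text \<open>Expanding the square leaves 2 Re (cnj u r) and |d|^2 - |\<alpha>|^2. The latter factors
  as a difference times a sum; the difference is bounded by order |\<tau>| through
  \<open>dn\<close>, and by order \<tau>^2 through \<beta> and \<open>r\<close>, and these yield the
  two branches of \<open>\<rho>\<close>. The bound \<open>dn\<close> is a separate hypothesis
  because the expansion of \<open>d\<close> alone gives terms in \<tau>^2, too large for large
  \<tau>. The constant 80 is 2 * 16 + 48.\<close>

lemma norm_square_expansion_bound:
  fixes u \<alpha> \<beta> r d :: complex and N W \<tau> \<rho> :: real
  assumes d: "d = \<alpha> + \<beta> + r" and W: "1 \<le> W" and N: "1 \<le> N" and \<rho>: "\<rho> = min 1 \<bar>\<tau>\<bar>"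
    and u: "cmod u \<le> 2 * W" and \<alpha>: "cmod \<alpha> \<le> 2 * W^2 * \<bar>\<tau>\<bar> / N" and \<beta>: "cmod \<beta> \<le> 4 * W^3 * \<tau>\<^sup>2 / N"
    and r: "cmod r \<le> 8 * W^4 * \<tau>\<^sup>2 * \<rho> / N" and dn: "cmod d \<le> 2 * W^2 * \<bar>\<tau>\<bar> / N"
  shows "\<bar>(cmod (u + d))\<^sup>2 - (cmod u)\<^sup>2 - 2 * Re (cnj u * (\<alpha> + \<beta>)) - (cmod \<alpha>)\<^sup>2\<bar> \<le> 80 * W^6 * \<tau>\<^sup>2 * \<rho> / N"
proof -
  have \<rho>01: "0 \<le> \<rho>" "\<rho> \<le> 1" using \<rho> by auto
  have pW: "W^a \<le> W^b" if "a \<le> b" for a b using W that by (rule power_increasing[rotated])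
  have "(cmod (u + d))\<^sup>2 = (cmod u)\<^sup>2 + 2 * Re (cnj u * d) + (cmod d)\<^sup>2"
    unfolding cmod_power2 by (simp add: power2_eq_square algebra_simps)
  then have eq: "(cmod (u + d))\<^sup>2 - (cmod u)\<^sup>2 - 2 * Re (cnj u * (\<alpha> + \<beta>)) - (cmod \<alpha>)\<^sup>2
      = 2 * Re (cnj u * r) + ((cmod d)\<^sup>2 - (cmod \<alpha>)\<^sup>2)"
    unfolding d by (simp add: algebra_simps)
  have "\<bar>Re (cnj u * r)\<bar> \<le> cmod u * cmod r"
    using abs_Re_le_cmod[of "cnj u * r"] by (simp add: norm_mult)
  also have "\<dots> \<le> (2 * W) * (8 * W^4 * \<tau>\<^sup>2 * \<rho> / N)"
    using u r W by (intro mult_mono) auto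
  also have "\<dots> = 16 * W^5 * (\<tau>\<^sup>2 * \<rho> / N)" by (simp add: power_eq_if)
  also have "\<dots> \<le> 16 * W^6 * (\<tau>\<^sup>2 * \<rho> / N)"
    using pW[of 5 6] \<rho>01 N by (intro mult_right_mono) auto
  finally have t1: "\<bar>Re (cnj u * r)\<bar> \<le> 16 * W^6 * (\<tau>\<^sup>2 * \<rho> / N)" .
  have "cmod (d - \<alpha>) \<le> cmod \<beta> + cmod r" unfolding d using norm_triangle_ineq[of \<beta> r] by simp
  also have "\<dots> \<le> 4 * W^3 * \<tau>\<^sup>2 / N + 8 * W^4 * \<tau>\<^sup>2 * \<rho> / N" using \<beta> r by simp
  also have "\<dots> \<le> 4 * W^4 * \<tau>\<^sup>2 / N + 8 * W^4 * \<tau>\<^sup>2 * 1 / N"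
    using pW[of 3 4] \<rho>01 N W by (intro add_mono divide_right_mono mult_mono mult_right_mono) auto
  finally have a1: "cmod (d - \<alpha>) \<le> 12 * W^4 * \<tau>\<^sup>2 / N" by (simp add: mult_ac)
  have four: "4 * W^2 * \<bar>\<tau>\<bar> / N = 2 * W^2 * \<bar>\<tau>\<bar> / N + 2 * W^2 * \<bar>\<tau>\<bar> / N"
    by (simp add: add_divide_distrib[symmetric])
  have a2: "cmod (d - \<alpha>) \<le> 4 * W^2 * \<bar>\<tau>\<bar> / N"
    using norm_triangle_ineq4[of d \<alpha>] \<alpha> dn unfolding four by linarith
  have a3: "cmod d + cmod \<alpha> \<le> 4 * W^2 * \<bar>\<tau>\<bar> / N" using \<alpha> dn unfolding four by linarith
  have "(cmod d)\<^sup>2 - (cmod \<alpha>)\<^sup>2 = (cmod d - cmod \<alpha>) * (cmod d + cmod \<alpha>)"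
    by (simp add: power2_eq_square algebra_simps)
  then have "\<bar>(cmod d)\<^sup>2 - (cmod \<alpha>)\<^sup>2\<bar> = \<bar>cmod d - cmod \<alpha>\<bar> * (cmod d + cmod \<alpha>)"
    by (simp add: abs_mult)
  also have "\<dots> \<le> cmod (d - \<alpha>) * (4 * W^2 * \<bar>\<tau>\<bar> / N)"
    using a3 norm_triangle_ineq3[of d \<alpha>] by (intro mult_mono) auto
  finally have b: "\<bar>(cmod d)\<^sup>2 - (cmod \<alpha>)\<^sup>2\<bar> \<le> cmod (d - \<alpha>) * (4 * W^2 * \<bar>\<tau>\<bar> / N)" .
  have nn: "0 \<le> 4 * W^2 * \<bar>\<tau>\<bar> / N" using N by simp
  have NN: "1 / N \<le> 1" "0 \<le> 1 / N" using N by auto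
  have b1: "cmod (d - \<alpha>) * (4 * W^2 * \<bar>\<tau>\<bar> / N) \<le> 48 * W^6 * (\<tau>\<^sup>2 / N) * 1"
  proof -
    have "cmod (d - \<alpha>) * (4 * W^2 * \<bar>\<tau>\<bar> / N) \<le> (4 * W^2 * \<bar>\<tau>\<bar> / N) * (4 * W^2 * \<bar>\<tau>\<bar> / N)"
      using a2 nn by (rule mult_right_mono)
    also have "\<dots> = 16 * W^4 * (\<tau>\<^sup>2 / N) * (1 / N)" by (simp add: power2_eq_square power4_eq_xxxx)
    also have "\<dots> \<le> 48 * W^6 * (\<tau>\<^sup>2 / N) * 1"
      using pW[of 4 6] NN N W by (intro mult_mono) auto
    finally show ?thesis .
  qed
  have b2: "cmod (d - \<alpha>) * (4 * W^2 * \<bar>\<tau>\<bar> / N) \<le> 48 * W^6 * (\<tau>\<^sup>2 / N) * \<bar>\<tau>\<bar>"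
  proof -
    have "cmod (d - \<alpha>) * (4 * W^2 * \<bar>\<tau>\<bar> / N) \<le> (12 * W^4 * \<tau>\<^sup>2 / N) * (4 * W^2 * \<bar>\<tau>\<bar> / N)"
      using a1 nn by (rule mult_right_mono)
    also have "\<dots> = 48 * W^6 * (\<tau>\<^sup>2 / N) * \<bar>\<tau>\<bar> * (1 / N)" by (simp add: power_eq_if)
    also have "\<dots> \<le> 48 * W^6 * (\<tau>\<^sup>2 / N) * \<bar>\<tau>\<bar> * 1"
      using NN N W by (intro mult_left_mono) auto
    finally show ?thesis by simp
  qed
  have "\<bar>(cmod d)\<^sup>2 - (cmod \<alpha>)\<^sup>2\<bar> \<le> 48 * W^6 * (\<tau>\<^sup>2 / N) * \<rho>"
    using b b1 b2 unfolding \<rho> min_def by auto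
  then have "\<bar>(cmod d)\<^sup>2 - (cmod \<alpha>)\<^sup>2\<bar> \<le> 48 * (W^6 * (\<tau>\<^sup>2 / N * \<rho>))"
    by (simp only: mult.assoc)
  moreover have "\<bar>Re (cnj u * r)\<bar> \<le> 16 * (W^6 * (\<tau>\<^sup>2 / N * \<rho>))"
    using t1 by (simp only: times_divide_eq_left mult.assoc)
  ultimately have "\<bar>2 * Re (cnj u * r) + ((cmod d)\<^sup>2 - (cmod \<alpha>)\<^sup>2)\<bar> \<le> 80 * (W^6 * (\<tau>\<^sup>2 / N * \<rho>))"
    by linarith
  then show ?thesis unfolding eq by (simp add: mult_ac)
qed

section \<open>Neumann expansion in one entry, with bounds uniform in the dimension\<close>

context
  fixes z :: complex and W :: real
  assumes z: "Im z > 0" and W_def: "W = 1 + 1 / Im z"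
begin

text \<open>The summand 1 in \<open>W\<close> makes its powers increase with the exponent, so that
  bounds with different powers merge into one; \<open>1 / Im z\<close> alone may be below 1.\<close>

lemma W_ge_1: "1 \<le> W" and W_ge: "1 / Im z \<le> W"
  using z by (simp_all add: W_def)

lemma power_W_mono: "a \<le> b \<Longrightarrow> W ^ a \<le> W ^ b"
  using W_ge_1 by (rule power_increasing[rotated])

lemma resolvent_bound: "a < n \<Longrightarrow> b < n \<Longrightarrow> cmod (resolvent n z x a b) \<le> W"
  using resolvent_entry_bound[OF resolvent_is_resolvent[OF z, of n x] normalized_entry_sym z] W_ge
  by (meson order_trans)

text \<open>Mixed products arise because each use of the resolvent identity leaves one factor old
  and one factor new.\<close>

lemma mixed_resolvent_square_bound:
  assumes "q < n" "p < n"
  shows "cmod (\<Sum>a<n. resolvent n z x q a * resolvent n z y a p) \<le> W^2"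
proof -
  have "cmod (\<Sum>a<n. resolvent n z x q a * resolvent n z y a p) \<le> 1 / Im z * (1 / Im z)"
    by (rule resolvent_product_bound[OF resolvent_is_resolvent[OF z] resolvent_is_resolvent[OF z]
          normalized_entry_sym normalized_entry_sym z assms])
  also have "\<dots> \<le> W * W" using W_ge W_ge_1 z by (intro mult_mono) auto
  finally show ?thesis by (simp add: power2_eq_square)
qed

lemma resolvent_square_bound: "q < n \<Longrightarrow> p < n \<Longrightarrow> cmod (resolvent_square n z x q p) \<le> W^2"
  unfolding resolvent_square_def by (rule mixed_resolvent_square_bound)

lemma resolvent_update:
  assumes "p \<in> lower_triangle n" "a < n" "b < n"
  shows "resolvent n z (x(p := t)) a b - resolvent n z x a b
    = - of_real ((t - x p) / sqrt n) *
      (\<Sum>\<pi>\<in>matrix_positions p. resolvent n z (x(p := t)) a (fst \<pi>) * resolvent n z x (snd \<pi>) b)"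
  by (rule resolvent_identity[OF resolvent_is_resolvent[OF z] resolvent_is_resolvent[OF z]
        matrix_positions_subset[OF assms(1)] normalized_entry_update[OF assms(1)] assms(2,3)])

lemma resolvent_update':
  assumes "p \<in> lower_triangle n" "a < n" "b < n"
  shows "resolvent n z (x(p := t)) a b - resolvent n z x a b
    = - of_real ((t - x p) / sqrt n) *
      (\<Sum>\<pi>\<in>matrix_positions p. resolvent n z x a (fst \<pi>) * resolvent n z (x(p := t)) (snd \<pi>) b)"
  by (rule resolvent_identity'[OF resolvent_is_resolvent[OF z] resolvent_is_resolvent[OF z]
        matrix_positions_subset[OF assms(1)] normalized_entry_update[OF assms(1)] assms(2,3)])

text \<open>Every change caused by moving one entry is bounded twice with the same \<open>B\<close>:
  trivially, by boundedness, and proportionally to the increment, by the resolvent identity.\<close>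

lemma norm_le_cutoffI:
  fixes v :: complex
  assumes "cmod v \<le> B" "cmod v \<le> \<bar>t\<bar> / sqrt n * B"
  shows "cmod v \<le> B * cutoff n t"
  using assms by (auto simp: cutoff_def min_def mult.commute)

lemma resolvent_diff_bound:
  assumes p: "p \<in> lower_triangle n" and ab: "a < n" "b < n"
  shows "cmod (resolvent n z (x(p := t)) a b - resolvent n z x a b) \<le> 2 * W^2 * cutoff n (t - x p)"
proof (rule norm_le_cutoffI)
  have "cmod (resolvent n z (x(p := t)) a b - resolvent n z x a b) \<le> W + W"
    using ab by (intro norm_diff_triangle_le resolvent_bound norm_triangle_le_diff add_mono) auto
  also have "\<dots> \<le> 2 * W^2" using power_W_mono[of 1 2] by simp
  finally show "cmod (resolvent n z (x(p := t)) a b - resolvent n z x a b) \<le> 2 * W^2" .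
  have "cmod (\<Sum>\<pi>\<in>matrix_positions p. resolvent n z (x(p := t)) a (fst \<pi>) * resolvent n z x (snd \<pi>) b)
      \<le> 2 * (W * W)"
    using matrix_positions_bound[OF p] ab W_ge_1
    by (intro norm_sum_matrix_positions) (auto simp: norm_mult intro!: mult_mono resolvent_bound)
  then show "cmod (resolvent n z (x(p := t)) a b - resolvent n z x a b) \<le> \<bar>t - x p\<bar> / sqrt n * (2 * W^2)"
    unfolding resolvent_update[OF p ab] norm_mult
    by (intro mult_mono) (auto simp: power2_eq_square norm_divide simp del: of_real_diff)
qed

text \<open>The change of R^2 is split at the mixed product R R'. The identity with the unperturbed
  factor on the left lets two old factors join into R^2 here, and two new ones into R'^2 in the
  companion lemma, so no sum of length \<open>n\<close> remains to be estimated.\<close>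

lemma mixed_resolvent_square_diff:
  assumes p: "p \<in> lower_triangle n" and ab: "a < n" "b < n"
  shows "(\<Sum>l<n. resolvent n z x a l * resolvent n z (x(p := t)) l b) - resolvent_square n z x a b
    = - of_real ((t - x p) / sqrt n) *
      (\<Sum>\<pi>\<in>matrix_positions p. resolvent_square n z x a (fst \<pi>) * resolvent n z (x(p := t)) (snd \<pi>) b)"
proof -
  let ?R = "resolvent n z x" and ?R' = "resolvent n z (x(p := t))"
  have "(\<Sum>l<n. ?R a l * ?R' l b) - resolvent_square n z x a b = (\<Sum>l<n. ?R a l * (?R' l b - ?R l b))"
    by (simp add: resolvent_square_def sum_subtractf[symmetric] algebra_simps)
  also have "\<dots> = (\<Sum>l<n. ?R a l * (- of_real ((t - x p) / sqrt n) *
      (\<Sum>\<pi>\<in>matrix_positions p. ?R l (fst \<pi>) * ?R' (snd \<pi>) b)))"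
    using ab by (intro sum.cong refl) (simp add: resolvent_update'[OF p])
  also have "\<dots> = - of_real ((t - x p) / sqrt n) *
      (\<Sum>l<n. \<Sum>\<pi>\<in>matrix_positions p. ?R a l * ?R l (fst \<pi>) * ?R' (snd \<pi>) b)"
    by (simp add: sum_distrib_left mult_ac)
  also have "(\<Sum>l<n. \<Sum>\<pi>\<in>matrix_positions p. ?R a l * ?R l (fst \<pi>) * ?R' (snd \<pi>) b)
     = (\<Sum>\<pi>\<in>matrix_positions p. \<Sum>l<n. ?R a l * ?R l (fst \<pi>) * ?R' (snd \<pi>) b)"
    by (rule sum.swap)
  finally show ?thesis by (simp add: resolvent_square_def sum_distrib_right del: fun_upd_apply)
qed

lemma mixed_resolvent_square_diff':
  assumes p: "p \<in> lower_triangle n" and ab: "a < n" "b < n"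
  shows "resolvent_square n z (x(p := t)) a b - (\<Sum>l<n. resolvent n z x a l * resolvent n z (x(p := t)) l b)
    = - of_real ((t - x p) / sqrt n) *
      (\<Sum>\<pi>\<in>matrix_positions p. resolvent n z x a (fst \<pi>) * resolvent_square n z (x(p := t)) (snd \<pi>) b)"
proof -
  let ?R = "resolvent n z x" and ?R' = "resolvent n z (x(p := t))"
  have "resolvent_square n z (x(p := t)) a b - (\<Sum>l<n. ?R a l * ?R' l b) = (\<Sum>l<n. (?R' a l - ?R a l) * ?R' l b)"
    by (simp add: resolvent_square_def sum_subtractf[symmetric] algebra_simps)
  also have "\<dots> = (\<Sum>l<n. (- of_real ((t - x p) / sqrt n) *
      (\<Sum>\<pi>\<in>matrix_positions p. ?R a (fst \<pi>) * ?R' (snd \<pi>) l)) * ?R' l b)"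
    using ab by (intro sum.cong refl) (simp add: resolvent_update'[OF p])
  also have "\<dots> = - of_real ((t - x p) / sqrt n) *
      (\<Sum>l<n. \<Sum>\<pi>\<in>matrix_positions p. ?R a (fst \<pi>) * (?R' (snd \<pi>) l * ?R' l b))"
    by (simp add: sum_distrib_left sum_distrib_right mult_ac)
  also have "(\<Sum>l<n. \<Sum>\<pi>\<in>matrix_positions p. ?R a (fst \<pi>) * (?R' (snd \<pi>) l * ?R' l b))
     = (\<Sum>\<pi>\<in>matrix_positions p. \<Sum>l<n. ?R a (fst \<pi>) * (?R' (snd \<pi>) l * ?R' l b))"
    by (rule sum.swap)
  finally show ?thesis by (simp add: resolvent_square_def sum_distrib_left del: fun_upd_apply)
qed

lemma resolvent_square_diff_bound:
  assumes p: "p \<in> lower_triangle n" and ab: "a < n" "b < n"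
  shows "cmod (resolvent_square n z (x(p := t)) a b - resolvent_square n z x a b)
    \<le> 4 * W^3 * cutoff n (t - x p)"
proof (rule norm_le_cutoffI)
  let ?M = "\<Sum>l<n. resolvent n z x a l * resolvent n z (x(p := t)) l b"
  have "cmod (resolvent_square n z (x(p := t)) a b - resolvent_square n z x a b) \<le> W^2 + W^2"
    using ab by (intro norm_triangle_le_diff add_mono resolvent_square_bound) auto
  also have "\<dots> \<le> 4 * W^3" using power_W_mono[of 2 3] zero_le_power[of W 3] W_ge_1 by linarith
  finally show "cmod (resolvent_square n z (x(p := t)) a b - resolvent_square n z x a b) \<le> 4 * W^3" .
  have "cmod (?M - resolvent_square n z x a b) \<le> \<bar>t - x p\<bar> / sqrt n * (2 * (W^2 * W))"
    unfolding mixed_resolvent_square_diff[OF p ab] norm_mult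
    using matrix_positions_bound[OF p] ab W_ge_1
    by (intro mult_mono norm_sum_matrix_positions)
       (auto simp: norm_mult norm_divide simp del: of_real_diff
         intro!: mult_mono resolvent_bound resolvent_square_bound)
  moreover have "cmod (resolvent_square n z (x(p := t)) a b - ?M) \<le> \<bar>t - x p\<bar> / sqrt n * (2 * (W * W^2))"
    unfolding mixed_resolvent_square_diff'[OF p ab] norm_mult
    using matrix_positions_bound[OF p] ab W_ge_1
    by (intro mult_mono norm_sum_matrix_positions)
       (auto simp: norm_mult norm_divide simp del: of_real_diff
         intro!: mult_mono resolvent_bound resolvent_square_bound)
  ultimately have "cmod ((resolvent_square n z (x(p := t)) a b - ?M) + (?M - resolvent_square n z x a b))
      \<le> \<bar>t - x p\<bar> / sqrt n * (2 * (W * W^2)) + \<bar>t - x p\<bar> / sqrt n * (2 * (W^2 * W))"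
    by (intro norm_triangle_mono) auto
  then show "cmod (resolvent_square n z (x(p := t)) a b - resolvent_square n z x a b)
      \<le> \<bar>t - x p\<bar> / sqrt n * (4 * W^3)"
    by (simp add: power3_eq_cube power2_eq_square mult_ac)
qed

lemma stj_bound: "cmod (stj n z x) \<le> W"
proof (cases "n = 0")
  case True then show ?thesis using W_ge_1 by (simp add: stj_def)
next
  case False
  have "cmod (\<Sum>a<n. resolvent n z x a a) \<le> of_nat (card {..<n}) * W"
    by (rule sum_norm_bound) (simp add: resolvent_bound)
  then show ?thesis using False by (simp add: stj_def norm_divide field_simps)
qed

text \<open>The trace is cyclic, so the diagonal sum closes up to entries of R R'. These are bounded
  uniformly in \<open>n\<close>, hence the factor 1/n is kept in full and the Lipschitz constant of
  \<open>stj\<close> in one entry has order n^(-3/2).\<close>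

lemma stj_update:
  assumes p: "p \<in> lower_triangle n"
  shows "stj n z (x(p := t)) - stj n z x = - of_real ((t - x p) / sqrt n / n) *
    (\<Sum>\<pi>\<in>matrix_positions p. \<Sum>a<n. resolvent n z x (snd \<pi>) a * resolvent n z (x(p := t)) a (fst \<pi>))"
proof -
  let ?R = "resolvent n z x" and ?R' = "resolvent n z (x(p := t))"
  have "stj n z (x(p := t)) - stj n z x = (\<Sum>a<n. ?R' a a - ?R a a) / of_nat n"
    by (simp add: stj_def sum_subtractf diff_divide_distrib)
  also have "(\<Sum>a<n. ?R' a a - ?R a a) = - of_real ((t - x p) / sqrt n) *
      (\<Sum>a<n. \<Sum>\<pi>\<in>matrix_positions p. ?R' a (fst \<pi>) * ?R (snd \<pi>) a)"
    by (simp add: resolvent_update[OF p] sum_distrib_left)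
  also have "(\<Sum>a<n. \<Sum>\<pi>\<in>matrix_positions p. ?R' a (fst \<pi>) * ?R (snd \<pi>) a)
    = (\<Sum>\<pi>\<in>matrix_positions p. \<Sum>a<n. ?R' a (fst \<pi>) * ?R (snd \<pi>) a)"
    by (rule sum.swap)
  finally show ?thesis by (simp add: mult_ac del: fun_upd_apply)
qed

lemma stj_lipschitz:
  assumes p: "p \<in> lower_triangle n"
  shows "cmod (stj n z (x(p := t)) - stj n z x) \<le> \<bar>t - x p\<bar> / sqrt n / n * (2 * W^2)"
  unfolding stj_update[OF p] norm_mult
  using matrix_positions_bound[OF p]
  by (intro mult_mono norm_sum_matrix_positions)
     (auto simp: norm_divide norm_mult simp del: of_real_diff intro!: mixed_resolvent_square_bound)

text \<open>The factor 1/n of \<open>stj_lipschitz\<close> is given up here: this bound only ever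
  multiplies a coefficient that already carries n^-2.\<close>

lemma stj_diff_bound:
  assumes p: "p \<in> lower_triangle n"
  shows "cmod (stj n z (x(p := t)) - stj n z x) \<le> 2 * W^2 * cutoff n (t - x p)"
proof (rule norm_le_cutoffI)
  have "cmod (stj n z (x(p := t)) - stj n z x) \<le> W + W"
    by (intro norm_triangle_le_diff add_mono stj_bound)
  also have "\<dots> \<le> 2 * W^2" using power_W_mono[of 1 2] by simp
  finally show "cmod (stj n z (x(p := t)) - stj n z x) \<le> 2 * W^2" .
  have n: "n \<ge> 1" using p by (auto simp: lower_triangle_def)
  have "\<bar>t - x p\<bar> / sqrt n / n * (2 * W^2) \<le> \<bar>t - x p\<bar> / sqrt n / 1 * (2 * W^2)"
    using n by (intro mult_right_mono divide_left_mono) auto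
  then show "cmod (stj n z (x(p := t)) - stj n z x) \<le> \<bar>t - x p\<bar> / sqrt n * (2 * W^2)"
    using stj_lipschitz[OF p, of x t] by simp
qed

lemma stj_coeff1_bound:
  assumes p: "p \<in> lower_triangle n"
  shows "cmod (stj_coeff1 n z p x) \<le> 1 / (n * sqrt n) * (2 * W^2)"
  unfolding stj_coeff1_def norm_mult
  using matrix_positions_bound[OF p]
  by (intro mult_mono norm_sum_matrix_positions)
     (auto simp: norm_divide norm_mult intro!: resolvent_square_bound)

lemma stj_coeff2_bound:
  assumes p: "p \<in> lower_triangle n"
  shows "cmod (stj_coeff2 n z p x) \<le> 1 / (real n)\<^sup>2 * (4 * W^3)"
proof -
  have "cmod (\<Sum>\<pi>\<in>matrix_positions p. \<Sum>\<pi>'\<in>matrix_positions p.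
        resolvent_square n z x (snd \<pi>) (fst \<pi>') * resolvent n z x (snd \<pi>') (fst \<pi>)) \<le> 2 * (2 * (W^2 * W))"
    using matrix_positions_bound[OF p] W_ge_1
    by (intro norm_sum_matrix_positions)
       (auto simp: norm_mult intro!: mult_mono resolvent_bound resolvent_square_bound)
  then have "cmod (stj_coeff2 n z p x) \<le> 1 / (real n)\<^sup>2 * (2 * (2 * (W^2 * W)))"
    unfolding stj_coeff2_def norm_mult
    by (intro mult_mono) (auto simp: norm_divide norm_mult norm_power)
  then show ?thesis by (simp add: power3_eq_cube power2_eq_square)
qed

text \<open>Two applications of the resolvent identity are exact. They put the whole remainder into
  replacing the last factor R' by R, and that difference is what \<open>resolvent_diff_bound\<close>
  controls by the cutoff. The constant 8 is 2 * 2 positions times the 2 of that bound.\<close>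

lemma stj_expansion:
  assumes p: "p \<in> lower_triangle n"
  defines "\<tau> \<equiv> \<lambda>x t. (t - x p) / sqrt n"
  shows "cmod (stj n z (x(p := t)) - stj n z x - of_real (t - x p) * stj_coeff1 n z p x
      - of_real ((t - x p)\<^sup>2) * stj_coeff2 n z p x)
    \<le> 8 * W^4 * (\<tau> x t)\<^sup>2 * cutoff n (t - x p) / n"
proof -
  let ?R = "resolvent n z x" and ?R' = "resolvent n z (x(p := t))"
  let ?Q = "resolvent_square n z x"
  let ?P = "matrix_positions p"
  let ?\<tau> = "\<tau> x t"
  have n: "n \<ge> 1" using p by (auto simp: lower_triangle_def)
  have \<tau>2: "?\<tau>\<^sup>2 = (t - x p)\<^sup>2 / n" using n by (simp add: \<tau>_def power_divide)
  have mixed: "(\<Sum>a<n. ?R (snd \<pi>) a * ?R' a (fst \<pi>)) = ?Q (snd \<pi>) (fst \<pi>)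
      - of_real ?\<tau> * (\<Sum>\<pi>'\<in>?P. ?Q (snd \<pi>) (fst \<pi>') * ?R' (snd \<pi>') (fst \<pi>))" if "\<pi> \<in> ?P" for \<pi>
    using mixed_resolvent_square_diff[OF p, of "snd \<pi>" "fst \<pi>" x t] matrix_positions_bound[OF p that]
    by (simp add: \<tau>_def algebra_simps)
  have "stj n z (x(p := t)) - stj n z x = - of_real (?\<tau> / n) *
    (\<Sum>\<pi>\<in>?P. ?Q (snd \<pi>) (fst \<pi>)
      - of_real ?\<tau> * (\<Sum>\<pi>'\<in>?P. ?Q (snd \<pi>) (fst \<pi>') * ?R' (snd \<pi>') (fst \<pi>)))"
    unfolding stj_update[OF p] by (simp add: mixed \<tau>_def)
  also have "\<dots> = - of_real (?\<tau> / n) * (\<Sum>\<pi>\<in>?P. ?Q (snd \<pi>) (fst \<pi>))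
      + of_real (?\<tau>\<^sup>2 / n) * (\<Sum>\<pi>\<in>?P. \<Sum>\<pi>'\<in>?P. ?Q (snd \<pi>) (fst \<pi>') * ?R' (snd \<pi>') (fst \<pi>))"
    by (simp add: sum_subtractf sum_distrib_left[symmetric] algebra_simps power2_eq_square)
  also have "- of_real (?\<tau> / n) * (\<Sum>\<pi>\<in>?P. ?Q (snd \<pi>) (fst \<pi>)) = of_real (t - x p) * stj_coeff1 n z p x"
    by (simp add: stj_coeff1_def \<tau>_def)
  finally have e1: "stj n z (x(p := t)) - stj n z x - of_real (t - x p) * stj_coeff1 n z p x
    = of_real (?\<tau>\<^sup>2 / n) * (\<Sum>\<pi>\<in>?P. \<Sum>\<pi>'\<in>?P. ?Q (snd \<pi>) (fst \<pi>') * ?R' (snd \<pi>') (fst \<pi>))"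
    by (simp del: fun_upd_apply)
  have e2: "of_real ((t - x p)\<^sup>2) * stj_coeff2 n z p x
    = of_real (?\<tau>\<^sup>2 / n) * (\<Sum>\<pi>\<in>?P. \<Sum>\<pi>'\<in>?P. ?Q (snd \<pi>) (fst \<pi>') * ?R (snd \<pi>') (fst \<pi>))"
    unfolding \<tau>2 stj_coeff2_def by (simp add: power2_eq_square)
  have e3: "stj n z (x(p := t)) - stj n z x - of_real (t - x p) * stj_coeff1 n z p x
      - of_real ((t - x p)\<^sup>2) * stj_coeff2 n z p x
    = of_real (?\<tau>\<^sup>2 / n) * (\<Sum>\<pi>\<in>?P. \<Sum>\<pi>'\<in>?P.
        ?Q (snd \<pi>) (fst \<pi>') * (?R' (snd \<pi>') (fst \<pi>) - ?R (snd \<pi>') (fst \<pi>)))"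
    unfolding e1 e2 by (simp add: algebra_simps sum_subtractf)
  have "cmod (\<Sum>\<pi>\<in>?P. \<Sum>\<pi>'\<in>?P.
        ?Q (snd \<pi>) (fst \<pi>') * (?R' (snd \<pi>') (fst \<pi>) - ?R (snd \<pi>') (fst \<pi>)))
      \<le> 2 * (2 * (W^2 * (2 * W^2 * cutoff n (t - x p))))"
    using matrix_positions_bound[OF p] W_ge_1
    by (intro norm_sum_matrix_positions)
       (auto simp: norm_mult intro!: mult_mono resolvent_diff_bound[OF p] resolvent_square_bound)
  then have "cmod (of_real (?\<tau>\<^sup>2 / n) * (\<Sum>\<pi>\<in>?P. \<Sum>\<pi>'\<in>?P.
        ?Q (snd \<pi>) (fst \<pi>') * (?R' (snd \<pi>') (fst \<pi>) - ?R (snd \<pi>') (fst \<pi>))))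
      \<le> ?\<tau>\<^sup>2 / n * (2 * (2 * (W^2 * (2 * W^2 * cutoff n (t - x p)))))"
    unfolding norm_mult by (intro mult_mono) (auto simp: norm_divide norm_power simp del: of_real_diff)
  then show ?thesis unfolding e3 by (simp add: power2_eq_square power4_eq_xxxx mult_ac)
qed

text \<open>This is \<open>norm_square_expansion_bound\<close> in the normalized increment \<tau> =
  (t - x p) / sqrt n; undoing the normalization of \<tau>^2 supplies the second factor 1/n.\<close>

lemma sq_dev_expansion:
  assumes p: "p \<in> lower_triangle n" and c: "cmod c \<le> W"
  shows "\<bar>sq_dev n z c (x(p := t)) - sq_dev n z c x - (t - x p) * sq_dev_coeff1 n z c p x
      - (t - x p)\<^sup>2 * sq_dev_coeff2 n z c p x\<bar>
    \<le> 80 * W^6 / (real n)\<^sup>2 * ((t - x p)\<^sup>2 * cutoff n (t - x p))"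
proof -
  have n: "n \<ge> 1" using p by (auto simp: lower_triangle_def)
  define \<tau> where "\<tau> = (t - x p) / sqrt n"
  have \<tau>2: "\<tau>\<^sup>2 = (t - x p)\<^sup>2 / n" using n by (simp add: \<tau>_def power_divide)
  define \<alpha> where "\<alpha> = of_real (t - x p) * stj_coeff1 n z p x"
  define \<beta> where "\<beta> = of_real ((t - x p)\<^sup>2) * stj_coeff2 n z p x"
  define d where "d = stj n z (x(p := t)) - stj n z x"
  define u where "u = stj n z x - c"
  have "\<bar>(cmod (u + d))\<^sup>2 - (cmod u)\<^sup>2 - 2 * Re (cnj u * (\<alpha> + \<beta>)) - (cmod \<alpha>)\<^sup>2\<bar>
      \<le> 80 * W^6 * \<tau>\<^sup>2 * cutoff n (t - x p) / n"
  proof (rule norm_square_expansion_bound[where r = "d - \<alpha> - \<beta>"])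
    show "d = \<alpha> + \<beta> + (d - \<alpha> - \<beta>)" by simp
    show "1 \<le> W" by (rule W_ge_1)
    show "1 \<le> real n" using n by simp
    show "cutoff n (t - x p) = min 1 \<bar>\<tau>\<bar>" by (simp add: cutoff_def \<tau>_def)
    show "cmod u \<le> 2 * W" unfolding u_def using norm_triangle_ineq4[of "stj n z x" c] c stj_bound[of n x] by linarith
    have "cmod \<alpha> \<le> \<bar>t - x p\<bar> * (1 / (n * sqrt n) * (2 * W^2))"
      unfolding \<alpha>_def norm_mult using stj_coeff1_bound[OF p] by (intro mult_mono) auto
    then show "cmod \<alpha> \<le> 2 * W\<^sup>2 * \<bar>\<tau>\<bar> / n" by (simp add: \<tau>_def mult_ac)
    have "cmod \<beta> \<le> (t - x p)\<^sup>2 * (1 / (real n)\<^sup>2 * (4 * W^3))"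
      unfolding \<beta>_def norm_mult using stj_coeff2_bound[OF p] by (intro mult_mono) (auto simp: norm_power simp del: of_real_diff)
    then show "cmod \<beta> \<le> 4 * W ^ 3 * \<tau>\<^sup>2 / n" by (simp only: \<tau>2) (simp add: mult_ac power2_eq_square)
    show "cmod (d - \<alpha> - \<beta>) \<le> 8 * W ^ 4 * \<tau>\<^sup>2 * cutoff n (t - x p) / n"
      unfolding d_def \<alpha>_def \<beta>_def \<tau>_def by (rule stj_expansion[OF p])
    show "cmod d \<le> 2 * W\<^sup>2 * \<bar>\<tau>\<bar> / n"
      using stj_lipschitz[OF p, of x t] by (simp add: d_def \<tau>_def mult_ac)
  qed
  also have "(cmod (u + d))\<^sup>2 - (cmod u)\<^sup>2 - 2 * Re (cnj u * (\<alpha> + \<beta>)) - (cmod \<alpha>)\<^sup>2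
    = sq_dev n z c (x(p := t)) - sq_dev n z c x - (t - x p) * sq_dev_coeff1 n z c p x
      - (t - x p)\<^sup>2 * sq_dev_coeff2 n z c p x"
  proof -
    have 1: "u + d = stj n z (x(p := t)) - c" by (simp add: u_def d_def)
    have 2: "cnj u * \<alpha> = of_real (t - x p) * (cnj u * stj_coeff1 n z p x)"
      and 3: "cnj u * \<beta> = of_real ((t - x p)\<^sup>2) * (cnj u * stj_coeff2 n z p x)"
      by (simp_all add: \<alpha>_def \<beta>_def mult_ac)
    have Re_scale: "Re (of_real r * w) = r * Re w" for r w by simp
    have 4: "Re (cnj u * (\<alpha> + \<beta>)) = (t - x p) * Re (cnj u * stj_coeff1 n z p x)
        + (t - x p)\<^sup>2 * Re (cnj u * stj_coeff2 n z p x)"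
      unfolding distrib_left 2 3 plus_complex.sel Re_scale by simp
    have 5: "(cmod \<alpha>)\<^sup>2 = (t - x p)\<^sup>2 * (cmod (stj_coeff1 n z p x))\<^sup>2"
      unfolding \<alpha>_def norm_mult by (simp add: power_mult_distrib del: of_real_diff)
    show ?thesis unfolding 1 4 5 sq_dev_def sq_dev_coeff1_def sq_dev_coeff2_def
      by (simp add: u_def algebra_simps)
  qed
  also have "80 * W^6 * \<tau>\<^sup>2 * cutoff n (t - x p) / n
      = 80 * W^6 / (real n)\<^sup>2 * ((t - x p)\<^sup>2 * cutoff n (t - x p))"
    by (simp add: \<tau>2 power2_eq_square[of "real n"])
  finally show ?thesis .
qed

text \<open>The first-order coefficient of \<open>stj\<close> has order n^(-3/2); its square n^-3 is
  relaxed to n^-2, the order of the second-order coefficient.\<close>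

lemma inverse_power_le:
  assumes "n \<ge> 1"
  shows "1 / (real n * sqrt n) \<le> 1" "(1 / (real n * sqrt n))\<^sup>2 \<le> 1 / real n ^ 2"
proof -
  have "sqrt (real n) \<ge> 1" using assms by simp
  then have "1 * 1 \<le> real n * sqrt n" using assms by (intro mult_mono) auto
  then show "1 / (real n * sqrt n) \<le> 1" by (simp add: divide_le_eq_1)
  have "real n ^ 2 * 1 \<le> real n ^ 2 * real n" using assms by (intro mult_left_mono) auto
  then show "(1 / (real n * sqrt n))\<^sup>2 \<le> 1 / real n ^ 2"
    using assms by (simp add: power_divide power_mult_distrib frac_le)
qed

text \<open>No power of \<open>n\<close> is kept: the first-order term will have mean zero, and its
  bound serves integrability only.\<close>

lemma sq_dev_coeff1_bound:
  assumes p: "p \<in> lower_triangle n" and c: "cmod c \<le> W"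
  shows "\<bar>sq_dev_coeff1 n z c p x\<bar> \<le> 8 * W^3"
proof -
  have n: "n \<ge> 1" using p by (auto simp: lower_triangle_def)
  have u: "cmod (stj n z x - c) \<le> 2 * W"
    using norm_triangle_ineq4[of "stj n z x" c] c stj_bound[of n x] by linarith
  have "cmod (stj_coeff1 n z p x) \<le> 1 / (n * sqrt n) * (2 * W^2)" by (rule stj_coeff1_bound[OF p])
  also have "\<dots> \<le> 1 * (2 * W^2)" using inverse_power_le[OF n] by (intro mult_right_mono) auto
  finally have s: "cmod (stj_coeff1 n z p x) \<le> 2 * W^2" by simp
  have "\<bar>Re (cnj (stj n z x - c) * stj_coeff1 n z p x)\<bar> \<le> cmod (stj n z x - c) * cmod (stj_coeff1 n z p x)"
    by (metis abs_Re_le_cmod complex_mod_cnj norm_mult)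
  also have "\<dots> \<le> (2 * W) * (2 * W^2)" using u s W_ge_1 by (intro mult_mono) auto
  finally show ?thesis by (simp add: sq_dev_coeff1_def abs_mult power_eq_if)
qed

text \<open>The constant 20 is 4 from the squared first-order coefficient plus twice 8 from the
  second-order one.\<close>

lemma sq_dev_coeff2_bound:
  assumes p: "p \<in> lower_triangle n" and c: "cmod c \<le> W"
  shows "\<bar>sq_dev_coeff2 n z c p x\<bar> \<le> 20 * W^4 / (real n)\<^sup>2"
proof -
  have n: "n \<ge> 1" using p by (auto simp: lower_triangle_def)
  have u: "cmod (stj n z x - c) \<le> 2 * W"
    using norm_triangle_ineq4[of "stj n z x" c] c stj_bound[of n x] by linarith
  have "(cmod (stj_coeff1 n z p x))\<^sup>2 \<le> (1 / (n * sqrt n) * (2 * W^2))\<^sup>2"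
    using stj_coeff1_bound[OF p] by (intro power_mono) auto
  also have "\<dots> = (1 / (n * sqrt n))\<^sup>2 * (2 * W^2)\<^sup>2" by (rule power_mult_distrib)
  also have "\<dots> \<le> 1 / (real n)\<^sup>2 * (2 * W^2)\<^sup>2"
    using inverse_power_le[OF n] by (intro mult_right_mono) auto
  also have "\<dots> = 4 * W^4 / (real n)\<^sup>2" by (simp add: power_mult_distrib power_eq_if)
  finally have s: "(cmod (stj_coeff1 n z p x))\<^sup>2 \<le> 4 * W^4 / (real n)\<^sup>2" .
  have "\<bar>Re (cnj (stj n z x - c) * stj_coeff2 n z p x)\<bar> \<le> cmod (stj n z x - c) * cmod (stj_coeff2 n z p x)"
    by (metis abs_Re_le_cmod complex_mod_cnj norm_mult)
  also have "\<dots> \<le> (2 * W) * (1 / (real n)\<^sup>2 * (4 * W^3))"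
    using u stj_coeff2_bound[OF p, of x] W_ge_1 by (intro mult_mono) auto
  also have "\<dots> = 8 * W^4 / (real n)\<^sup>2" by (simp add: power_eq_if)
  finally have "\<bar>sq_dev_coeff2 n z c p x\<bar> \<le> 4 * W^4 / (real n)\<^sup>2 + 2 * (8 * W^4 / (real n)\<^sup>2)"
    unfolding sq_dev_coeff2_def using s zero_le_power2[of "cmod (stj_coeff1 n z p x)"] by linarith
  then show ?thesis by simp
qed

lemma stj_coeff1_diff_bound:
  assumes p: "p \<in> lower_triangle n" and m: "m \<in> lower_triangle n"
  shows "cmod (stj_coeff1 n z p (x(m := t)) - stj_coeff1 n z p x)
    \<le> 1 / (n * sqrt n) * (8 * W^3 * cutoff n (t - x m))"
proof -
  let ?\<Delta> = "\<lambda>a b. resolvent_square n z (x(m := t)) a b - resolvent_square n z x a b"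
  have "stj_coeff1 n z p (x(m := t)) - stj_coeff1 n z p x = - of_real (1 / (real n * sqrt (real n))) *
     (\<Sum>\<pi>\<in>matrix_positions p. ?\<Delta> (snd \<pi>) (fst \<pi>))"
    by (simp add: stj_coeff1_def sum_subtractf algebra_simps diff_divide_distrib)
  moreover have "cmod (\<Sum>\<pi>\<in>matrix_positions p. ?\<Delta> (snd \<pi>) (fst \<pi>)) \<le> 2 * (4 * W^3 * cutoff n (t - x m))"
    using matrix_positions_bound[OF p] W_ge_1
    by (intro norm_sum_matrix_positions resolvent_square_diff_bound[OF m]) auto
  ultimately show ?thesis
    by (simp only: norm_mult norm_minus_cancel norm_of_real) (intro mult_mono, auto)
qed

lemma stj_coeff2_diff_bound:
  assumes p: "p \<in> lower_triangle n" and m: "m \<in> lower_triangle n"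
  shows "cmod (stj_coeff2 n z p (x(m := t)) - stj_coeff2 n z p x)
    \<le> 1 / (real n)\<^sup>2 * (24 * W^4 * cutoff n (t - x m))"
proof -
  let ?Q = "resolvent_square n z x" and ?Q' = "resolvent_square n z (x(m := t))"
  let ?R = "resolvent n z x" and ?R' = "resolvent n z (x(m := t))"
  let ?\<Delta> = "\<lambda>a b c d. ?Q' a b * ?R' c d - ?Q a b * ?R c d"
  have \<Delta>: "cmod (?\<Delta> a b c d) \<le> 6 * W^4 * cutoff n (t - x m)"
    if "a < n" "b < n" "c < n" "d < n" for a b c d
  proof -
    \<comment> \<open>The product is telescoped so that each summand contains exactly one
      difference, which carries the cutoff.\<close>
    have "?\<Delta> a b c d = (?Q' a b - ?Q a b) * ?R' c d + ?Q a b * (?R' c d - ?R c d)"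
      by (simp add: algebra_simps)
    also have "cmod \<dots> \<le> (4 * W^3 * cutoff n (t - x m)) * W + W^2 * (2 * W^2 * cutoff n (t - x m))"
      using that W_ge_1
      by (intro norm_triangle_mono)
         (auto simp: norm_mult intro!: mult_mono resolvent_square_diff_bound[OF m]
            resolvent_diff_bound[OF m] resolvent_bound resolvent_square_bound)
    finally show ?thesis by (simp add: power_eq_if mult_ac)
  qed
  have "stj_coeff2 n z p (x(m := t)) - stj_coeff2 n z p x = of_real (1 / (real n)\<^sup>2) *
     (\<Sum>\<pi>\<in>matrix_positions p. \<Sum>\<pi>'\<in>matrix_positions p. ?\<Delta> (snd \<pi>) (fst \<pi>') (snd \<pi>') (fst \<pi>))"
    by (simp add: stj_coeff2_def sum_subtractf algebra_simps diff_divide_distrib)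
  moreover have "cmod (\<Sum>\<pi>\<in>matrix_positions p. \<Sum>\<pi>'\<in>matrix_positions p.
      ?\<Delta> (snd \<pi>) (fst \<pi>') (snd \<pi>') (fst \<pi>)) \<le> 2 * (2 * (6 * W^4 * cutoff n (t - x m)))"
    using matrix_positions_bound[OF p] W_ge_1
    by (intro norm_sum_matrix_positions \<Delta>) auto
  ultimately show ?thesis
    by (simp only: norm_mult norm_of_real) (intro mult_mono, auto)
qed

text \<open>The price of setting another entry to zero; it must keep the order n^-2 and gain the
  cutoff. The constant 144 is 32 + 2 * 56: the 32 from the squared first-order coefficient, and 56 =
  8 + 48 from changing the deviation and the second-order coefficient in turn.\<close>

lemma sq_dev_coeff2_diff_bound:
  assumes p: "p \<in> lower_triangle n" and m: "m \<in> lower_triangle n" and c: "cmod c \<le> W"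
  shows "\<bar>sq_dev_coeff2 n z c p (x(m := t)) - sq_dev_coeff2 n z c p x\<bar>
    \<le> 144 * W^6 / (real n)\<^sup>2 * cutoff n (t - x m)"
proof -
  have n: "n \<ge> 1" using p by (auto simp: lower_triangle_def)
  let ?\<rho> = "cutoff n (t - x m)"
  let ?a = "stj_coeff1 n z p x" and ?a' = "stj_coeff1 n z p (x(m := t))"
  let ?b = "stj_coeff2 n z p x" and ?b' = "stj_coeff2 n z p (x(m := t))"
  let ?u = "stj n z x - c" and ?u' = "stj n z (x(m := t)) - c"
  define e where "e = 1 / (real n * sqrt n)"
  have e: "e\<^sup>2 \<le> 1 / (real n)\<^sup>2" "0 \<le> e" using inverse_power_le[OF n] by (auto simp: e_def)
  have u: "cmod ?u \<le> 2 * W"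
    using norm_triangle_ineq4[of "stj n z x" c] c stj_bound[of n x] by linarith
  have "(cmod ?a')\<^sup>2 - (cmod ?a)\<^sup>2 = (cmod ?a' - cmod ?a) * (cmod ?a' + cmod ?a)"
    by (simp add: power2_eq_square algebra_simps)
  then have "\<bar>(cmod ?a')\<^sup>2 - (cmod ?a)\<^sup>2\<bar> = \<bar>cmod ?a' - cmod ?a\<bar> * (cmod ?a' + cmod ?a)"
    by (simp add: abs_mult)
  also have "\<dots> \<le> (e * (8 * W^3 * ?\<rho>)) * (e * (2 * W^2) + e * (2 * W^2))"
    using stj_coeff1_bound[OF p] stj_coeff1_diff_bound[OF p m, of x t] norm_triangle_ineq3[of ?a' ?a] e W_ge_1
    unfolding e_def by (intro mult_mono add_mono) (auto intro: order_trans)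
  also have "\<dots> = e\<^sup>2 * (32 * W^5 * ?\<rho>)" by (simp add: power_eq_if algebra_simps)
  also have "\<dots> \<le> 1 / (real n)\<^sup>2 * (32 * W^6 * ?\<rho>)"
    using e power_W_mono[of 5 6] W_ge_1 by (intro mult_mono mult_right_mono) auto
  finally have 1: "\<bar>(cmod ?a')\<^sup>2 - (cmod ?a)\<^sup>2\<bar> \<le> 1 / (real n)\<^sup>2 * (32 * W^6 * ?\<rho>)" .
  have "cnj ?u' * ?b' - cnj ?u * ?b = cnj (?u' - ?u) * ?b' + cnj ?u * (?b' - ?b)"
    by (simp add: algebra_simps)
  also have "cmod \<dots> \<le> (2 * W^2 * ?\<rho>) * (1 / (real n)\<^sup>2 * (4 * W^3)) + (2 * W) * (1 / (real n)\<^sup>2 * (24 * W^4 * ?\<rho>))"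
  proof (intro norm_triangle_mono)
    show "cmod (cnj (?u' - ?u) * ?b') \<le> (2 * W^2 * ?\<rho>) * (1 / (real n)\<^sup>2 * (4 * W^3))"
      unfolding norm_mult complex_mod_cnj
      using stj_diff_bound[OF m, of x t] stj_coeff2_bound[OF p, of "x(m := t)"] W_ge_1
      by (intro mult_mono) auto
    show "cmod (cnj ?u * (?b' - ?b)) \<le> (2 * W) * (1 / (real n)\<^sup>2 * (24 * W^4 * ?\<rho>))"
      unfolding norm_mult complex_mod_cnj
      using u stj_coeff2_diff_bound[OF p m, of x t] W_ge_1
      by (intro mult_mono) auto
  qed
  also have "\<dots> = 1 / (real n)\<^sup>2 * (56 * W^5 * ?\<rho>)" by (simp add: power_eq_if algebra_simps)
  also have "\<dots> \<le> 1 / (real n)\<^sup>2 * (56 * W^6 * ?\<rho>)"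
    using power_W_mono[of 5 6] W_ge_1 by (intro mult_left_mono mult_right_mono) auto
  finally have 2: "\<bar>Re (cnj ?u' * ?b' - cnj ?u * ?b)\<bar> \<le> 1 / (real n)\<^sup>2 * (56 * W^6 * ?\<rho>)"
    using abs_Re_le_cmod order_trans by blast
  have "sq_dev_coeff2 n z c p (x(m := t)) - sq_dev_coeff2 n z c p x
      = ((cmod ?a')\<^sup>2 - (cmod ?a)\<^sup>2) + 2 * Re (cnj ?u' * ?b' - cnj ?u * ?b)"
    unfolding sq_dev_coeff2_def minus_complex.sel by simp
  then have "\<bar>sq_dev_coeff2 n z c p (x(m := t)) - sq_dev_coeff2 n z c p x\<bar>
      \<le> 1 / (real n)\<^sup>2 * (32 * W^6 * ?\<rho>) + 2 * (1 / (real n)\<^sup>2 * (56 * W^6 * ?\<rho>))"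
    using 1 2 by linarith
  then show ?thesis by (simp add: mult_ac)
qed

end

section \<open>Measurability and identification with the Stieltjes transform\<close>

context
  fixes z :: complex
  assumes z: "Im z > 0"
begin

lemma measurable_resolvent_square_entry:
  "q < n \<Longrightarrow> p < n \<Longrightarrow> (\<lambda>x. resolvent_square n z x q p) \<in> borel_measurable (PiM UNIV (\<lambda>_. borel))"
  unfolding resolvent_square_def
  by (intro borel_measurable_sum borel_measurable_times measurable_resolvent[OF z]) auto

lemma measurable_stj: "stj n z \<in> borel_measurable (PiM UNIV (\<lambda>_. borel))"
  unfolding stj_def[abs_def]
  by (intro borel_measurable_sum borel_measurable_divide borel_measurable_const measurable_resolvent[OF z]) auto

lemma measurable_stj_coeffs:
  assumes p: "p \<in> lower_triangle n"
  shows "stj_coeff1 n z p \<in> borel_measurable (PiM UNIV (\<lambda>_. borel))"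
    and "stj_coeff2 n z p \<in> borel_measurable (PiM UNIV (\<lambda>_. borel))"
  unfolding stj_coeff1_def[abs_def] stj_coeff2_def[abs_def]
  using matrix_positions_bound[OF p]
  by (intro borel_measurable_sum borel_measurable_times borel_measurable_const
      measurable_resolvent[OF z] measurable_resolvent_square_entry; blast)+

lemma measurable_sq_dev: "sq_dev n z c \<in> borel_measurable (PiM UNIV (\<lambda>_. borel))"
proof -
  note [measurable] = measurable_stj
  show ?thesis unfolding sq_dev_def[abs_def] by measurable
qed

lemma measurable_sq_dev_coeffs:
  assumes p: "p \<in> lower_triangle n"
  shows "sq_dev_coeff1 n z c p \<in> borel_measurable (PiM UNIV (\<lambda>_. borel))"
    and "sq_dev_coeff2 n z c p \<in> borel_measurable (PiM UNIV (\<lambda>_. borel))"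
proof -
  note [measurable] = measurable_stj measurable_stj_coeffs[OF p]
  have [measurable]: "cnj \<in> borel_measurable borel"
    by (intro borel_measurable_continuous_onI continuous_intros)
  have [measurable]: "Re \<in> borel_measurable borel"
    by (intro borel_measurable_continuous_onI continuous_intros)
  show "sq_dev_coeff1 n z c p \<in> borel_measurable (PiM UNIV (\<lambda>_. borel))"
    unfolding sq_dev_coeff1_def[abs_def] by measurable
  show "sq_dev_coeff2 n z c p \<in> borel_measurable (PiM UNIV (\<lambda>_. borel))"
    unfolding sq_dev_coeff2_def[abs_def] by measurable
qed

lemma stieltjes_eq_stj:
  "stieltjes (normalized_sym_matrix n (\<lambda>i j. x (int i, int j))) z = stj n z x"
proof -
  let ?A = "normalized_sym_matrix n (\<lambda>i j. x (int i, int j))"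
  have dim: "dim_row ?A = n" by (simp add: normalized_sym_matrix_def sym_matrix_def)
  obtain B where "mat_inverse (shifted_matrix n z x) = Some B" "B \<in> carrier_mat n n"
    by (rule mat_inverse_shifted_matrix[OF z])
  then show ?thesis
    by (simp add: stieltjes_def dim shifted_matrix_def[symmetric] stj_def resolvent_def mat_trace_def)
qed

end

subsection \<open>Variance of Lipschitz functions of independent variables\<close>

lemma measurable_to_coordinates:
  fixes f :: "'b \<Rightarrow> 'i \<Rightarrow> real"
  assumes "\<And>i. (\<lambda>\<omega>. f \<omega> i) \<in> borel_measurable N"
  shows "f \<in> measurable N (PiM UNIV (\<lambda>_. borel))"
  using measurable_PiM_single'[of UNIV "\<lambda>i \<omega>. f \<omega> i" N "\<lambda>_. borel"] assms by simp

lemma measurable_coordinate [measurable (raw)]: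
  fixes f :: "'b \<Rightarrow> 'i \<Rightarrow> real"
  assumes "f \<in> measurable N (PiM UNIV (\<lambda>_. borel))"
  shows "(\<lambda>\<omega>. f \<omega> i) \<in> borel_measurable N"
  by (rule measurable_compose[OF assms measurable_component_singleton]) simp

lemma measurable_update_coordinate:
  fixes f :: "'b \<Rightarrow> 'i \<Rightarrow> real"
  assumes [measurable]: "f \<in> measurable N (PiM UNIV (\<lambda>_. borel))" "g \<in> borel_measurable N"
  shows "(\<lambda>\<omega>. (f \<omega>)(p := g \<omega>)) \<in> measurable N (PiM UNIV (\<lambda>_. borel))"
proof (rule measurable_to_coordinates)
  show "(\<lambda>\<omega>. ((f \<omega>)(p := g \<omega>)) i) \<in> borel_measurable N" for i
    by (cases "i = p") simp_all
qed

context prob_space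
begin

lemma integrable_bounded:
  fixes f :: "'a \<Rightarrow> 'b::{banach, second_countable_topology}"
  assumes "f \<in> borel_measurable M" "\<And>\<omega>. norm (f \<omega>) \<le> B"
  shows "integrable M f"
  using assms by (intro integrable_const_bound[where B = B]) auto

lemma norm_expectation_le:
  fixes f :: "'a \<Rightarrow> 'b::{banach, second_countable_topology}"
  assumes "f \<in> borel_measurable M" "\<And>\<omega>. norm (f \<omega>) \<le> B"
  shows "norm (expectation f) \<le> B"
proof -
  \<comment> \<open>The bound is assumed at every point of the type, so an arbitrary point shows
    \<open>B\<close> to be nonnegative.\<close>
  have "0 \<le> B" using assms(2)[of undefined] norm_ge_zero order_trans by blast
  have "norm (expectation f) \<le> expectation (\<lambda>\<omega>. norm (f \<omega>))" by (rule integral_norm_bound)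
  also have "\<dots> \<le> expectation (\<lambda>_. B)"
    using assms \<open>0 \<le> B\<close> by (intro integral_mono integrable_norm integrable_bounded[where B = B]) auto
  finally show ?thesis by (simp add: prob_space)
qed

text \<open>Fubini for the joint law, written back on \<open>M\<close>: the second sample point
  \<open>\<omega>'\<close> plays the independent copy, so later statements can do without product
  spaces.\<close>

lemma expectation_indep_double:
  fixes h :: "_ \<Rightarrow> 'b::{banach, second_countable_topology}"
  assumes ind: "indep_var N1 A N2 B" and h: "h \<in> borel_measurable (N1 \<Otimes>\<^sub>M N2)"
    and bd: "\<And>u. norm (h u) \<le> C"
  shows "expectation (\<lambda>\<omega>. h (A \<omega>, B \<omega>)) = expectation (\<lambda>\<omega>. expectation (\<lambda>\<omega>'. h (A \<omega>, B \<omega>')))"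
proof -
  have A[measurable]: "A \<in> measurable M N1" and B[measurable]: "B \<in> measurable M N2"
    using ind by (auto dest: indep_var_rv1 indep_var_rv2)
  note h[measurable]
  interpret D1: prob_space "distr M N1 A" by (rule prob_space_distr) simp
  interpret D2: prob_space "distr M N2 B" by (rule prob_space_distr) simp
  interpret D: pair_prob_space "distr M N1 A" "distr M N2 B" ..
  have "expectation (\<lambda>\<omega>. h (A \<omega>, B \<omega>)) = integral\<^sup>L (distr M (N1 \<Otimes>\<^sub>M N2) (\<lambda>\<omega>. (A \<omega>, B \<omega>))) h"
    by (subst integral_distr) auto
  also have "distr M (N1 \<Otimes>\<^sub>M N2) (\<lambda>\<omega>. (A \<omega>, B \<omega>)) = distr M N1 A \<Otimes>\<^sub>M distr M N2 B"
    using ind by (simp add: indep_var_distribution_eq)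
  also have "integral\<^sup>L (distr M N1 A \<Otimes>\<^sub>M distr M N2 B) h
      = (\<integral>u. \<integral>v. h (u, v) \<partial>distr M N2 B \<partial>distr M N1 A)"
  proof (rule D.integral_fst'[symmetric])
    show "integrable (distr M N1 A \<Otimes>\<^sub>M distr M N2 B) h"
      by (rule D.integrable_bounded) (auto intro: bd)
  qed
  also have "\<dots> = (\<integral>u. expectation (\<lambda>\<omega>'. h (u, B \<omega>')) \<partial>distr M N1 A)"
  proof (rule Bochner_Integration.integral_cong[OF refl])
    fix u assume "u \<in> space (distr M N1 A)"
    then have u: "u \<in> space N1" by simp
    show "(\<integral>v. h (u, v) \<partial>distr M N2 B) = expectation (\<lambda>\<omega>'. h (u, B \<omega>'))"
      using u by (intro integral_distr) measurable
  qed
  also have "\<dots> = expectation (\<lambda>\<omega>. expectation (\<lambda>\<omega>'. h (A \<omega>, B \<omega>')))"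
    by (rule integral_distr) measurable
  finally show ?thesis .
qed

text \<open>The Gaussian family is indexed by pairs of naturals, the exchange by pairs of integers;
  this carries independence across.\<close>

lemma indep_vars_reindex:
  assumes ind: "indep_vars M' X (f ` I)" and inj: "inj_on f I"
  shows "indep_vars (\<lambda>i. M' (f i)) (\<lambda>i. X (f i)) I"
  unfolding indep_vars_def2
proof (intro conjI ballI)
  fix i assume "i \<in> I"
  then show "random_variable (M' (f i)) (X (f i))"
    using ind by (auto simp: indep_vars_def2)
next
  let ?F = "\<lambda>j. {X j -` A \<inter> space M |A. A \<in> sets (M' j)}"
  have F: "indep_sets ?F (f ` I)" using ind by (auto simp: indep_vars_def2)
  show "indep_sets (\<lambda>i. ?F (f i)) I"
    unfolding indep_sets_def
  proof (intro conjI ballI allI impI)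
    fix i assume "i \<in> I" then show "?F (f i) \<subseteq> events" using F by (auto simp: indep_sets_def)
  next
    fix J A assume J: "J \<subseteq> I" "J \<noteq> {}" "finite J" and A: "A \<in> Pi J (\<lambda>i. ?F (f i))"
    have injJ: "inj_on f J" using inj J(1) by (rule inj_on_subset)
    \<comment> \<open>The events are moved along \<open>f\<close>; injectivity on \<open>J\<close>
      makes the two products run over the same factors.\<close>
    define B where "B = (\<lambda>j. A (inv_into J f j))"
    have BA: "B (f i) = A i" if "i \<in> J" for i using that injJ by (simp add: B_def)
    have "prob (\<Inter>j\<in>f ` J. B j) = (\<Prod>j\<in>f ` J. prob (B j))"
    proof -
      have "B \<in> Pi (f ` J) ?F" using A BA by (auto simp: Pi_iff)
      moreover have "f ` J \<subseteq> f ` I" "f ` J \<noteq> {}" "finite (f ` J)" using J by auto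
      ultimately show ?thesis using F unfolding indep_sets_def by blast
    qed
    then show "prob (\<Inter>j\<in>J. A j) = (\<Prod>j\<in>J. prob (A j))"
      by (simp add: prod.reindex[OF injJ] BA cong: INF_cong prod.cong)
  qed
qed

text \<open>Each block is padded by constants to a function on all coordinates, so that one and the
  same functional can be evaluated on any block.\<close>

lemma indep_var_patched_coordinates:
  fixes Y :: "'i \<Rightarrow> 'a \<Rightarrow> real"
  assumes ind: "indep_vars (\<lambda>_. borel) Y I" and AB: "A \<inter> B = {}" "A \<subseteq> I" "B \<subseteq> I"
  shows "indep_var (PiM UNIV (\<lambda>_. borel)) (\<lambda>\<omega> q. if q \<in> A then Y q \<omega> else x q)
    (PiM UNIV (\<lambda>_. borel)) (\<lambda>\<omega> q. if q \<in> B then Y q \<omega> else x' q)"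
proof -
  have meas: "(\<lambda>y q. if q \<in> J then y q else x q) \<in> measurable (PiM J (\<lambda>_. borel)) (PiM UNIV (\<lambda>_. borel :: real measure))"
    for J :: "'i set" and x
  proof (rule measurable_to_coordinates)
    show "(\<lambda>y. if i \<in> J then y i else x i) \<in> borel_measurable (PiM J (\<lambda>_. borel))" for i
      by (cases "i \<in> J") (auto intro: measurable_component_singleton)
  qed
  from indep_var_compose[OF indep_var_restrict[OF ind AB] meas[of A x] meas[of B x']]
  show ?thesis by (simp add: comp_def cong: if_cong)
qed

text \<open>Bias-variance decomposition around \<open>c\<close>; the variance is then at most the
  mean squared distance to any point \<open>d\<close>, the mean being the best constant.\<close>

lemma expectation_norm_square_le:
  fixes Z :: "'a \<Rightarrow> complex"
  assumes Z: "Z \<in> borel_measurable M" "\<And>\<omega>. cmod (Z \<omega>) \<le> B"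
  shows "expectation (\<lambda>\<omega>. (cmod (Z \<omega> - c))\<^sup>2)
    \<le> (cmod (expectation Z - c))\<^sup>2 + expectation (\<lambda>\<omega>. (cmod (Z \<omega> - d))\<^sup>2)"
proof -
  note Z(1)[measurable]
  have B: "0 \<le> B" using Z(2)[of undefined] norm_ge_zero order_trans by blast
  have iZ: "integrable M Z" by (rule integrable_bounded[OF Z])
  have i2: "integrable M (\<lambda>\<omega>. (cmod (Z \<omega>))\<^sup>2)"
    by (rule integrable_bounded[where B = "B\<^sup>2"]) (auto intro!: power_mono Z(2))
  have iRe: "integrable M (\<lambda>\<omega>. Re (cnj e * Z \<omega>))" for e using iZ by simp
  have ex: "expectation (\<lambda>\<omega>. (cmod (Z \<omega> - e))\<^sup>2)
      = expectation (\<lambda>\<omega>. (cmod (Z \<omega>))\<^sup>2) - 2 * Re (cnj e * expectation Z) + (cmod e)\<^sup>2" for e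
  proof -
    have "(cmod (Z \<omega> - e))\<^sup>2 = (cmod (Z \<omega>))\<^sup>2 - 2 * Re (cnj e * Z \<omega>) + (cmod e)\<^sup>2" for \<omega>
      unfolding cmod_power2 by (simp add: power2_eq_square algebra_simps)
    moreover have "expectation (\<lambda>\<omega>. (cmod (Z \<omega>))\<^sup>2 - 2 * Re (cnj e * Z \<omega>) + (cmod e)\<^sup>2)
        = expectation (\<lambda>\<omega>. (cmod (Z \<omega>))\<^sup>2) - 2 * expectation (\<lambda>\<omega>. Re (cnj e * Z \<omega>)) + (cmod e)\<^sup>2"
      using i2 iRe[of e] by (simp add: prob_space del: times_complex.sel)
    moreover have "expectation (\<lambda>\<omega>. Re (cnj e * Z \<omega>)) = Re (cnj e * expectation Z)"
      using iZ by (subst integral_Re) auto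
    ultimately show ?thesis by simp
  qed
  have "(cmod (expectation Z - c))\<^sup>2
      = (cmod (expectation Z))\<^sup>2 - 2 * Re (cnj c * expectation Z) + (cmod c)\<^sup>2"
    unfolding cmod_power2 by (simp add: power2_eq_square algebra_simps)
  moreover have "0 \<le> (cmod (expectation Z - d))\<^sup>2" by simp
  moreover have "(cmod (expectation Z - d))\<^sup>2
      = (cmod (expectation Z))\<^sup>2 - 2 * Re (cnj d * expectation Z) + (cmod d)\<^sup>2"
    unfolding cmod_power2 by (simp add: power2_eq_square algebra_simps)
  ultimately show ?thesis unfolding ex by linarith
qed

text \<open>Tensorization of the variance: averaging out one coordinate at a time preserves both the
  bound and the Lipschitz constants of \<open>f\<close>.\<close>
lemma lipschitz_variance_bound:
  fixes Y :: "'i \<Rightarrow> 'a \<Rightarrow> real" and f :: "('i \<Rightarrow> real) \<Rightarrow> complex"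
  assumes "finite I" "indep_vars (\<lambda>_. borel) Y I"
    and "\<And>p. p \<in> I \<Longrightarrow> integrable M (\<lambda>\<omega>. (Y p \<omega>)\<^sup>2)"
    and "f \<in> borel_measurable (PiM UNIV (\<lambda>_. borel))" "\<And>x. cmod (f x) \<le> B"
    and "\<And>x p t. p \<in> I \<Longrightarrow> cmod (f (x(p := t)) - f (x(p := 0))) \<le> L * \<bar>t\<bar>"
  defines "V J \<equiv> \<lambda>\<omega> q. if q \<in> J then Y q \<omega> else 0"
  shows "expectation (\<lambda>\<omega>. (cmod (f (V I \<omega>) - expectation (\<lambda>\<omega>. f (V I \<omega>))))\<^sup>2)
    \<le> (\<Sum>p\<in>I. L\<^sup>2 * expectation (\<lambda>\<omega>. (Y p \<omega>)\<^sup>2))"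
  using assms(1-6)
proof (induction I arbitrary: f rule: finite_induct)
  case empty
  then show ?case by (simp add: V_def prob_space)
next
  case (insert p I)
  have Yind: "indep_vars (\<lambda>_. borel) Y (insert p I)" by fact
  have Y[measurable]: "Y q \<in> borel_measurable M" if "q \<in> insert p I" for q
    using Yind that by (auto simp: indep_vars_def2)
  note f[measurable] = insert.prems(3)
  note fB = insert.prems(4) and fL = insert.prems(5)
  have Yp[measurable]: "Y p \<in> borel_measurable M" by (rule Y) simp
  have V[measurable]: "V I \<in> measurable M (PiM UNIV (\<lambda>_. borel))"
  proof (rule measurable_to_coordinates)
    show "(\<lambda>\<omega>. V I \<omega> i) \<in> borel_measurable M" for i
      by (cases "i \<in> I") (auto simp: V_def intro: Y)
  qed
  have VI: "V (insert p I) \<omega> = (V I \<omega>)(p := Y p \<omega>)" for \<omega>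
    by (auto simp: V_def fun_eq_iff)
  \<comment> \<open>The coordinate \<open>p\<close> is averaged out. The induction hypothesis is
    applied to \<open>g\<close>, whose mean at \<open>V I\<close> is again the mean \<open>c\<close>
    of \<open>f\<close>.\<close>
  define g where "g = (\<lambda>x. expectation (\<lambda>\<omega>. f (x(p := Y p \<omega>))))"
  have updY[measurable]: "(\<lambda>\<omega>. x(p := Y p \<omega>)) \<in> measurable M (PiM UNIV (\<lambda>_. borel))" for x
    by (intro measurable_update_coordinate measurable_const) (auto simp: space_PiM)
  have upd'[measurable]: "(\<lambda>(x, \<omega>). x(p := Y p \<omega>)) \<in> measurable (PiM UNIV (\<lambda>_. borel) \<Otimes>\<^sub>M M) (PiM UNIV (\<lambda>_. borel))"
    unfolding case_prod_beta by (intro measurable_update_coordinate) measurable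
  have g[measurable]: "g \<in> borel_measurable (PiM UNIV (\<lambda>_. borel))"
    unfolding g_def using measurable_compose[OF upd' f]
    by (intro borel_measurable_lebesgue_integral) (simp add: case_prod_beta)
  have gB: "cmod (g x) \<le> B" for x
    unfolding g_def by (rule norm_expectation_le) (auto intro: fB)
  have fint: "integrable M (\<lambda>\<omega>. f (x(p := Y p \<omega>)))" for x
    by (rule integrable_bounded) (auto intro: fB)
  have gL: "cmod (g (x(q := t)) - g (x(q := 0))) \<le> L * \<bar>t\<bar>" if q: "q \<in> I" for x q t
  proof -
    have "q \<noteq> p" using q insert.hyps by auto
    then have comm: "x(q := t, p := s) = x(p := s, q := t)" for t s by (simp add: fun_upd_twist)
    have "g (x(q := t)) - g (x(q := 0)) = expectation (\<lambda>\<omega>. f (x(q := t, p := Y p \<omega>)) - f (x(q := 0, p := Y p \<omega>)))"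
      unfolding g_def by (rule Bochner_Integration.integral_diff[symmetric]; rule fint)
    also have "cmod \<dots> \<le> L * \<bar>t\<bar>"
    proof (rule norm_expectation_le)
      show "cmod (f (x(q := t, p := Y p \<omega>)) - f (x(q := 0, p := Y p \<omega>))) \<le> L * \<bar>t\<bar>" for \<omega>
        unfolding comm by (rule fL) (use q in simp)
    qed simp
    finally show ?thesis .
  qed
  have ind: "indep_var (PiM UNIV (\<lambda>_. borel)) (V I) (PiM UNIV (\<lambda>_. borel)) (V {p})"
    unfolding V_def by (rule indep_var_patched_coordinates[OF Yind]) (use insert.hyps in auto)
  have Vp: "V {p} \<omega> p = Y p \<omega>" for \<omega> by (simp add: V_def)
  have upd2[measurable]: "(\<lambda>(x, v). x(p := v p)) \<in> measurable (PiM UNIV (\<lambda>_. borel) \<Otimes>\<^sub>M PiM UNIV (\<lambda>_. borel))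
      (PiM UNIV (\<lambda>_. borel :: real measure))"
    unfolding case_prod_beta by (intro measurable_update_coordinate) measurable
  \<comment> \<open>General in the target type, as it is applied to the complex \<open>f\<close> and
    to its real squared deviation.\<close>
  have double: "expectation (\<lambda>\<omega>. k ((V I \<omega>)(p := Y p \<omega>)))
      = expectation (\<lambda>\<omega>. expectation (\<lambda>\<omega>'. k ((V I \<omega>)(p := Y p \<omega>'))))"
    if "k \<in> borel_measurable (PiM UNIV (\<lambda>_. borel))" "\<And>x. norm (k x) \<le> C"
    for k :: "('i \<Rightarrow> real) \<Rightarrow> 'c::{banach, second_countable_topology}" and C
    using expectation_indep_double[OF ind, of "\<lambda>(x, v). k (x(p := v p))" C]
      measurable_compose[OF upd2 that(1)] that(2) by (simp add: case_prod_beta Vp)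
  define c where "c = expectation (\<lambda>\<omega>. f (V (insert p I) \<omega>))"
  have c: "c = expectation (\<lambda>\<omega>. g (V I \<omega>))"
    unfolding c_def VI g_def by (rule double[OF f fB])
  have IH: "expectation (\<lambda>\<omega>. (cmod (g (V I \<omega>) - c))\<^sup>2) \<le> (\<Sum>p\<in>I. L\<^sup>2 * expectation (\<lambda>\<omega>. (Y p \<omega>)\<^sup>2))"
    unfolding c
  proof (rule insert.IH)
    show "indep_vars (\<lambda>_. borel) Y I" by (rule indep_vars_subset[OF Yind]) auto
    show "integrable M (\<lambda>\<omega>. (Y q \<omega>)\<^sup>2)" if "q \<in> I" for q using insert.prems(2) that by simp
  qed (rule g gB gL; assumption?)+
  have cB: "cmod c \<le> B"
    unfolding c by (rule norm_expectation_le) (auto intro: gB)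
  have bd: "norm ((cmod (v - c))\<^sup>2) \<le> (B + B)\<^sup>2" if "cmod v \<le> B" for v
  proof -
    have "cmod (v - c) \<le> B + B" using norm_triangle_ineq4[of v c] that cB by linarith
    then have "(cmod (v - c))\<^sup>2 \<le> (B + B)\<^sup>2" by (rule power_mono) simp
    then show ?thesis by (simp del: power_mult_distrib)
  qed
  have Y2: "integrable M (\<lambda>\<omega>. (Y p \<omega>)\<^sup>2)" using insert.prems(2) by simp
  have inner: "expectation (\<lambda>\<omega>'. (cmod (f (x(p := Y p \<omega>')) - c))\<^sup>2)
      \<le> (cmod (g x - c))\<^sup>2 + L\<^sup>2 * expectation (\<lambda>\<omega>. (Y p \<omega>)\<^sup>2)" for x
  proof -
    \<comment> \<open>The comparison point \<open>d\<close> is the value with a zero at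
      \<open>p\<close>, so the Lipschitz bound gives the second moment of \<open>Y p\<close> at once
      and no second copy of it appears.\<close>
    have "expectation (\<lambda>\<omega>'. (cmod (f (x(p := Y p \<omega>')) - c))\<^sup>2)
      \<le> (cmod (g x - c))\<^sup>2 + expectation (\<lambda>\<omega>'. (cmod (f (x(p := Y p \<omega>')) - f (x(p := 0))))\<^sup>2)"
      unfolding g_def by (rule expectation_norm_square_le[where B = B]) (auto intro: fB)
    also have "expectation (\<lambda>\<omega>'. (cmod (f (x(p := Y p \<omega>')) - f (x(p := 0))))\<^sup>2)
      \<le> expectation (\<lambda>\<omega>'. L\<^sup>2 * (Y p \<omega>')\<^sup>2)"
    proof (rule integral_mono')
      show "integrable M (\<lambda>\<omega>'. L\<^sup>2 * (Y p \<omega>')\<^sup>2)" using Y2 by simp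
      show "(cmod (f (x(p := Y p \<omega>')) - f (x(p := 0))))\<^sup>2 \<le> L\<^sup>2 * (Y p \<omega>')\<^sup>2" for \<omega>'
        using power_mono[OF fL[of p x "Y p \<omega>'"] norm_ge_zero, of 2] by (simp add: power_mult_distrib del: fun_upd_apply)
    qed simp
    finally show ?thesis by simp
  qed
  have "expectation (\<lambda>\<omega>. (cmod (f (V (insert p I) \<omega>) - c))\<^sup>2)
      = expectation (\<lambda>\<omega>. expectation (\<lambda>\<omega>'. (cmod (f ((V I \<omega>)(p := Y p \<omega>')) - c))\<^sup>2))"
  proof -
    have "(\<lambda>x. (cmod (f x - c))\<^sup>2) \<in> borel_measurable (PiM UNIV (\<lambda>_. borel))" by measurable
    from double[OF this bd[OF fB]] show ?thesis unfolding VI .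
  qed
  also have "\<dots> \<le> expectation (\<lambda>\<omega>. (cmod (g (V I \<omega>) - c))\<^sup>2 + L\<^sup>2 * expectation (\<lambda>\<omega>. (Y p \<omega>)\<^sup>2))"
  proof (rule integral_mono')
    show "integrable M (\<lambda>\<omega>. (cmod (g (V I \<omega>) - c))\<^sup>2 + L\<^sup>2 * expectation (\<lambda>\<omega>. (Y p \<omega>)\<^sup>2))"
      by (intro Bochner_Integration.integrable_add integrable_bounded[OF _ bd[OF gB]]) auto
  qed (auto intro: inner)
  also have "\<dots> = expectation (\<lambda>\<omega>. (cmod (g (V I \<omega>) - c))\<^sup>2) + L\<^sup>2 * expectation (\<lambda>\<omega>. (Y p \<omega>)\<^sup>2)"
    by (subst Bochner_Integration.integral_add) (auto intro: integrable_bounded[OF _ bd[OF gB]] simp: prob_space)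
  finally show ?case using IH insert.hyps unfolding c_def by simp
qed

text \<open>Both values of \<open>G\<close> are expanded around a zero at \<open>p\<close>, so the
  zeroth-order terms cancel. By independence the first-order term of \<open>y\<close> has mean 0 and
  its second-order term the factor \<open>v\<close>, which is how the square of \<open>s\<close>
  comes to be centred. Here \<open>s\<close> is deterministic; later it is the value of an
  \<open>X\<close> entry at a frozen sample point.\<close>

lemma taylor_swap:
  fixes G G1 G2 :: "('i \<Rightarrow> real) \<Rightarrow> real" and V :: "'a \<Rightarrow> 'i \<Rightarrow> real" and D :: "'a \<Rightarrow> 'i \<Rightarrow> real" and p :: 'i
  defines "y \<equiv> \<lambda>\<omega>. D \<omega> p"
  assumes ind: "indep_var (PiM UNIV (\<lambda>_. borel)) V (PiM UNIV (\<lambda>_. borel)) D" and Vp: "\<And>\<omega>. V \<omega> p = 0"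
    and y: "integrable M (\<lambda>\<omega>. (y \<omega>)\<^sup>2)" "expectation y = 0" "expectation (\<lambda>\<omega>. (y \<omega>)\<^sup>2) = v"
    and G: "G \<in> borel_measurable (PiM UNIV (\<lambda>_. borel))" "\<And>x. \<bar>G x\<bar> \<le> B"
    and G1: "G1 \<in> borel_measurable (PiM UNIV (\<lambda>_. borel))" "\<And>x. \<bar>G1 x\<bar> \<le> B"
    and G2: "G2 \<in> borel_measurable (PiM UNIV (\<lambda>_. borel))" "\<And>x. \<bar>G2 x\<bar> \<le> B"
    and expand: "\<And>x t. \<bar>G (x(p := t)) - G (x(p := 0)) - t * G1 (x(p := 0)) - t\<^sup>2 * G2 (x(p := 0))\<bar> \<le> \<rho> t"
    and \<rho>: "integrable M (\<lambda>\<omega>. \<rho> (y \<omega>))"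
  shows "\<bar>expectation (\<lambda>\<omega>. G ((V \<omega>)(p := s))) - expectation (\<lambda>\<omega>. G ((V \<omega>)(p := y \<omega>)))
      - s * expectation (\<lambda>\<omega>. G1 (V \<omega>)) - (s\<^sup>2 - v) * expectation (\<lambda>\<omega>. G2 (V \<omega>))\<bar>
    \<le> \<rho> s + expectation (\<lambda>\<omega>. \<rho> (y \<omega>))"
proof -
  have V[measurable]: "V \<in> measurable M (PiM UNIV (\<lambda>_. borel))" and D[measurable]: "D \<in> measurable M (PiM UNIV (\<lambda>_. borel))"
    using ind by (auto dest: indep_var_rv1 indep_var_rv2)
  have ym[measurable]: "y \<in> borel_measurable M" unfolding y_def by measurable
  note [measurable] = G(1) G1(1) G2(1)
  have [measurable]: "(\<lambda>\<omega>. (V \<omega>)(p := y \<omega>)) \<in> measurable M (PiM UNIV (\<lambda>_. borel))"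
    "(\<lambda>\<omega>. (V \<omega>)(p := s)) \<in> measurable M (PiM UNIV (\<lambda>_. borel))"
    by (intro measurable_update_coordinate; simp)+
  have V0: "(V \<omega>)(p := 0) = V \<omega>" for \<omega> using Vp[of \<omega>] by (metis fun_upd_triv)
  have iG: "integrable M (\<lambda>\<omega>. G (V \<omega>))" "integrable M (\<lambda>\<omega>. G1 (V \<omega>))" "integrable M (\<lambda>\<omega>. G2 (V \<omega>))"
    "integrable M (\<lambda>\<omega>. G ((V \<omega>)(p := s)))" "integrable M (\<lambda>\<omega>. G ((V \<omega>)(p := y \<omega>)))"
    by (rule integrable_bounded[where B = B]; simp add: G(2) G1(2) G2(2))+
  have iy: "integrable M y" by (rule square_integrable_imp_integrable[OF ym y(1)])
  have ind1: "indep_var borel (\<lambda>\<omega>. G1 (V \<omega>)) borel y"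
    using indep_var_compose[OF ind G1(1), of "\<lambda>v. v p" borel] by (simp add: comp_def y_def)
  have ind2: "indep_var borel (\<lambda>\<omega>. G2 (V \<omega>)) borel (\<lambda>\<omega>. (y \<omega>)\<^sup>2)"
    using indep_var_compose[OF ind G2(1), of "\<lambda>v. (v p)\<^sup>2" borel] by (simp add: comp_def y_def)
  have e1: "expectation (\<lambda>\<omega>. y \<omega> * G1 (V \<omega>)) = 0" "integrable M (\<lambda>\<omega>. y \<omega> * G1 (V \<omega>))"
    using indep_var_lebesgue_integral[OF ind1 iG(2) iy] indep_var_integrable[OF ind1 iG(2) iy] y(2)
    by (simp_all add: mult.commute)
  have e2: "expectation (\<lambda>\<omega>. (y \<omega>)\<^sup>2 * G2 (V \<omega>)) = v * expectation (\<lambda>\<omega>. G2 (V \<omega>))"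
    "integrable M (\<lambda>\<omega>. (y \<omega>)\<^sup>2 * G2 (V \<omega>))"
    using indep_var_lebesgue_integral[OF ind2 iG(3) y(1)] indep_var_integrable[OF ind2 iG(3) y(1)] y(3)
    by (simp_all add: mult.commute)
  have "expectation (\<lambda>\<omega>. G ((V \<omega>)(p := s)) - G (V \<omega>) - s * G1 (V \<omega>) - s\<^sup>2 * G2 (V \<omega>))
      = expectation (\<lambda>\<omega>. G ((V \<omega>)(p := s))) - expectation (\<lambda>\<omega>. G (V \<omega>))
        - s * expectation (\<lambda>\<omega>. G1 (V \<omega>)) - s\<^sup>2 * expectation (\<lambda>\<omega>. G2 (V \<omega>))"
    using iG by simp
  moreover have "norm (expectation (\<lambda>\<omega>. G ((V \<omega>)(p := s)) - G (V \<omega>) - s * G1 (V \<omega>) - s\<^sup>2 * G2 (V \<omega>))) \<le> \<rho> s"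
    using expand[of "V _" s] by (intro norm_expectation_le) (auto simp: V0)
  ultimately have 1: "\<bar>expectation (\<lambda>\<omega>. G ((V \<omega>)(p := s))) - expectation (\<lambda>\<omega>. G (V \<omega>))
        - s * expectation (\<lambda>\<omega>. G1 (V \<omega>)) - s\<^sup>2 * expectation (\<lambda>\<omega>. G2 (V \<omega>))\<bar> \<le> \<rho> s"
    by simp
  let ?r = "\<lambda>\<omega>. G ((V \<omega>)(p := y \<omega>)) - G (V \<omega>) - y \<omega> * G1 (V \<omega>) - (y \<omega>)\<^sup>2 * G2 (V \<omega>)"
  have ir: "integrable M ?r" using iG e1 e2 by simp
  have "expectation ?r = expectation (\<lambda>\<omega>. G ((V \<omega>)(p := y \<omega>))) - expectation (\<lambda>\<omega>. G (V \<omega>))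
        - v * expectation (\<lambda>\<omega>. G2 (V \<omega>))"
    using iG e1 e2 by simp
  moreover have "norm (expectation ?r) \<le> expectation (\<lambda>\<omega>. norm (?r \<omega>))" by (rule integral_norm_bound)
  moreover have "expectation (\<lambda>\<omega>. norm (?r \<omega>)) \<le> expectation (\<lambda>\<omega>. \<rho> (y \<omega>))"
    using expand[of "V _" "y _"] by (intro integral_mono integrable_norm ir \<rho>) (simp add: V0)
  ultimately have 2: "\<bar>expectation (\<lambda>\<omega>. G ((V \<omega>)(p := y \<omega>))) - expectation (\<lambda>\<omega>. G (V \<omega>))
        - v * expectation (\<lambda>\<omega>. G2 (V \<omega>))\<bar> \<le> expectation (\<lambda>\<omega>. \<rho> (y \<omega>))"
    by simp
  show ?thesis using 1 2 by (simp add: algebra_simps)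
qed

lemma expectation_mult_cond_exp_zero:
  assumes F: "subalgebra M F" and f: "f \<in> borel_measurable F" "\<And>\<omega>. \<bar>f \<omega>\<bar> \<le> B"
    and g: "integrable M g" and z: "AE \<omega> in M. real_cond_exp M F g \<omega> = 0"
  shows "expectation (\<lambda>\<omega>. f \<omega> * g \<omega>) = 0"
proof -
  interpret F: finite_measure_subalgebra M F by unfold_locales (rule F)
  have fM[measurable]: "f \<in> borel_measurable M" by (rule measurable_from_subalg[OF F f(1)])
  have [measurable]: "g \<in> borel_measurable M" using g by simp
  have "integrable M (\<lambda>\<omega>. f \<omega> * g \<omega>)"
    using Bochner_Integration.integrable_bound[of M "\<lambda>\<omega>. B * g \<omega>" "\<lambda>\<omega>. f \<omega> * g \<omega>"] g f(2)
    by (force simp: abs_mult intro!: mult_right_mono order_trans[OF f(2)])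
  then have "expectation (\<lambda>\<omega>. f \<omega> * g \<omega>) = expectation (\<lambda>\<omega>. f \<omega> * real_cond_exp M F g \<omega>)"
    by (intro F.real_cond_exp_intg(2)[symmetric] f) simp_all
  also have "\<dots> = expectation (\<lambda>\<omega>. 0)"
    using z by (intro integral_cong_AE) auto
  finally show ?thesis by simp
qed

text \<open>A bounded \<open>F\<close>-measurable factor sees \<open>g\<close> only through its
  conditional expectation, so absolute values are taken after conditioning. This is where the
  conditional variances enter.\<close>

lemma abs_expectation_mult_le_cond_exp:
  assumes F: "subalgebra M F" and f: "f \<in> borel_measurable F" "\<And>\<omega>. \<bar>f \<omega>\<bar> \<le> B"
    and g: "integrable M g"
  shows "\<bar>expectation (\<lambda>\<omega>. f \<omega> * g \<omega>)\<bar> \<le> B * Lp_norm M 1 (real_cond_exp M F g)"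
proof -
  interpret F: finite_measure_subalgebra M F by unfold_locales (rule F)
  have fM[measurable]: "f \<in> borel_measurable M" by (rule measurable_from_subalg[OF F f(1)])
  have [measurable]: "g \<in> borel_measurable M" using g by simp
  have i: "integrable M (\<lambda>\<omega>. f \<omega> * g \<omega>)"
    using Bochner_Integration.integrable_bound[of M "\<lambda>\<omega>. B * g \<omega>" "\<lambda>\<omega>. f \<omega> * g \<omega>"] g f(2)
    by (force simp: abs_mult intro!: mult_right_mono order_trans[OF f(2)])
  have ic: "integrable M (real_cond_exp M F g)" by (rule F.real_cond_exp_int(1)[OF g])
  have i': "integrable M (\<lambda>\<omega>. f \<omega> * real_cond_exp M F g \<omega>)"
    by (rule F.real_cond_exp_intg(1)[OF i f(1)]) simp
  have "expectation (\<lambda>\<omega>. f \<omega> * g \<omega>) = expectation (\<lambda>\<omega>. f \<omega> * real_cond_exp M F g \<omega>)"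
    using i by (intro F.real_cond_exp_intg(2)[symmetric] f) simp_all
  also have "\<bar>\<dots>\<bar> \<le> expectation (\<lambda>\<omega>. \<bar>f \<omega> * real_cond_exp M F g \<omega>\<bar>)"
    by (rule integral_abs_bound)
  also have "\<dots> \<le> expectation (\<lambda>\<omega>. B * \<bar>real_cond_exp M F g \<omega>\<bar>)"
    using ic integrable_abs[OF i'] f(2) by (intro integral_mono) (auto simp: abs_mult intro!: mult_right_mono)
  also have "\<dots> = B * Lp_norm M 1 (real_cond_exp M F g)"
    by (simp add: Lp_norm_def powr_one_gt_zero_iff)
  finally show ?thesis .
qed

end

subsection \<open>Lindeberg exchange\<close>

text \<open>The coordinates are zeroed one at a time; each still has its original value when its
  turn comes, so the costs add up without interaction.\<close>

lemma zero_coordinates_bound: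
  fixes h :: "('i \<Rightarrow> real) \<Rightarrow> real"
  assumes "finite J"
    and "\<And>x m t. m \<in> J \<Longrightarrow> \<bar>h (x(m := t)) - h (x(m := 0))\<bar> \<le> \<kappa> * ct t"
  shows "\<bar>h x - h (\<lambda>q. if q \<in> J then 0 else x q)\<bar> \<le> \<kappa> * (\<Sum>m\<in>J. ct (x m))"
  using assms
proof (induction J rule: finite_induct)
  case empty
  then show ?case by simp
next
  case (insert m J)
  let ?x = "\<lambda>q. if q \<in> J then 0 else x q"
  have 1: "?x(m := x m) = ?x" using insert.hyps by auto
  have 2: "?x(m := 0) = (\<lambda>q. if q \<in> insert m J then 0 else x q)" by auto
  have "\<bar>h x - h ?x\<bar> \<le> \<kappa> * (\<Sum>m\<in>J. ct (x m))"
    using insert.prems by (intro insert.IH) auto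
  moreover have "\<bar>h ?x - h (\<lambda>q. if q \<in> insert m J then 0 else x q)\<bar> \<le> \<kappa> * ct (x m)"
    using insert.prems[of m ?x "x m"] unfolding 1 2 by simp
  ultimately show ?case using insert.hyps by (simp add: distrib_left)
qed

context prob_space
begin

text \<open>\<open>A\<close> holds the positions that already carry \<open>X\<close>,
  \<open>B\<close> those that still carry \<open>Y\<close>. Averaging over \<open>\<omega>'\<close>
  first turns the Taylor coefficients into functions \<open>\<phi>1\<close> and
  \<open>\<phi>2\<close> of the coordinates in \<open>A\<close>, so their measurability with respect
  to \<open>F1\<close>, or to \<open>Fa\<close> after zeroing the coordinates in \<open>W\<close>,
  reduces to that of single entries.\<close>

lemma lindeberg_step:
  fixes X Y :: "'i \<Rightarrow> 'a \<Rightarrow> real" and G G1 G2 :: "('i \<Rightarrow> real) \<Rightarrow> real"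
  assumes fin: "finite A" and p: "p \<notin> A" "p \<notin> B" and AB: "A \<inter> B = {}"
    and X: "\<And>q. X q \<in> borel_measurable M" "integrable M (\<lambda>\<omega>. (X p \<omega>)\<^sup>2)"
    and Y: "indep_vars (\<lambda>_. borel) Y (insert p B)" "integrable M (\<lambda>\<omega>. (Y p \<omega>)\<^sup>2)"
      "expectation (Y p) = 0" "expectation (\<lambda>\<omega>. (Y p \<omega>)\<^sup>2) = v"
    and G: "G \<in> borel_measurable (PiM UNIV (\<lambda>_. borel))" "\<And>x. \<bar>G x\<bar> \<le> b"
    and G1: "G1 \<in> borel_measurable (PiM UNIV (\<lambda>_. borel))" "\<And>x. \<bar>G1 x\<bar> \<le> b"
    and G2: "G2 \<in> borel_measurable (PiM UNIV (\<lambda>_. borel))" "\<And>x. \<bar>G2 x\<bar> \<le> \<kappa>"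
    and expand: "\<And>x t. \<bar>G (x(p := t)) - G (x(p := 0)) - t * G1 (x(p := 0)) - t\<^sup>2 * G2 (x(p := 0))\<bar>
      \<le> \<kappa> * (t\<^sup>2 * ct t)"
    and lip: "\<And>x m t. m \<in> A \<Longrightarrow> \<bar>G2 (x(m := t)) - G2 (x(m := 0))\<bar> \<le> \<kappa> * ct t"
    and ct: "ct \<in> borel_measurable borel" "\<And>t. 0 \<le> ct t" "\<And>t. ct t \<le> 1"
    and F1: "subalgebra M F1" "\<And>q. q \<in> A \<Longrightarrow> X q \<in> borel_measurable F1"
      "AE \<omega> in M. real_cond_exp M F1 (X p) \<omega> = 0"
    and Fa: "subalgebra M Fa" "\<And>q. q \<in> A \<Longrightarrow> q \<notin> W \<Longrightarrow> X q \<in> borel_measurable Fa"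
  defines "Z \<equiv> \<lambda>\<omega> \<omega>' q. if q \<in> B then Y q \<omega>' else if q \<in> A then X q \<omega> else 0"
  shows "\<bar>expectation (\<lambda>\<omega>. expectation (\<lambda>\<omega>'. G ((Z \<omega> \<omega>')(p := X p \<omega>))))
      - expectation (\<lambda>\<omega>. expectation (\<lambda>\<omega>'. G ((Z \<omega> \<omega>')(p := Y p \<omega>'))))\<bar>
    \<le> \<kappa> * (Lp_norm M 1 (real_cond_exp M Fa (\<lambda>\<omega>. (X p \<omega>)\<^sup>2 - v))
       + (\<Sum>m\<in>A \<inter> W. expectation (\<lambda>\<omega>. \<bar>(X p \<omega>)\<^sup>2 - v\<bar> * ct (X m \<omega>)))
       + expectation (\<lambda>\<omega>. (X p \<omega>)\<^sup>2 * ct (X p \<omega>)) + expectation (\<lambda>\<omega>. (Y p \<omega>)\<^sup>2 * ct (Y p \<omega>)))"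
proof -
  let ?S = "PiM UNIV (\<lambda>_. borel) :: ('i \<Rightarrow> real) measure"
  note [measurable] = X(1) G(1) G1(1) G2(1) ct(1)
  have Ym[measurable]: "Y q \<in> borel_measurable M" if "q \<in> insert p B" for q
    using Y(1) that by (auto simp: indep_vars_def2)
  have Yp[measurable]: "Y p \<in> borel_measurable M" by (rule Ym) simp
  \<comment> \<open>One common bound, because \<open>taylor_swap\<close> takes the same one for all
    three functions; it secures integrability and does not reach the conclusion.\<close>
  define b' where "b' = max b \<kappa>"
  have bG: "\<bar>G x\<bar> \<le> b'" "\<bar>G1 x\<bar> \<le> b'" "\<bar>G2 x\<bar> \<le> b'" for x
    using G(2)[of x] G1(2)[of x] G2(2)[of x] by (auto simp: b'_def)
  have \<kappa>: "0 \<le> \<kappa>" using G2(2)[of undefined] by linarith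
  define hyb where "hyb = (\<lambda>x \<omega>' q. if q \<in> B then Y q \<omega>' else x q)"
  define XJ where "XJ = (\<lambda>J \<omega> q. if q \<in> J then X q \<omega> else 0)"
  have Z: "Z \<omega> \<omega>' = hyb (XJ A \<omega>) \<omega>'" for \<omega> \<omega>'
    by (auto simp: Z_def hyb_def XJ_def fun_eq_iff)
  have XJ_meas: "XJ J \<in> measurable F ?S" if "\<And>q. q \<in> J \<Longrightarrow> X q \<in> borel_measurable F" for J and F :: "'a measure"
  proof (rule measurable_to_coordinates)
    show "(\<lambda>\<omega>. XJ J \<omega> q) \<in> borel_measurable F" for q
      by (cases "q \<in> J") (auto simp: XJ_def that)
  qed
  have hyb_meas[measurable]: "(\<lambda>(x, \<omega>'). hyb x \<omega>') \<in> measurable (?S \<Otimes>\<^sub>M M) ?S"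
  proof (rule measurable_to_coordinates)
    show "(\<lambda>\<omega>. (case \<omega> of (x, \<omega>') \<Rightarrow> hyb x \<omega>') q) \<in> borel_measurable (?S \<Otimes>\<^sub>M M)" for q
    proof (cases "q \<in> B")
      case True
      then have [measurable]: "Y q \<in> borel_measurable M" by (intro Ym) simp
      show ?thesis using True by (simp add: hyb_def case_prod_beta)
    next
      case False
      then show ?thesis by (simp add: hyb_def case_prod_beta)
    qed
  qed
  have hyb_meas1: "(\<lambda>\<omega>'. hyb x \<omega>') \<in> measurable M ?S" for x
    using measurable_Pair2[OF hyb_meas, of x] by (simp add: space_PiM)
  have avg_meas: "(\<lambda>x. expectation (\<lambda>\<omega>'. h (hyb x \<omega>'))) \<in> borel_measurable ?S"
    if "h \<in> borel_measurable ?S" for h :: "('i \<Rightarrow> real) \<Rightarrow> real"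
    using measurable_compose[OF hyb_meas that]
    by (intro borel_measurable_lebesgue_integral) (simp add: case_prod_beta)
  define \<phi>1 where "\<phi>1 = (\<lambda>x. expectation (\<lambda>\<omega>'. G1 (hyb x \<omega>')))"
  define \<phi>2 where "\<phi>2 = (\<lambda>x. expectation (\<lambda>\<omega>'. G2 (hyb x \<omega>')))"
  have \<phi>m[measurable]: "\<phi>1 \<in> borel_measurable ?S" "\<phi>2 \<in> borel_measurable ?S"
    unfolding \<phi>1_def \<phi>2_def by (intro avg_meas; simp)+
  have \<phi>b: "\<bar>\<phi>1 x\<bar> \<le> b" "\<bar>\<phi>2 x\<bar> \<le> \<kappa>" for x
  proof -
    note [measurable] = hyb_meas1[of x]
    show "\<bar>\<phi>1 x\<bar> \<le> b" "\<bar>\<phi>2 x\<bar> \<le> \<kappa>"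
      unfolding \<phi>1_def \<phi>2_def real_norm_def[symmetric] by (rule norm_expectation_le; simp add: G1(2) G2(2))+
  qed
  have \<phi>2_lip: "\<bar>\<phi>2 (x(m := t)) - \<phi>2 (x(m := 0))\<bar> \<le> \<kappa> * ct t" if m: "m \<in> A" for x m t
  proof -
    have hm: "hyb (x(m := s)) \<omega>' = (hyb x \<omega>')(m := s)" for s \<omega>'
      using m AB by (auto simp: hyb_def fun_eq_iff)
    have i: "integrable M (\<lambda>\<omega>'. G2 (hyb y \<omega>'))" for y
      by (rule integrable_bounded[where B = \<kappa>]) (use measurable_compose[OF hyb_meas1 G2(1)] in \<open>auto simp: G2(2)\<close>)
    have "\<phi>2 (x(m := t)) - \<phi>2 (x(m := 0)) = expectation (\<lambda>\<omega>'. G2 (hyb (x(m := t)) \<omega>') - G2 (hyb (x(m := 0)) \<omega>'))"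
      unfolding \<phi>2_def by (rule Bochner_Integration.integral_diff[symmetric]; rule i)
    moreover have "norm \<dots> \<le> \<kappa> * ct t"
    proof (rule norm_expectation_le)
      show "norm (G2 (hyb (x(m := t)) \<omega>') - G2 (hyb (x(m := 0)) \<omega>')) \<le> \<kappa> * ct t" for \<omega>'
        unfolding hm real_norm_def by (rule lip[OF m])
    qed (use i in simp)
    ultimately show ?thesis by simp
  qed
  have XA[measurable]: "XJ J \<in> measurable M ?S" for J by (rule XJ_meas) (rule X(1))
  have GX_meas: "(\<lambda>\<omega>. expectation (\<lambda>\<omega>'. G ((hyb (XJ A \<omega>) \<omega>')(p := X p \<omega>)))) \<in> borel_measurable M"
    and GY_meas: "(\<lambda>\<omega>. expectation (\<lambda>\<omega>'. G ((hyb (XJ A \<omega>) \<omega>')(p := Y p \<omega>')))) \<in> borel_measurable M"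
  proof -
    have hX[measurable]: "(\<lambda>(\<omega>, \<omega>'). hyb (XJ A \<omega>) \<omega>') \<in> measurable (M \<Otimes>\<^sub>M M) ?S"
      using measurable_compose[of "\<lambda>(\<omega>, \<omega>'). (XJ A \<omega>, \<omega>')" "M \<Otimes>\<^sub>M M" "?S \<Otimes>\<^sub>M M" "\<lambda>(x, \<omega>'). hyb x \<omega>'" ?S]
      by (simp add: case_prod_beta)
    have "(\<lambda>u. (hyb (XJ A (fst u)) (snd u))(p := X p (fst u))) \<in> measurable (M \<Otimes>\<^sub>M M) ?S"
      "(\<lambda>u. (hyb (XJ A (fst u)) (snd u))(p := Y p (snd u))) \<in> measurable (M \<Otimes>\<^sub>M M) ?S"
      using hX by (intro measurable_update_coordinate; simp add: case_prod_beta)+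
    from measurable_compose[OF this(1) G(1)] measurable_compose[OF this(2) G(1)]
    show "(\<lambda>\<omega>. expectation (\<lambda>\<omega>'. G ((hyb (XJ A \<omega>) \<omega>')(p := X p \<omega>)))) \<in> borel_measurable M"
      "(\<lambda>\<omega>. expectation (\<lambda>\<omega>'. G ((hyb (XJ A \<omega>) \<omega>')(p := Y p \<omega>')))) \<in> borel_measurable M"
      by (intro borel_measurable_lebesgue_integral; simp add: case_prod_beta)+
  qed
  have inner_meas: "(\<lambda>\<omega>'. G ((hyb x \<omega>')(p := s))) \<in> borel_measurable M"
    "(\<lambda>\<omega>'. G ((hyb x \<omega>')(p := Y p \<omega>'))) \<in> borel_measurable M" for x s
    by (rule measurable_compose[OF measurable_update_coordinate[OF hyb_meas1] G(1)]; simp)+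
  define DX where "DX = (\<lambda>\<omega>. expectation (\<lambda>\<omega>'. G ((hyb (XJ A \<omega>) \<omega>')(p := X p \<omega>))))"
  define DY where "DY = (\<lambda>\<omega>. expectation (\<lambda>\<omega>'. G ((hyb (XJ A \<omega>) \<omega>')(p := Y p \<omega>'))))"
  have iD: "integrable M DX" "integrable M DY"
    using GX_meas GY_meas inner_meas
    by (auto simp: DX_def DY_def intro!: integrable_bounded[where B = b] norm_expectation_le simp: G(2))
  have icut: "integrable M (\<lambda>\<omega>. (f \<omega>)\<^sup>2 * ct (g \<omega>))"
    if "f \<in> borel_measurable M" "g \<in> borel_measurable M" "integrable M (\<lambda>\<omega>. (f \<omega>)\<^sup>2)" for f g :: "'a \<Rightarrow> real"
    using that ct
    by (intro Bochner_Integration.integrable_bound[OF that(3)]) (auto intro!: AE_I2 mult_left_le simp: abs_mult)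
  have iXc: "integrable M (\<lambda>\<omega>. (X p \<omega>)\<^sup>2 * ct (X p \<omega>))" and iYc: "integrable M (\<lambda>\<omega>. (Y p \<omega>)\<^sup>2 * ct (Y p \<omega>))"
    by (intro icut; simp add: X Y)+
  define y\<rho> where "y\<rho> = expectation (\<lambda>\<omega>. (Y p \<omega>)\<^sup>2 * ct (Y p \<omega>))"
  \<comment> \<open>With \<open>\<omega>\<close> frozen, \<open>X p \<omega>\<close> is a number and
    only the Gaussian entries at \<open>\<omega>'\<close> are random; \<open>taylor_swap\<close>
    applies with the hybrid as environment.\<close>
  have pointwise: "\<bar>DX \<omega> - DY \<omega> - X p \<omega> * \<phi>1 (XJ A \<omega>) - ((X p \<omega>)\<^sup>2 - v) * \<phi>2 (XJ A \<omega>)\<bar>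
      \<le> \<kappa> * ((X p \<omega>)\<^sup>2 * ct (X p \<omega>)) + \<kappa> * y\<rho>" for \<omega>
  proof -
    define Dp where "Dp = (\<lambda>\<omega>' q. if q \<in> {p} then Y q \<omega>' else 0)"
    have Dp: "Dp \<omega>' p = Y p \<omega>'" for \<omega>' by (simp add: Dp_def)
    have ind: "indep_var ?S (hyb (XJ A \<omega>)) ?S Dp"
      unfolding hyb_def Dp_def by (rule indep_var_patched_coordinates[OF Y(1)]) (use p in auto)
    have hp: "hyb (XJ A \<omega>) \<omega>' p = 0" for \<omega>' using p by (simp add: hyb_def XJ_def)
    show ?thesis
      using taylor_swap[OF ind hp, unfolded Dp, OF Y(2-4) G(1) bG(1) G1(1) bG(2) G2(1) bG(3) expand, of "X p \<omega>"] iYc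
      by (simp add: DX_def DY_def \<phi>1_def \<phi>2_def y\<rho>_def del: fun_upd_apply)
  qed
  have iX: "integrable M (X p)" by (rule square_integrable_imp_integrable[OF X(1) X(2)])
  have iXv: "integrable M (\<lambda>\<omega>. (X p \<omega>)\<^sup>2 - v)" using X(2) by simp
  have ibd: "integrable M (\<lambda>\<omega>. f \<omega> * g \<omega>)"
    if "integrable M f" "g \<in> borel_measurable M" "\<And>\<omega>. \<bar>g \<omega>\<bar> \<le> C" for f g :: "'a \<Rightarrow> real" and C
  proof (rule Bochner_Integration.integrable_bound)
    show "integrable M (\<lambda>\<omega>. C * f \<omega>)" using that by simp
    have "\<bar>f \<omega> * g \<omega>\<bar> \<le> \<bar>C * f \<omega>\<bar>" for \<omega>
    proof -
      have "\<bar>f \<omega>\<bar> * \<bar>g \<omega>\<bar> \<le> \<bar>f \<omega>\<bar> * \<bar>C\<bar>" using that(3)[of \<omega>] by (intro mult_left_mono) auto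
      then show ?thesis by (simp add: abs_mult mult.commute)
    qed
    then show "AE \<omega> in M. norm (f \<omega> * g \<omega>) \<le> norm (C * f \<omega>)" by simp
  qed (use that in measurable)
  have i1: "integrable M (\<lambda>\<omega>. X p \<omega> * \<phi>1 (XJ A \<omega>))" by (rule ibd[OF iX _ \<phi>b(1)]) measurable
  have i2: "integrable M (\<lambda>\<omega>. ((X p \<omega>)\<^sup>2 - v) * \<phi>2 (XJ J \<omega>))" for J by (rule ibd[OF iXv _ \<phi>b(2)]) measurable
  let ?r = "\<lambda>\<omega>. DX \<omega> - DY \<omega> - X p \<omega> * \<phi>1 (XJ A \<omega>) - ((X p \<omega>)\<^sup>2 - v) * \<phi>2 (XJ A \<omega>)"
  have ir: "integrable M ?r" using iD i1 i2 by simp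
  have "\<bar>expectation ?r\<bar> \<le> expectation (\<lambda>\<omega>. \<bar>?r \<omega>\<bar>)" by (rule integral_abs_bound)
  also have "\<dots> \<le> expectation (\<lambda>\<omega>. \<kappa> * ((X p \<omega>)\<^sup>2 * ct (X p \<omega>)) + \<kappa> * y\<rho>)"
    using ir iXc by (intro integral_mono pointwise) auto
  also have "\<dots> = \<kappa> * expectation (\<lambda>\<omega>. (X p \<omega>)\<^sup>2 * ct (X p \<omega>)) + \<kappa> * y\<rho>"
    using iXc by (simp add: prob_space)
  finally have rem: "\<bar>expectation ?r\<bar> \<le> \<kappa> * expectation (\<lambda>\<omega>. (X p \<omega>)\<^sup>2 * ct (X p \<omega>)) + \<kappa> * y\<rho>" .
  have E_r: "expectation ?r = expectation DX - expectation DY - expectation (\<lambda>\<omega>. X p \<omega> * \<phi>1 (XJ A \<omega>))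
      - expectation (\<lambda>\<omega>. ((X p \<omega>)\<^sup>2 - v) * \<phi>2 (XJ A \<omega>))"
    using iD i1 i2 by simp
  \<comment> \<open>The martingale difference condition: every position in \<open>A\<close> belongs
    to the past of \<open>p\<close>.\<close>
  have first: "expectation (\<lambda>\<omega>. X p \<omega> * \<phi>1 (XJ A \<omega>)) = 0"
  proof -
    have "(\<lambda>\<omega>. \<phi>1 (XJ A \<omega>)) \<in> borel_measurable F1"
      using measurable_compose[OF XJ_meas[of A F1] \<phi>m(1)] F1(2) by simp
    from expectation_mult_cond_exp_zero[OF F1(1) this \<phi>b(1) iX F1(3)] show ?thesis by (simp add: mult.commute)
  qed
  \<comment> \<open>Zeroing the positions in \<open>W\<close> leaves a factor measurable with
    respect to \<open>Fa\<close>; the cost of doing so is estimated in \<open>third\<close>.\<close>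
  let ?J = "A - W"
  have "(\<lambda>\<omega>. \<phi>2 (XJ ?J \<omega>)) \<in> borel_measurable Fa"
    using measurable_compose[OF XJ_meas[of ?J Fa] \<phi>m(2)] Fa(2) by simp
  from abs_expectation_mult_le_cond_exp[OF Fa(1) this \<phi>b(2) iXv]
  have second: "\<bar>expectation (\<lambda>\<omega>. ((X p \<omega>)\<^sup>2 - v) * \<phi>2 (XJ ?J \<omega>))\<bar>
      \<le> \<kappa> * Lp_norm M 1 (real_cond_exp M Fa (\<lambda>\<omega>. (X p \<omega>)\<^sup>2 - v))"
    by (simp add: mult.commute)
  have ic: "integrable M (\<lambda>\<omega>. \<bar>(X p \<omega>)\<^sup>2 - v\<bar> * ct (X m \<omega>))" for m
  proof -
    have "\<bar>ct (X m \<omega>)\<bar> \<le> 1" for \<omega> using ct(2,3)[of "X m \<omega>"] by simp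
    from ibd[OF integrable_abs[OF iXv] _ this] show ?thesis by simp
  qed
  have third: "\<bar>expectation (\<lambda>\<omega>. ((X p \<omega>)\<^sup>2 - v) * \<phi>2 (XJ A \<omega>)) - expectation (\<lambda>\<omega>. ((X p \<omega>)\<^sup>2 - v) * \<phi>2 (XJ ?J \<omega>))\<bar>
      \<le> \<kappa> * (\<Sum>m\<in>A \<inter> W. expectation (\<lambda>\<omega>. \<bar>(X p \<omega>)\<^sup>2 - v\<bar> * ct (X m \<omega>)))"
  proof -
    have "expectation (\<lambda>\<omega>. ((X p \<omega>)\<^sup>2 - v) * \<phi>2 (XJ A \<omega>)) - expectation (\<lambda>\<omega>. ((X p \<omega>)\<^sup>2 - v) * \<phi>2 (XJ ?J \<omega>))
      = expectation (\<lambda>\<omega>. ((X p \<omega>)\<^sup>2 - v) * \<phi>2 (XJ A \<omega>) - ((X p \<omega>)\<^sup>2 - v) * \<phi>2 (XJ ?J \<omega>))"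
      using i2 by simp
    also have "\<bar>\<dots>\<bar> \<le> expectation (\<lambda>\<omega>. \<bar>((X p \<omega>)\<^sup>2 - v) * \<phi>2 (XJ A \<omega>) - ((X p \<omega>)\<^sup>2 - v) * \<phi>2 (XJ ?J \<omega>)\<bar>)"
      by (rule integral_abs_bound)
    also have "\<dots> \<le> expectation (\<lambda>\<omega>. \<kappa> * (\<Sum>m\<in>A \<inter> W. \<bar>(X p \<omega>)\<^sup>2 - v\<bar> * ct (X m \<omega>)))"
    proof (rule integral_mono)
      show "integrable M (\<lambda>\<omega>. \<bar>((X p \<omega>)\<^sup>2 - v) * \<phi>2 (XJ A \<omega>) - ((X p \<omega>)\<^sup>2 - v) * \<phi>2 (XJ ?J \<omega>)\<bar>)"
        using i2 by simp
      show "integrable M (\<lambda>\<omega>. \<kappa> * (\<Sum>m\<in>A \<inter> W. \<bar>(X p \<omega>)\<^sup>2 - v\<bar> * ct (X m \<omega>)))"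
        using ic by simp
      fix \<omega>
      have zero: "(\<lambda>q. if q \<in> A \<inter> W then 0 else XJ A \<omega> q) = XJ ?J \<omega>"
        by (auto simp: XJ_def fun_eq_iff)
      have "\<bar>\<phi>2 (XJ A \<omega>) - \<phi>2 (XJ ?J \<omega>)\<bar> \<le> \<kappa> * (\<Sum>m\<in>A \<inter> W. ct (XJ A \<omega> m))"
        using zero_coordinates_bound[of "A \<inter> W" \<phi>2 \<kappa> ct "XJ A \<omega>"] fin \<phi>2_lip unfolding zero by simp
      then have "\<bar>(X p \<omega>)\<^sup>2 - v\<bar> * \<bar>\<phi>2 (XJ A \<omega>) - \<phi>2 (XJ ?J \<omega>)\<bar>
          \<le> \<bar>(X p \<omega>)\<^sup>2 - v\<bar> * (\<kappa> * (\<Sum>m\<in>A \<inter> W. ct (XJ A \<omega> m)))"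
        by (rule mult_left_mono) simp
      also have "(\<Sum>m\<in>A \<inter> W. ct (XJ A \<omega> m)) = (\<Sum>m\<in>A \<inter> W. ct (X m \<omega>))"
        by (rule sum.cong) (auto simp: XJ_def)
      finally show "\<bar>((X p \<omega>)\<^sup>2 - v) * \<phi>2 (XJ A \<omega>) - ((X p \<omega>)\<^sup>2 - v) * \<phi>2 (XJ ?J \<omega>)\<bar>
          \<le> \<kappa> * (\<Sum>m\<in>A \<inter> W. \<bar>(X p \<omega>)\<^sup>2 - v\<bar> * ct (X m \<omega>))"
        unfolding right_diff_distrib[symmetric] abs_mult by (simp add: sum_distrib_left mult_ac)
    qed
    also have "\<dots> = \<kappa> * (\<Sum>m\<in>A \<inter> W. expectation (\<lambda>\<omega>. \<bar>(X p \<omega>)\<^sup>2 - v\<bar> * ct (X m \<omega>)))"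
      using ic by simp
    finally show ?thesis .
  qed
  have "\<bar>expectation DX - expectation DY\<bar> \<le> \<kappa> * expectation (\<lambda>\<omega>. (X p \<omega>)\<^sup>2 * ct (X p \<omega>)) + \<kappa> * y\<rho>
     + \<kappa> * Lp_norm M 1 (real_cond_exp M Fa (\<lambda>\<omega>. (X p \<omega>)\<^sup>2 - v))
     + \<kappa> * (\<Sum>m\<in>A \<inter> W. expectation (\<lambda>\<omega>. \<bar>(X p \<omega>)\<^sup>2 - v\<bar> * ct (X m \<omega>)))"
    using rem second third unfolding E_r first by linarith
  then show ?thesis by (simp add: Z DX_def DY_def y\<rho>_def algebra_simps)
qed

text \<open>Telescoping over the hybrids \<open>H k\<close>, in which positions with
  \<open>key\<close> below \<open>k\<close> carry \<open>X\<close>. At a \<open>k\<close> outside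
  the range of \<open>key\<close> nothing changes, so any injective numbering can encode the
  order.\<close>

lemma lindeberg_swap:
  fixes X Y :: "'i \<Rightarrow> 'a \<Rightarrow> real" and G :: "('i \<Rightarrow> real) \<Rightarrow> real"
    and G1 G2 :: "'i \<Rightarrow> ('i \<Rightarrow> real) \<Rightarrow> real" and key :: "'i \<Rightarrow> nat"
  assumes fin: "finite I" and inj: "inj_on key I"
    and X: "\<And>q. X q \<in> borel_measurable M" "\<And>p. integrable M (\<lambda>\<omega>. (X p \<omega>)\<^sup>2)"
    and Y: "indep_vars (\<lambda>_. borel) Y I" "\<And>p. p \<in> I \<Longrightarrow> integrable M (\<lambda>\<omega>. (Y p \<omega>)\<^sup>2)"
      "\<And>p. p \<in> I \<Longrightarrow> expectation (Y p) = 0" "\<And>p. p \<in> I \<Longrightarrow> expectation (\<lambda>\<omega>. (Y p \<omega>)\<^sup>2) = v p"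
    and G: "G \<in> borel_measurable (PiM UNIV (\<lambda>_. borel))" "\<And>x. \<bar>G x\<bar> \<le> b"
    and G1: "\<And>p. p \<in> I \<Longrightarrow> G1 p \<in> borel_measurable (PiM UNIV (\<lambda>_. borel))" "\<And>p x. p \<in> I \<Longrightarrow> \<bar>G1 p x\<bar> \<le> b"
    and G2: "\<And>p. p \<in> I \<Longrightarrow> G2 p \<in> borel_measurable (PiM UNIV (\<lambda>_. borel))" "\<And>p x. p \<in> I \<Longrightarrow> \<bar>G2 p x\<bar> \<le> \<kappa>"
    and expand: "\<And>p x t. p \<in> I \<Longrightarrow>
      \<bar>G (x(p := t)) - G (x(p := 0)) - t * G1 p (x(p := 0)) - t\<^sup>2 * G2 p (x(p := 0))\<bar> \<le> \<kappa> * (t\<^sup>2 * ct t)"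
    and lip: "\<And>p x m t. p \<in> I \<Longrightarrow> m \<in> I \<Longrightarrow> \<bar>G2 p (x(m := t)) - G2 p (x(m := 0))\<bar> \<le> \<kappa> * ct t"
    and ct: "ct \<in> borel_measurable borel" "\<And>t. 0 \<le> ct t" "\<And>t. ct t \<le> 1"
    and F1: "\<And>p. p \<in> I \<Longrightarrow> subalgebra M (F1 p)"
      "\<And>p q. p \<in> I \<Longrightarrow> q \<in> I \<Longrightarrow> key q < key p \<Longrightarrow> X q \<in> borel_measurable (F1 p)"
      "\<And>p. p \<in> I \<Longrightarrow> AE \<omega> in M. real_cond_exp M (F1 p) (X p) \<omega> = 0"
    and Fa: "\<And>p. p \<in> I \<Longrightarrow> subalgebra M (Fa p)"
      "\<And>p q. p \<in> I \<Longrightarrow> q \<in> I \<Longrightarrow> key q < key p \<Longrightarrow> q \<notin> W p \<Longrightarrow> X q \<in> borel_measurable (Fa p)"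
  shows "\<bar>expectation (\<lambda>\<omega>. G (\<lambda>q. if q \<in> I then X q \<omega> else 0))
      - expectation (\<lambda>\<omega>. G (\<lambda>q. if q \<in> I then Y q \<omega> else 0))\<bar>
    \<le> \<kappa> * (\<Sum>p\<in>I. Lp_norm M 1 (real_cond_exp M (Fa p) (\<lambda>\<omega>. (X p \<omega>)\<^sup>2 - v p))
       + (\<Sum>m\<in>I \<inter> W p. expectation (\<lambda>\<omega>. \<bar>(X p \<omega>)\<^sup>2 - v p\<bar> * ct (X m \<omega>)))
       + expectation (\<lambda>\<omega>. (X p \<omega>)\<^sup>2 * ct (X p \<omega>)) + expectation (\<lambda>\<omega>. (Y p \<omega>)\<^sup>2 * ct (Y p \<omega>)))"
    (is "_ \<le> \<kappa> * (\<Sum>p\<in>I. ?bound p)")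
proof -
  define H where "H = (\<lambda>k. expectation (\<lambda>\<omega>. expectation (\<lambda>\<omega>'.
     G (\<lambda>q. if q \<in> I then if key q < k then X q \<omega> else Y q \<omega>' else 0))))"
  \<comment> \<open>The inserted 0 keeps \<open>Max\<close> meaningful when \<open>I\<close> is
    empty; \<open>Suc\<close> puts every key strictly below \<open>T\<close>.\<close>
  define T where "T = Suc (Max (insert 0 (key ` I)))"
  have T: "key q < T" if "q \<in> I" for q
    using that fin by (auto simp: T_def less_Suc_eq_le)
  have HT: "H T = expectation (\<lambda>\<omega>. G (\<lambda>q. if q \<in> I then X q \<omega> else 0))"
    unfolding H_def using T by (simp add: prob_space cong: if_cong)
  have H0: "H 0 = expectation (\<lambda>\<omega>. G (\<lambda>q. if q \<in> I then Y q \<omega> else 0))"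
    unfolding H_def by (simp add: prob_space cong: if_cong)
  have same: "H (Suc k) = H k" if "k \<notin> key ` I" for k
  proof -
    have "(\<lambda>q. if q \<in> I then if key q < Suc k then X q \<omega> else Y q \<omega>' else 0)
        = (\<lambda>q. if q \<in> I then if key q < k then X q \<omega> else Y q \<omega>' else 0)" for \<omega> \<omega>'
      using that by (auto simp: fun_eq_iff less_Suc_eq)
    then show ?thesis by (simp add: H_def)
  qed
  have step: "\<bar>H (Suc (key p)) - H (key p)\<bar> \<le> \<kappa> * ?bound p" if p: "p \<in> I" for p
  proof -
    define A where "A = {q \<in> I. key q < key p}"
    define B where "B = {q \<in> I. key p < key q}"
    have pAB: "p \<notin> A" "p \<notin> B" "A \<inter> B = {}" "finite A" using fin by (auto simp: A_def B_def)
    have only_p: "q = p" if "q \<in> I" "key q = key p" for q using inj p that by (auto simp: inj_on_def)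
    let ?Z = "\<lambda>\<omega> \<omega>' q. if q \<in> B then Y q \<omega>' else if q \<in> A then X q \<omega> else 0"
    \<comment> \<open>Consecutive hybrids differ at \<open>p\<close> alone, since injectivity makes
      \<open>p\<close> the only position with its key.\<close>
    have ZX: "(?Z \<omega> \<omega>')(p := X p \<omega>) = (\<lambda>q. if q \<in> I then if key q < Suc (key p) then X q \<omega> else Y q \<omega>' else 0)"
      and ZY: "(?Z \<omega> \<omega>')(p := Y p \<omega>') = (\<lambda>q. if q \<in> I then if key q < key p then X q \<omega> else Y q \<omega>' else 0)" for \<omega> \<omega>'
      using p by (auto simp: fun_eq_iff A_def B_def less_Suc_eq not_less le_less dest: only_p)
    have "\<bar>H (Suc (key p)) - H (key p)\<bar>
        \<le> \<kappa> * (Lp_norm M 1 (real_cond_exp M (Fa p) (\<lambda>\<omega>. (X p \<omega>)\<^sup>2 - v p))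
       + (\<Sum>m\<in>A \<inter> W p. expectation (\<lambda>\<omega>. \<bar>(X p \<omega>)\<^sup>2 - v p\<bar> * ct (X m \<omega>)))
       + expectation (\<lambda>\<omega>. (X p \<omega>)\<^sup>2 * ct (X p \<omega>)) + expectation (\<lambda>\<omega>. (Y p \<omega>)\<^sup>2 * ct (Y p \<omega>)))"
      unfolding H_def ZX[symmetric] ZY[symmetric]
    proof (rule lindeberg_step[where b = b and ?G1.0 = "G1 p" and ?G2.0 = "G2 p" and ?F1.0 = "F1 p"])
      show "indep_vars (\<lambda>_. borel) Y (insert p B)"
        by (rule indep_vars_subset[OF Y(1)]) (use p in \<open>auto simp: B_def\<close>)
    qed (use pAB X Y(2-4)[OF p] G G1[OF p] G2[OF p] expand[OF p] lip[OF p] ct F1[OF p] Fa[OF p] in \<open>auto simp: A_def simp del: fun_upd_apply\<close>)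
    \<comment> \<open>Enlarging \<open>A \<inter> W p\<close> to \<open>I \<inter> W p\<close> adds
      nonnegative terms and removes the order from the bound.\<close>
    also have "\<dots> \<le> \<kappa> * ?bound p"
    proof -
      have "0 \<le> \<kappa>" using G2(2)[OF p, of undefined] by linarith
      moreover have "(\<Sum>m\<in>A \<inter> W p. expectation (\<lambda>\<omega>. \<bar>(X p \<omega>)\<^sup>2 - v p\<bar> * ct (X m \<omega>)))
          \<le> (\<Sum>m\<in>I \<inter> W p. expectation (\<lambda>\<omega>. \<bar>(X p \<omega>)\<^sup>2 - v p\<bar> * ct (X m \<omega>)))"
        using fin ct by (intro sum_mono2) (auto simp: A_def)
      ultimately show ?thesis by (intro mult_left_mono) auto
    qed
    finally show ?thesis .
  qed
  have "H T - H 0 = (\<Sum>k<T. H (Suc k) - H k)" by (rule sum_lessThan_telescope[symmetric])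
  also have "\<dots> = (\<Sum>k\<in>key ` I. H (Suc k) - H k)"
    by (rule sum.mono_neutral_right) (use T same in auto)
  also have "\<dots> = (\<Sum>p\<in>I. H (Suc (key p)) - H (key p))"
    using inj by (simp add: sum.reindex)
  finally have "\<bar>H T - H 0\<bar> \<le> (\<Sum>p\<in>I. \<bar>H (Suc (key p)) - H (key p)\<bar>)" by (simp add: sum_abs)
  also have "\<dots> \<le> (\<Sum>p\<in>I. \<kappa> * ?bound p)" by (rule sum_mono) (rule step)
  finally show ?thesis unfolding HT H0 by (simp only: sum_distrib_left)
qed

end

subsection \<open>Lexicographic order and truncated moments\<close>

lemma lex_code_less_iff:
  fixes j j' n :: nat
  assumes "j \<le> n" "j' \<le> n"
  shows "i * Suc n + j < i' * Suc n + j' \<longleftrightarrow> i < i' \<or> (i = i' \<and> j < j')"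
proof -
  consider "i < i'" | "i = i'" | "i' < i" by linarith
  then show ?thesis
  proof cases
    case 1
    then have "Suc i * Suc n \<le> i' * Suc n" by (intro mult_le_mono1) simp
    then show ?thesis using 1 assms by simp
  next
    case 2
    then show ?thesis by simp
  next
    case 3
    then have "Suc i' * Suc n \<le> i * Suc n" by (intro mult_le_mono1) simp
    then show ?thesis using 3 assms by simp
  qed
qed

text \<open>The coordinates serve as digits in base \<open>Suc n\<close>; the second is a valid
  digit because it is at most \<open>n\<close>. Comparing codes is then comparing
  lexicographically.\<close>

definition lex_code :: "nat \<Rightarrow> int \<times> int \<Rightarrow> nat" where
  "lex_code n p = nat (fst p) * Suc n + nat (snd p)"

lemma lex_code_less:
  assumes "p \<in> lower_triangle n" "q \<in> lower_triangle n" "lex_code n q < lex_code n p"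
  shows "lex_le q p" "q \<noteq> p"
proof -
  have "nat (fst q) < nat (fst p) \<or> (nat (fst q) = nat (fst p) \<and> nat (snd q) < nat (snd p))"
    using assms lex_code_less_iff[of "nat (snd q)" n "nat (snd p)" "nat (fst q)" "nat (fst p)"]
    unfolding lex_code_def by (auto simp: lower_triangle_def)
  then show "lex_le q p" "q \<noteq> p" using assms(1,2) by (auto simp: lex_le_def lower_triangle_def)
qed

lemma inj_on_lex_code: "inj_on (lex_code n) (lower_triangle n)"
proof (rule inj_onI)
  fix p q assume pq: "p \<in> lower_triangle n" "q \<in> lower_triangle n" "lex_code n p = lex_code n q"
  have le: "nat (snd p) \<le> n" "nat (snd q) \<le> n" using pq(1,2) by (auto simp: lower_triangle_def)
  have "\<not> lex_code n p < lex_code n q" "\<not> lex_code n q < lex_code n p" using pq(3) by simp_all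
  then have "nat (fst p) = nat (fst q) \<and> nat (snd p) = nat (snd q)"
    unfolding lex_code_def lex_code_less_iff[OF le] lex_code_less_iff[OF le(2,1)] by linarith
  then show "p = q" using pq(1,2) by (auto simp: lower_triangle_def)
qed

lemma lower_triangle_Sigma: "lower_triangle n = Sigma {1..int n} (\<lambda>i. {1..i})"
  by (auto simp: lower_triangle_def)

lemma finite_triangle [simp]: "finite (lower_triangle n)"
  by (simp add: lower_triangle_Sigma)

lemma sum_triangle:
  "(\<Sum>i=1..int n. \<Sum>j=1..i. f i j) = (\<Sum>p\<in>lower_triangle n. f (fst p) (snd p))"
  unfolding lower_triangle_Sigma by (subst sum.Sigma) (auto simp: case_prod_beta)

text \<open>The exact complement of the distance condition in \<open>past_set\<close>, hence the
  strict inequalities in both coordinates.\<close>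

definition near :: "nat \<Rightarrow> int \<times> int \<Rightarrow> (int \<times> int) set" where
  "near a p = {q. \<bar>fst q - fst p\<bar> < int a \<and> \<bar>snd q - snd p\<bar> < int a}"

lemma near_sym: "q \<in> near a p \<longleftrightarrow> p \<in> near a q"
  by (auto simp: near_def abs_minus_commute)

lemma finite_near: "finite (near a p)" and card_near: "card (near a p) \<le> (2 * a)\<^sup>2"
proof -
  have eq: "near a p = {fst p - int a<..<fst p + int a} \<times> {snd p - int a<..<snd p + int a}"
    by (auto simp: near_def abs_less_iff)
  show "finite (near a p)" unfolding eq by simp
  have "card {i - int a<..<i + int a} \<le> 2 * a" for i by simp
  then show "card (near a p) \<le> (2 * a)\<^sup>2"
    unfolding eq card_cartesian_product power2_eq_square by (intro mult_le_mono) auto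
qed

text \<open>A neighbourhood has at most \<open>(2 * a)\<^sup>2\<close> positions whatever
  \<open>n\<close> is, so the double sum costs a constant factor. When the summand belongs to the
  neighbour, symmetry of \<open>near\<close> allows the two sums to be exchanged first.\<close>

lemma sum_near_le:
  fixes f :: "int \<times> int \<Rightarrow> real"
  assumes "finite I" "\<And>p. p \<in> I \<Longrightarrow> 0 \<le> f p"
  shows "(\<Sum>p\<in>I. \<Sum>m\<in>I \<inter> near a p. f p) \<le> (2 * real a)\<^sup>2 * (\<Sum>p\<in>I. f p)"
    and "(\<Sum>p\<in>I. \<Sum>m\<in>I \<inter> near a p. f m) \<le> (2 * real a)\<^sup>2 * (\<Sum>p\<in>I. f p)"
proof -
  show 1: "(\<Sum>p\<in>I. \<Sum>m\<in>I \<inter> near a p. f p) \<le> (2 * real a)\<^sup>2 * (\<Sum>p\<in>I. f p)"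
    unfolding sum_distrib_left
  proof (rule sum_mono)
    fix p assume p: "p \<in> I"
    have "card (I \<inter> near a p) \<le> card (near a p)" by (intro card_mono finite_near) auto
    then have "real (card (I \<inter> near a p)) \<le> real ((2 * a)\<^sup>2)" using card_near[of a p] by linarith
    then show "(\<Sum>m\<in>I \<inter> near a p. f p) \<le> (2 * real a)\<^sup>2 * f p"
      using assms(2)[OF p] by (simp add: mult_right_mono)
  qed
  have "(\<Sum>p\<in>I. \<Sum>m\<in>I \<inter> near a p. f m) = (\<Sum>p\<in>I. \<Sum>m\<in>{m \<in> I. m \<in> near a p}. f m)"
    by (intro sum.cong) auto
  also have "\<dots> = (\<Sum>m\<in>I. \<Sum>p\<in>{p \<in> I. m \<in> near a p}. f m)"
    by (rule sum.swap_restrict) (use assms in auto)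
  also have "\<dots> = (\<Sum>m\<in>I. \<Sum>p\<in>I \<inter> near a m. f m)"
    by (intro sum.cong) (auto simp: near_sym)
  finally show "(\<Sum>p\<in>I. \<Sum>m\<in>I \<inter> near a p. f m) \<le> (2 * real a)\<^sup>2 * (\<Sum>p\<in>I. f p)"
    using 1 by simp
qed

text \<open>Only the lower triangle is read, so the hybrids of the exchange may be zero
  elsewhere.\<close>

lemma stj_cong:
  assumes "\<And>p. p \<in> lower_triangle n \<Longrightarrow> x p = y p"
  shows "stj n z x = stj n z y"
proof -
  have "normalized_entry n x i j = normalized_entry n y i j" if "i < n" "j < n" for i j
    using that assms by (auto simp: normalized_entry_def lower_triangle_def)
  then have "shifted_matrix n z x = shifted_matrix n z y"
    using carrier_matD[OF shifted_matrix_carrier[of n z x]] carrier_matD[OF shifted_matrix_carrier[of n z y]]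
    by (intro eq_matI) (simp_all add: shifted_matrix_entry)
  then show ?thesis by (simp add: stj_def resolvent_def)
qed

section \<open>Truncated second moments and the cutoff\<close>

definition tail_moment :: "'a measure \<Rightarrow> real \<Rightarrow> ('a \<Rightarrow> real) \<Rightarrow> real" where
  "tail_moment M r f = (\<integral>\<omega>. (f \<omega>)\<^sup>2 * indicator {\<omega>. \<bar>f \<omega>\<bar> > r} \<omega> \<partial>M)"

lemma tail_nonneg: "0 \<le> tail_moment M r f"
  unfolding tail_moment_def by (intro Bochner_Integration.integral_nonneg) simp

lemma cutoff_le:
  assumes "n \<ge> 1" "\<bar>y\<bar> \<le> \<epsilon> * sqrt n"
  shows "cutoff n y \<le> \<epsilon>"
proof -
  have "\<bar>y\<bar> / sqrt n \<le> \<epsilon>" using assms by (simp add: divide_le_eq)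
  then show ?thesis by (simp add: cutoff_def min_le_iff_disj)
qed

text \<open>For small \<open>y\<close> the cutoff is at most \<epsilon>. For large \<open>y\<close>,
  either \<open>x\<close> is large too and its own tail pays, or x^2 is at most y^2 and the tail of
  \<open>y\<close> pays. A product of two dependent entries is thus controlled by their separate
  tails.\<close>

lemma square_mult_cutoff_le:
  assumes "n \<ge> 1" "\<epsilon> > 0"
  shows "x\<^sup>2 * cutoff n y \<le> \<epsilon> * x\<^sup>2 + x\<^sup>2 * of_bool (\<bar>x\<bar> > \<epsilon> * sqrt n) + y\<^sup>2 * of_bool (\<bar>y\<bar> > \<epsilon> * sqrt n)"
proof (cases "\<bar>y\<bar> \<le> \<epsilon> * sqrt n")
  case True
  then have "x\<^sup>2 * cutoff n y \<le> x\<^sup>2 * \<epsilon>" using cutoff_le[OF assms(1) True] by (intro mult_left_mono) auto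
  moreover have "0 \<le> x\<^sup>2 * of_bool (\<bar>x\<bar> > \<epsilon> * sqrt n)" "0 \<le> y\<^sup>2 * of_bool (\<bar>y\<bar> > \<epsilon> * sqrt n)" by simp_all
  moreover have "\<epsilon> * x\<^sup>2 = x\<^sup>2 * \<epsilon>" by simp
  ultimately show ?thesis by linarith
next
  case False
  have 1: "x\<^sup>2 * cutoff n y \<le> x\<^sup>2" using mult_left_mono[OF cutoff_le_1[of n y], of "x\<^sup>2"] by simp
  have e: "0 \<le> \<epsilon> * x\<^sup>2" using assms(2) by simp
  show ?thesis
  proof (cases "\<bar>x\<bar> > \<epsilon> * sqrt n")
    case True
    have "x\<^sup>2 * cutoff n y \<le> \<epsilon> * x\<^sup>2 + x\<^sup>2 + y\<^sup>2"
      using 1 e zero_le_power2[of y] by linarith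
    then show ?thesis using True False by simp
  next
    case xs: False
    then have "\<bar>x\<bar> \<le> \<bar>y\<bar>" using False by linarith
    then have "x\<^sup>2 \<le> y\<^sup>2" using abs_le_square_iff by blast
    then show ?thesis using xs False 1 e by simp
  qed
qed

text \<open>The deterministic counterpart, with a variance in place of x^2: for large
  \<open>y\<close> the number \<epsilon>^2 n is at most y^2, and \<open>L\<close> covers the excess
  of \<open>v\<close> over it.\<close>

lemma const_mult_cutoff_le:
  assumes "n \<ge> 1" "\<epsilon> > 0" and v: "0 \<le> v" "v \<le> \<epsilon>\<^sup>2 * n + L" and L: "0 \<le> L"
  shows "v * cutoff n y \<le> \<epsilon> * v + L + y\<^sup>2 * of_bool (\<bar>y\<bar> > \<epsilon> * sqrt n)"
proof (cases "\<bar>y\<bar> \<le> \<epsilon> * sqrt n")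
  case True
  then have "v * cutoff n y \<le> v * \<epsilon>" using cutoff_le[OF assms(1) True] v by (intro mult_left_mono) auto
  then show ?thesis using True L by (simp add: mult.commute)
next
  case False
  have 1: "v * cutoff n y \<le> v" using mult_left_mono[OF cutoff_le_1[of n y] v(1)] by simp
  have "(\<epsilon> * sqrt n)\<^sup>2 \<le> \<bar>y\<bar>\<^sup>2" using False assms(2) by (intro power_mono) auto
  then have "\<epsilon>\<^sup>2 * n \<le> y\<^sup>2" by (simp add: power_mult_distrib)
  moreover have "0 \<le> \<epsilon> * v" using assms(2) v(1) by simp
  ultimately show ?thesis using False 1 v(2) by simp
qed

lemma measurable_cutoff [measurable]: "cutoff n \<in> borel_measurable borel"
  unfolding cutoff_def[abs_def] by measurable

context prob_space
begin

lemma tail_eq: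
  fixes f :: "'a \<Rightarrow> real"
  shows "tail_moment M r f = expectation (\<lambda>\<omega>. (f \<omega>)\<^sup>2 * of_bool (\<bar>f \<omega>\<bar> > r))"
  unfolding tail_moment_def by (intro Bochner_Integration.integral_cong) (auto simp: indicator_def)

lemma integrable_tail:
  fixes f :: "'a \<Rightarrow> real"
  assumes [measurable]: "f \<in> borel_measurable M" and "integrable M (\<lambda>\<omega>. (f \<omega>)\<^sup>2)"
  shows "integrable M (\<lambda>\<omega>. (f \<omega>)\<^sup>2 * of_bool (\<bar>f \<omega>\<bar> > r))"
  by (rule Bochner_Integration.integrable_bound[OF assms(2)]) auto

text \<open>Supplies the hypothesis \<open>v \<le> \<epsilon>\<^sup>2 * n + L\<close> of the cutoff
  estimates, with the tail moment as \<open>L\<close>.\<close>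

lemma second_moment_le_tail:
  fixes f :: "'a \<Rightarrow> real"
  assumes f: "f \<in> borel_measurable M" "integrable M (\<lambda>\<omega>. (f \<omega>)\<^sup>2)"
  shows "expectation (\<lambda>\<omega>. (f \<omega>)\<^sup>2) \<le> \<epsilon>\<^sup>2 * real n + tail_moment M (\<epsilon> * sqrt n) f"
proof -
  have pw: "(f \<omega>)\<^sup>2 \<le> \<epsilon>\<^sup>2 * real n + (f \<omega>)\<^sup>2 * of_bool (\<bar>f \<omega>\<bar> > \<epsilon> * sqrt n)" for \<omega>
  proof (cases "\<bar>f \<omega>\<bar> > \<epsilon> * sqrt n")
    case False
    then have "\<bar>f \<omega>\<bar>\<^sup>2 \<le> (\<epsilon> * sqrt n)\<^sup>2" by (intro power_mono) auto
    then show ?thesis using False by (simp add: power_mult_distrib)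
  qed simp
  have "expectation (\<lambda>\<omega>. (f \<omega>)\<^sup>2) \<le> expectation (\<lambda>\<omega>. \<epsilon>\<^sup>2 * real n + (f \<omega>)\<^sup>2 * of_bool (\<bar>f \<omega>\<bar> > \<epsilon> * sqrt n))"
    using f integrable_tail[OF f] by (intro integral_mono pw) auto
  also have "\<dots> = \<epsilon>\<^sup>2 * real n + tail_moment M (\<epsilon> * sqrt n) f"
    using integrable_tail[OF f] by (simp add: tail_eq prob_space)
  finally show ?thesis .
qed

lemma integrable_mult_cutoff:
  fixes f g :: "'a \<Rightarrow> real"
  assumes "integrable M f" and [measurable]: "g \<in> borel_measurable M"
  shows "integrable M (\<lambda>\<omega>. f \<omega> * cutoff n (g \<omega>))"
proof (rule Bochner_Integration.integrable_bound[OF assms(1)])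
  have [measurable]: "f \<in> borel_measurable M" using assms(1) by simp
  show "(\<lambda>\<omega>. f \<omega> * cutoff n (g \<omega>)) \<in> borel_measurable M" by measurable
  show "AE \<omega> in M. norm (f \<omega> * cutoff n (g \<omega>)) \<le> norm (f \<omega>)"
    by (auto simp: abs_mult intro!: AE_I2 mult_left_le)
qed

lemma expectation_square_mult_cutoff_le:
  fixes f g :: "'a \<Rightarrow> real"
  assumes n: "n \<ge> 1" and \<epsilon>: "\<epsilon> > 0"
    and f: "f \<in> borel_measurable M" "integrable M (\<lambda>\<omega>. (f \<omega>)\<^sup>2)"
    and g: "g \<in> borel_measurable M" "integrable M (\<lambda>\<omega>. (g \<omega>)\<^sup>2)"
  shows "expectation (\<lambda>\<omega>. (f \<omega>)\<^sup>2 * cutoff n (g \<omega>))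
    \<le> \<epsilon> * expectation (\<lambda>\<omega>. (f \<omega>)\<^sup>2) + tail_moment M (\<epsilon> * sqrt n) f + tail_moment M (\<epsilon> * sqrt n) g"
proof -
  have "expectation (\<lambda>\<omega>. (f \<omega>)\<^sup>2 * cutoff n (g \<omega>))
      \<le> expectation (\<lambda>\<omega>. \<epsilon> * (f \<omega>)\<^sup>2 + (f \<omega>)\<^sup>2 * of_bool (\<bar>f \<omega>\<bar> > \<epsilon> * sqrt n) + (g \<omega>)\<^sup>2 * of_bool (\<bar>g \<omega>\<bar> > \<epsilon> * sqrt n))"
    using f g integrable_tail[OF f] integrable_tail[OF g]
    by (intro integral_mono square_mult_cutoff_le[OF n \<epsilon>] integrable_mult_cutoff) auto
  also have "\<dots> = \<epsilon> * expectation (\<lambda>\<omega>. (f \<omega>)\<^sup>2) + tail_moment M (\<epsilon> * sqrt n) f + tail_moment M (\<epsilon> * sqrt n) g"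
    using f integrable_tail[OF f] integrable_tail[OF g] by (simp add: tail_eq)
  finally show ?thesis .
qed

text \<open>The centred square is at most f^2 + v; the two parts fall under
  \<open>square_mult_cutoff_le\<close> and \<open>const_mult_cutoff_le\<close> with equal bounds,
  whence the factors 2.\<close>

lemma expectation_centered_square_mult_cutoff_le:
  fixes f g :: "'a \<Rightarrow> real"
  assumes n: "n \<ge> 1" and \<epsilon>: "\<epsilon> > 0"
    and f: "f \<in> borel_measurable M" "integrable M (\<lambda>\<omega>. (f \<omega>)\<^sup>2)" "expectation (\<lambda>\<omega>. (f \<omega>)\<^sup>2) = v"
    and g: "g \<in> borel_measurable M" "integrable M (\<lambda>\<omega>. (g \<omega>)\<^sup>2)"
  shows "expectation (\<lambda>\<omega>. \<bar>(f \<omega>)\<^sup>2 - v\<bar> * cutoff n (g \<omega>))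
    \<le> 2 * \<epsilon> * v + 2 * tail_moment M (\<epsilon> * sqrt n) f + 2 * tail_moment M (\<epsilon> * sqrt n) g"
proof -
  note [measurable] = f(1) g(1)
  have v: "0 \<le> v" using f(3) by (simp add: Bochner_Integration.integral_nonneg flip: f(3))
  have if2: "integrable M (\<lambda>\<omega>. (f \<omega>)\<^sup>2 * cutoff n (g \<omega>))"
    by (rule integrable_mult_cutoff[OF f(2) g(1)])
  have iv: "integrable M (\<lambda>\<omega>. v * cutoff n (g \<omega>))" by (rule integrable_mult_cutoff) auto
  have "expectation (\<lambda>\<omega>. \<bar>(f \<omega>)\<^sup>2 - v\<bar> * cutoff n (g \<omega>))
      \<le> expectation (\<lambda>\<omega>. (f \<omega>)\<^sup>2 * cutoff n (g \<omega>) + v * cutoff n (g \<omega>))"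
  proof (intro integral_mono)
    show "integrable M (\<lambda>\<omega>. \<bar>(f \<omega>)\<^sup>2 - v\<bar> * cutoff n (g \<omega>))"
      using f(2) by (intro integrable_mult_cutoff) auto
    show "integrable M (\<lambda>\<omega>. (f \<omega>)\<^sup>2 * cutoff n (g \<omega>) + v * cutoff n (g \<omega>))"
      using if2 iv by simp
    fix \<omega>
    have "\<bar>(f \<omega>)\<^sup>2 - v\<bar> \<le> (f \<omega>)\<^sup>2 + v" using v by (simp add: abs_le_iff)
    from mult_right_mono[OF this cutoff_nonneg[of n "g \<omega>"]]
    show "\<bar>(f \<omega>)\<^sup>2 - v\<bar> * cutoff n (g \<omega>) \<le> (f \<omega>)\<^sup>2 * cutoff n (g \<omega>) + v * cutoff n (g \<omega>)"
      by (simp add: distrib_right)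
  qed
  also have "\<dots> = expectation (\<lambda>\<omega>. (f \<omega>)\<^sup>2 * cutoff n (g \<omega>)) + expectation (\<lambda>\<omega>. v * cutoff n (g \<omega>))"
    using if2 iv by simp
  finally have 1: "expectation (\<lambda>\<omega>. \<bar>(f \<omega>)\<^sup>2 - v\<bar> * cutoff n (g \<omega>))
      \<le> expectation (\<lambda>\<omega>. (f \<omega>)\<^sup>2 * cutoff n (g \<omega>)) + expectation (\<lambda>\<omega>. v * cutoff n (g \<omega>))" .
  have "expectation (\<lambda>\<omega>. v * cutoff n (g \<omega>))
      \<le> expectation (\<lambda>\<omega>. \<epsilon> * v + tail_moment M (\<epsilon> * sqrt n) f + (g \<omega>)\<^sup>2 * of_bool (\<bar>g \<omega>\<bar> > \<epsilon> * sqrt n))"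
    using iv integrable_tail[OF g] second_moment_le_tail[OF f(1,2), of \<epsilon> n] v tail_nonneg f(3)
    by (intro integral_mono const_mult_cutoff_le[OF n \<epsilon>]) auto
  also have "\<dots> = \<epsilon> * v + tail_moment M (\<epsilon> * sqrt n) f + tail_moment M (\<epsilon> * sqrt n) g"
    using integrable_tail[OF g] by (simp add: tail_eq[of _ g] prob_space)
  finally show ?thesis
    using 1 expectation_square_mult_cutoff_le[OF n \<epsilon> f(1,2) g] f(3) by simp
qed

text \<open>The third absolute moment is what the cutoff calls for, since \<open>cutoff n t\<close>
  is at most |t| / sqrt n. For positive \<open>v\<close> it equals 2 sqrt (2 / pi) v^(3/2), and pi
  is at least 2.\<close>

lemma centered_gaussian_moments:
  assumes Y[measurable]: "Y \<in> borel_measurable M" and D: "distr M borel Y = centered_gaussian v" and v: "0 \<le> v"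
  shows "integrable M (\<lambda>\<omega>. (Y \<omega>)\<^sup>2)" "expectation Y = 0" "expectation (\<lambda>\<omega>. (Y \<omega>)\<^sup>2) = v"
    "integrable M (\<lambda>\<omega>. \<bar>Y \<omega>\<bar> ^ 3)" "expectation (\<lambda>\<omega>. \<bar>Y \<omega>\<bar> ^ 3) \<le> 2 * v * sqrt v"
proof -
  have int: "integrable M (\<lambda>\<omega>. h (Y \<omega>)) \<longleftrightarrow> integrable (centered_gaussian v) h"
    and ex: "expectation (\<lambda>\<omega>. h (Y \<omega>)) = integral\<^sup>L (centered_gaussian v) h"
    if [measurable]: "h \<in> borel_measurable borel" for h :: "real \<Rightarrow> real"
    unfolding D[symmetric] by (simp_all add: integrable_distr_eq integral_distr)
  have "integrable (centered_gaussian v) (\<lambda>x. x\<^sup>2) \<and> integral\<^sup>L (centered_gaussian v) (\<lambda>x. x) = 0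
     \<and> integral\<^sup>L (centered_gaussian v) (\<lambda>x. x\<^sup>2) = v
     \<and> integrable (centered_gaussian v) (\<lambda>x. \<bar>x\<bar> ^ 3) \<and> integral\<^sup>L (centered_gaussian v) (\<lambda>x. \<bar>x\<bar> ^ 3) \<le> 2 * v * sqrt v"
  proof (cases "v = 0")
    case True
    then show ?thesis by (simp add: centered_gaussian_def integral_return integrable_iff_bounded nn_integral_return)
  next
    case False
    then have s: "sqrt v > 0" using v by simp
    let ?d = "normal_density 0 (sqrt v)"
    have i: "integrable (centered_gaussian v) h \<longleftrightarrow> integrable lborel (\<lambda>x. ?d x * h x)"
      and e: "integral\<^sup>L (centered_gaussian v) h = integral\<^sup>L lborel (\<lambda>x. ?d x * h x)"
      if [measurable]: "h \<in> borel_measurable borel" for h :: "real \<Rightarrow> real"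
      using False normal_density_nonneg[of 0 "sqrt v"]
      by (simp_all add: centered_gaussian_def integrable_density integral_density)
    have "integral\<^sup>L lborel (\<lambda>x. ?d x * x) = 0"
      using integral_normal_moment_odd[OF s, of 0 0] by simp
    moreover have "integral\<^sup>L lborel (\<lambda>x. ?d x * x\<^sup>2) = v"
      using integral_normal_moment_even[OF s, of 0 1] v by (simp add: fact_numeral power2_eq_square)
    moreover have "integral\<^sup>L lborel (\<lambda>x. ?d x * \<bar>x\<bar> ^ 3) \<le> 2 * v * sqrt v"
    proof -
      have "integral\<^sup>L lborel (\<lambda>x. ?d x * \<bar>x\<bar> ^ 3) = 2 * sqrt v ^ 3 * sqrt (2 / pi)"
        using integral_normal_moment_abs_odd[OF s, of 0 1] by (simp add: numeral_3_eq_3)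
      also have "\<dots> = 2 * v * sqrt v * sqrt (2 / pi)" using v by (simp add: power3_eq_cube)
      also have "\<dots> \<le> 2 * v * sqrt v * 1"
        using v pi_ge_two by (intro mult_left_mono) auto
      finally show ?thesis by simp
    qed
    moreover have "integrable lborel (\<lambda>x. ?d x * x\<^sup>2)" using integrable_normal_moment[OF s, of 0 2] by simp
    moreover have "integrable lborel (\<lambda>x. ?d x * \<bar>x\<bar> ^ 3)" using integrable_normal_moment_abs[OF s, of 0 3] by simp
    ultimately show ?thesis by (simp add: i e)
  qed
  then show "integrable M (\<lambda>\<omega>. (Y \<omega>)\<^sup>2)" "expectation Y = 0" "expectation (\<lambda>\<omega>. (Y \<omega>)\<^sup>2) = v"
    "integrable M (\<lambda>\<omega>. \<bar>Y \<omega>\<bar> ^ 3)" "expectation (\<lambda>\<omega>. \<bar>Y \<omega>\<bar> ^ 3) \<le> 2 * v * sqrt v"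
    using ex[of "\<lambda>x. x"] ex[of "\<lambda>x. x\<^sup>2"] ex[of "\<lambda>x. \<bar>x\<bar> ^ 3"]
      int[of "\<lambda>x. x\<^sup>2"] int[of "\<lambda>x. \<bar>x\<bar> ^ 3"] by simp_all
qed

text \<open>The Lindeberg condition does not force \<open>max \<sigma>\<^sup>2 = o(n)\<close>, so a Gaussian entry with
  variance above \<open>4 \<epsilon>\<^sup>2 n\<close> is charged to the truncated second moment \<open>L\<close> of the matching \<open>X\<close> entry.\<close>
lemma centered_gaussian_mult_cutoff_le:
  assumes Y[measurable]: "Y \<in> borel_measurable M" and D: "distr M borel Y = centered_gaussian v"
    and n: "n \<ge> 1" and \<epsilon>: "\<epsilon> > 0" and v: "0 \<le> v" "v \<le> \<epsilon>\<^sup>2 * n + L" and L: "0 \<le> L"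
  shows "expectation (\<lambda>\<omega>. (Y \<omega>)\<^sup>2 * cutoff n (Y \<omega>)) \<le> 4 * \<epsilon> * v + 2 * L"
proof -
  note mom = centered_gaussian_moments[OF Y D v(1)]
  have i: "integrable M (\<lambda>\<omega>. (Y \<omega>)\<^sup>2 * cutoff n (Y \<omega>))" by (rule integrable_mult_cutoff[OF mom(1) Y])
  show ?thesis
  proof (cases "v \<le> 4 * \<epsilon>\<^sup>2 * n")
    case True
    \<comment> \<open>Below the threshold \<open>sqrt v / sqrt n\<close> is at most
      \<open>2 * \<epsilon>\<close>, which makes the third moment over sqrt n small relative to
      \<open>v\<close>.\<close>
    have "sqrt v \<le> sqrt (4 * \<epsilon>\<^sup>2 * n)" using True by (rule real_sqrt_le_mono)
    also have "\<dots> = 2 * \<epsilon> * sqrt n" using \<epsilon> by (simp add: real_sqrt_mult)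
    finally have s: "sqrt v / sqrt n \<le> 2 * \<epsilon>" using n by (simp add: divide_le_eq)
    have "expectation (\<lambda>\<omega>. (Y \<omega>)\<^sup>2 * cutoff n (Y \<omega>)) \<le> expectation (\<lambda>\<omega>. \<bar>Y \<omega>\<bar> ^ 3 / sqrt n)"
    proof (intro integral_mono i)
      show "integrable M (\<lambda>\<omega>. \<bar>Y \<omega>\<bar> ^ 3 / sqrt n)" using mom(4) by simp
      fix \<omega>
      have "(Y \<omega>)\<^sup>2 * cutoff n (Y \<omega>) \<le> (Y \<omega>)\<^sup>2 * (\<bar>Y \<omega>\<bar> / sqrt n)"
        by (intro mult_left_mono) (auto simp: cutoff_def)
      also have "\<dots> = \<bar>Y \<omega>\<bar> ^ 3 / sqrt n" by (simp add: power3_eq_cube power2_eq_square abs_mult_self_eq)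
      finally show "(Y \<omega>)\<^sup>2 * cutoff n (Y \<omega>) \<le> \<bar>Y \<omega>\<bar> ^ 3 / sqrt n" .
    qed
    also have "\<dots> = expectation (\<lambda>\<omega>. \<bar>Y \<omega>\<bar> ^ 3) / sqrt n" by simp
    also have "\<dots> \<le> 2 * v * sqrt v / sqrt n" using mom(5) by (intro divide_right_mono) auto
    also have "\<dots> = 2 * v * (sqrt v / sqrt n)" by simp
    also have "\<dots> \<le> 2 * v * (2 * \<epsilon>)" using s v(1) by (intro mult_left_mono) auto
    finally show ?thesis using L by (simp add: mult_ac)
  next
    case False
    have "expectation (\<lambda>\<omega>. (Y \<omega>)\<^sup>2 * cutoff n (Y \<omega>)) \<le> expectation (\<lambda>\<omega>. (Y \<omega>)\<^sup>2)"
      by (intro integral_mono i mom mult_left_le) auto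
    also have "\<dots> = v" by (rule mom(3))
    \<comment> \<open>Above the threshold \<epsilon>^2 n is less than v / 4, so the bound on
      \<open>v\<close> leaves 3 v / 4 below \<open>L\<close>.\<close>
    also have "\<dots> \<le> 2 * L" using False v by linarith
    also have "\<dots> \<le> 4 * \<epsilon> * v + 2 * L" using \<epsilon> v by simp
    finally show ?thesis .
  qed
qed

end

section \<open>Generated sigma-algebras\<close>

lemma space_gen_subalgebra: "space (gen_subalgebra M X I) = space M"
  by (simp add: gen_subalgebra_def space_measure_of_conv)

lemma sets_gen_subalgebra:
  "sets (gen_subalgebra M X I) = sigma_sets (space M) (\<Union>i\<in>I. {X i -` A \<inter> space M | A. A \<in> sets borel})"
  unfolding gen_subalgebra_def by (rule sets_measure_of) auto

lemma subalgebra_gen_subalgebra: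
  assumes "\<And>i. i \<in> I \<Longrightarrow> X i \<in> borel_measurable M"
  shows "subalgebra M (gen_subalgebra M X I)"
  unfolding subalgebra_def space_gen_subalgebra sets_gen_subalgebra
  using assms by (auto intro!: sets.sigma_sets_subset measurable_sets)

lemma measurable_gen_subalgebra:
  assumes "i \<in> I"
  shows "X i \<in> borel_measurable (gen_subalgebra M X I)"
  by (rule measurableI) (use assms in \<open>auto simp: space_gen_subalgebra sets_gen_subalgebra intro!: sigma_sets.Basic\<close>)

subsection \<open>Comparison with the Gaussian matrix\<close>

context prob_space
begin

text \<open>Both sequences concentrate around one centre \<open>c n\<close>, which may move with
  \<open>n\<close>. The triangle inequality, (a + b)^2 at most 2 a^2 + 2 b^2, and Markov's
  inequality then finish.\<close>

lemma tendsto_in_probability_of_second_moments: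
  fixes A B :: "nat \<Rightarrow> 'a \<Rightarrow> complex"
  assumes A: "\<And>n. A n \<in> borel_measurable M" "\<And>n \<omega>. cmod (A n \<omega>) \<le> K"
    and B: "\<And>n. B n \<in> borel_measurable M" "\<And>n \<omega>. cmod (B n \<omega>) \<le> K"
    and lim: "(\<lambda>n. expectation (\<lambda>\<omega>. (cmod (A n \<omega> - c n))\<^sup>2)) \<longlonglongrightarrow> 0"
      "(\<lambda>n. expectation (\<lambda>\<omega>. (cmod (B n \<omega> - c n))\<^sup>2)) \<longlonglongrightarrow> 0"
  shows "tendsto_in_probability M (\<lambda>n \<omega>. A n \<omega> - B n \<omega>) (\<lambda>_. 0)"
  unfolding tendsto_in_probability_def
proof (intro conjI allI impI)
  note [measurable] = A(1) B(1)
  show "(\<lambda>\<omega>. A n \<omega> - B n \<omega>) \<in> borel_measurable M" for n by measurable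
  show "(\<lambda>_. 0 :: complex) \<in> borel_measurable M" by simp
  fix \<delta> :: real assume \<delta>: "\<delta> > 0"
  let ?e = "\<lambda>n. expectation (\<lambda>\<omega>. (cmod (A n \<omega> - c n))\<^sup>2) + expectation (\<lambda>\<omega>. (cmod (B n \<omega> - c n))\<^sup>2)"
  have i: "integrable M (\<lambda>\<omega>. (cmod (D n \<omega> - c n))\<^sup>2)"
    if [measurable]: "\<And>n. D n \<in> borel_measurable M" and b: "\<And>n \<omega>. cmod (D n \<omega>) \<le> K" for D n
  proof (rule integrable_bounded[where B = "(K + cmod (c n))\<^sup>2"])
    fix \<omega>
    have "cmod (D n \<omega> - c n) \<le> K + cmod (c n)"
      using norm_triangle_ineq4[of "D n \<omega>" "c n"] b[of n \<omega>] by linarith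
    from power_mono[OF this norm_ge_zero, of 2]
    show "norm ((cmod (D n \<omega> - c n))\<^sup>2) \<le> (K + cmod (c n))\<^sup>2" by simp
  qed measurable
  note iA = i[of A, OF A] and iB = i[of B, OF B]
  have le: "measure M {\<omega> \<in> space M. cmod (A n \<omega> - B n \<omega> - 0) > \<delta>} \<le> 2 * ?e n / \<delta>\<^sup>2" for n
  proof -
    let ?u = "\<lambda>\<omega>. 2 * (cmod (A n \<omega> - c n))\<^sup>2 + 2 * (cmod (B n \<omega> - c n))\<^sup>2"
    have iu: "integrable M ?u" using iA iB by simp
    have "{\<omega> \<in> space M. cmod (A n \<omega> - B n \<omega> - 0) > \<delta>} \<subseteq> {\<omega> \<in> space M. \<delta>\<^sup>2 \<le> ?u \<omega>}"
    proof safe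
      fix \<omega> assume "\<omega> \<in> space M" "\<delta> < cmod (A n \<omega> - B n \<omega> - 0)"
      then have "\<delta> \<le> cmod (A n \<omega> - c n) + cmod (B n \<omega> - c n)"
        using norm_triangle_ineq4[of "A n \<omega> - c n" "B n \<omega> - c n"] by simp
      then have "\<delta>\<^sup>2 \<le> (cmod (A n \<omega> - c n) + cmod (B n \<omega> - c n))\<^sup>2"
        using \<delta> by (intro power_mono) auto
      also have "\<dots> \<le> ?u \<omega>"
        using zero_le_power2[of "cmod (A n \<omega> - c n) - cmod (B n \<omega> - c n)"]
        by (simp add: power2_sum power2_diff)
      finally show "\<delta>\<^sup>2 \<le> ?u \<omega>" .
    qed
    then have "measure M {\<omega> \<in> space M. cmod (A n \<omega> - B n \<omega> - 0) > \<delta>} \<le> measure M {\<omega> \<in> space M. \<delta>\<^sup>2 \<le> ?u \<omega>}"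
      by (rule finite_measure_mono) measurable
    also have "\<dots> \<le> expectation ?u / \<delta>\<^sup>2"
      by (rule integral_Markov_inequality_measure[OF iu sets.empty_sets]) (use \<delta> in auto)
    also have "expectation ?u = 2 * ?e n" using iA iB by simp
    finally show ?thesis .
  qed
  show "(\<lambda>n. measure M {\<omega> \<in> space M. cmod (A n \<omega> - B n \<omega> - 0) > \<delta>}) \<longlonglongrightarrow> 0"
  proof (rule real_tendsto_sandwich[OF _ _ tendsto_const])
    show "eventually (\<lambda>n. 0 \<le> measure M {\<omega> \<in> space M. cmod (A n \<omega> - B n \<omega> - 0) > \<delta>}) sequentially"
      by (intro always_eventually allI measure_nonneg)
    show "eventually (\<lambda>n. measure M {\<omega> \<in> space M. cmod (A n \<omega> - B n \<omega> - 0) > \<delta>} \<le> 2 * ?e n / \<delta>\<^sup>2) sequentially"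
      by (intro always_eventually allI le)
    have "(\<lambda>n. 2 * ?e n / \<delta>\<^sup>2) \<longlonglongrightarrow> 2 * (0 + 0) / \<delta>\<^sup>2"
      by (rule tendsto_divide[OF tendsto_mult[OF tendsto_const tendsto_add[OF lim]] tendsto_const]) (use \<delta> in simp)
    then show "(\<lambda>n. 2 * ?e n / \<delta>\<^sup>2) \<longlonglongrightarrow> 0" by (simp only: add_0 mult_zero_right div_0)
  qed
qed

text \<open>The squared Lipschitz constant has order n^-3; against variances whose sum is O(n^2)
  this leaves 1/n.\<close>

lemma stj_variance_bound:
  fixes Y :: "int \<times> int \<Rightarrow> 'a \<Rightarrow> real"
  assumes z: "Im z > 0" and W: "W = 1 + 1 / Im z" and n: "n \<ge> 1"
    and Y: "indep_vars (\<lambda>_. borel) Y (lower_triangle n)" "\<And>p. p \<in> lower_triangle n \<Longrightarrow> integrable M (\<lambda>\<omega>. (Y p \<omega>)\<^sup>2)"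
      "\<And>p. p \<in> lower_triangle n \<Longrightarrow> expectation (\<lambda>\<omega>. (Y p \<omega>)\<^sup>2) = v p"
  defines "s \<equiv> \<lambda>\<omega>. stj n z (\<lambda>q. if q \<in> lower_triangle n then Y q \<omega> else 0)"
  shows "expectation (\<lambda>\<omega>. (cmod (s \<omega> - expectation s))\<^sup>2) \<le> 4 * W^4 / n * ((\<Sum>p\<in>lower_triangle n. v p) / (real n)\<^sup>2)"
proof -
  define l where "l = 2 * W^2 / (sqrt n * n)"
  have "expectation (\<lambda>\<omega>. (cmod (s \<omega> - expectation s))\<^sup>2)
      \<le> (\<Sum>p\<in>lower_triangle n. l\<^sup>2 * expectation (\<lambda>\<omega>. (Y p \<omega>)\<^sup>2))"
    unfolding s_def
  proof (rule lipschitz_variance_bound[OF finite_triangle Y(1,2) measurable_stj[OF z] stj_bound[OF z W]])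
    fix x p t assume p: "p \<in> lower_triangle n"
    show "cmod (stj n z (x(p := t)) - stj n z (x(p := 0))) \<le> l * \<bar>t\<bar>"
      using stj_lipschitz[OF z W p, of "x(p := 0)" t] by (simp add: l_def mult_ac)
  qed
  also have "\<dots> = l\<^sup>2 * (\<Sum>p\<in>lower_triangle n. v p)" by (simp add: Y(3) sum_distrib_left)
  also have "l\<^sup>2 = 4 * W^4 / n / (real n)\<^sup>2"
    unfolding l_def power_divide power_mult_distrib power_mult[symmetric] by simp
  finally show ?thesis by simp
qed

text \<open>Every error of the exchange is expressed through three averages over the triangle:
  conditional variances, variances, and tail moments. The middle one is only bounded, so it must
  come with the free factor \<epsilon>.\<close>

lemma sq_dev_comparison:
  fixes X Y :: "int \<times> int \<Rightarrow> 'a \<Rightarrow> real"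
  assumes z: "Im z > 0" and W: "W = 1 + 1 / Im z" and n: "n \<ge> 1" and c: "cmod c \<le> W" and \<epsilon>: "\<epsilon> > 0"
    and X: "\<And>p. X p \<in> borel_measurable M" "\<And>p. integrable M (\<lambda>\<omega>. (X p \<omega>)\<^sup>2)"
      "\<And>p. expectation (\<lambda>\<omega>. (X p \<omega>)\<^sup>2) = v p"
    and Y: "indep_vars (\<lambda>_. borel) Y (lower_triangle n)"
      "\<And>p. p \<in> lower_triangle n \<Longrightarrow> distr M borel (Y p) = centered_gaussian (v p)"
    and F1: "\<And>p. p \<in> lower_triangle n \<Longrightarrow> subalgebra M (F1 p)"
      "\<And>p q. p \<in> lower_triangle n \<Longrightarrow> q \<in> lower_triangle n \<Longrightarrow> lex_le q p \<Longrightarrow> q \<noteq> p \<Longrightarrow> X q \<in> borel_measurable (F1 p)"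
      "\<And>p. p \<in> lower_triangle n \<Longrightarrow> AE \<omega> in M. real_cond_exp M (F1 p) (X p) \<omega> = 0"
    and Fa: "\<And>p. p \<in> lower_triangle n \<Longrightarrow> subalgebra M (Fa p)"
      "\<And>p q. p \<in> lower_triangle n \<Longrightarrow> q \<in> lower_triangle n \<Longrightarrow> lex_le q p \<Longrightarrow> q \<notin> near a p \<Longrightarrow> X q \<in> borel_measurable (Fa p)"
  shows "\<bar>expectation (\<lambda>\<omega>. sq_dev n z c (\<lambda>q. if q \<in> lower_triangle n then X q \<omega> else 0))
      - expectation (\<lambda>\<omega>. sq_dev n z c (\<lambda>q. if q \<in> lower_triangle n then Y q \<omega> else 0))\<bar>
    \<le> 144 * W^6 * ((\<Sum>p\<in>lower_triangle n. Lp_norm M 1 (real_cond_exp M (Fa p) (\<lambda>\<omega>. (X p \<omega>)\<^sup>2 - v p))) / (real n)\<^sup>2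
        + (2 * (2 * real a)\<^sup>2 + 5) * \<epsilon> * ((\<Sum>p\<in>lower_triangle n. v p) / (real n)\<^sup>2)
        + (4 * (2 * real a)\<^sup>2 + 4) * ((\<Sum>p\<in>lower_triangle n. tail_moment M (\<epsilon> * sqrt n) (X p)) / (real n)\<^sup>2))"
proof -
  let ?I = "lower_triangle n"
  \<comment> \<open>The largest of the three constants \<open>20 * W^4\<close>,
    \<open>80 * W^6\<close> and \<open>144 * W^6\<close> in the estimates of coefficient, remainder
    and Lipschitz constant.\<close>
  define \<kappa> where "\<kappa> = 144 * W^6 / (real n)\<^sup>2"
  define L where "L = (\<lambda>p. tail_moment M (\<epsilon> * sqrt n) (X p))"
  define A where "A = (\<lambda>p. Lp_norm M 1 (real_cond_exp M (Fa p) (\<lambda>\<omega>. (X p \<omega>)\<^sup>2 - v p)))"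
  have W1: "1 \<le> W" by (rule W_ge_1[OF z W])
  have Ym: "Y p \<in> borel_measurable M" if "p \<in> ?I" for p using Y(1) that by (auto simp: indep_vars_def2)
  have v: "0 \<le> v p" for p
    unfolding X(3)[symmetric] by (rule Bochner_Integration.integral_nonneg) simp
  have L0: "0 \<le> L p" for p unfolding L_def by (rule tail_nonneg)
  have pW: "W ^ i \<le> W ^ j" if "i \<le> j" for i j by (rule power_W_mono[OF z W that])
  define b where "b = max ((2 * W)\<^sup>2) (8 * W^3)"
  have G: "\<bar>sq_dev n z c x\<bar> \<le> b" for x
  proof -
    have "cmod (stj n z x - c) \<le> 2 * W"
      using norm_triangle_ineq4[of "stj n z x" c] c stj_bound[OF z W, of n x] by linarith
    then have "(cmod (stj n z x - c))\<^sup>2 \<le> (2 * W)\<^sup>2" by (rule power_mono) simp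
    then show ?thesis by (simp add: sq_dev_def b_def)
  qed
  have G1: "\<bar>sq_dev_coeff1 n z c p x\<bar> \<le> b" if p: "p \<in> ?I" for p x
    using sq_dev_coeff1_bound[OF z W p c, of x] by (simp add: b_def)
  have "20 * W^4 \<le> 144 * W^6" "80 * W^6 \<le> 144 * W^6"
    using pW[of 4 6] zero_le_power[of W 4] W1 by linarith+
  then have le: "20 * W^4 / (real n)\<^sup>2 \<le> \<kappa>" "80 * W^6 / (real n)\<^sup>2 \<le> \<kappa>"
    unfolding \<kappa>_def by (intro divide_right_mono; simp)+
  have G2: "\<bar>sq_dev_coeff2 n z c p x\<bar> \<le> \<kappa>" if p: "p \<in> ?I" for p x
    using sq_dev_coeff2_bound[OF z W p c, of x] le by linarith
  have expand: "\<bar>sq_dev n z c (x(p := t)) - sq_dev n z c (x(p := 0)) - t * sq_dev_coeff1 n z c p (x(p := 0))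
        - t\<^sup>2 * sq_dev_coeff2 n z c p (x(p := 0))\<bar> \<le> \<kappa> * (t\<^sup>2 * cutoff n t)" if p: "p \<in> ?I" for p x t
  proof -
    have "\<bar>sq_dev n z c (x(p := t)) - sq_dev n z c (x(p := 0)) - t * sq_dev_coeff1 n z c p (x(p := 0))
        - t\<^sup>2 * sq_dev_coeff2 n z c p (x(p := 0))\<bar> \<le> 80 * W^6 / (real n)\<^sup>2 * (t\<^sup>2 * cutoff n t)"
      using sq_dev_expansion[OF z W p c, of "x(p := 0)" t] unfolding fun_upd_upd fun_upd_same diff_0_right .
    also have "\<dots> \<le> \<kappa> * (t\<^sup>2 * cutoff n t)" using le by (intro mult_right_mono) auto
    finally show ?thesis .
  qed
  have lip: "\<bar>sq_dev_coeff2 n z c p (x(m := t)) - sq_dev_coeff2 n z c p (x(m := 0))\<bar> \<le> \<kappa> * cutoff n t"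
    if "p \<in> ?I" "m \<in> ?I" for p x m t
    using sq_dev_coeff2_diff_bound[OF z W that c, of "x(m := 0)" t]
    unfolding fun_upd_upd fun_upd_same diff_0_right \<kappa>_def .
  have Y2: "integrable M (\<lambda>\<omega>. (Y p \<omega>)\<^sup>2)" and Y1: "expectation (Y p) = 0"
    and Yv: "expectation (\<lambda>\<omega>. (Y p \<omega>)\<^sup>2) = v p" if "p \<in> ?I" for p
    using centered_gaussian_moments[OF Ym[OF that] Y(2)[OF that] v] by auto
  have F1': "X q \<in> borel_measurable (F1 p)"
    if "p \<in> ?I" "q \<in> ?I" "lex_code n q < lex_code n p" for p q
    using that by (intro F1(2) lex_code_less)
  have Fa': "X q \<in> borel_measurable (Fa p)"
    if "p \<in> ?I" "q \<in> ?I" "lex_code n q < lex_code n p" "q \<notin> near a p" for p q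
    using that by (intro Fa(2) lex_code_less)
  have "\<bar>expectation (\<lambda>\<omega>. sq_dev n z c (\<lambda>q. if q \<in> ?I then X q \<omega> else 0))
      - expectation (\<lambda>\<omega>. sq_dev n z c (\<lambda>q. if q \<in> ?I then Y q \<omega> else 0))\<bar>
    \<le> \<kappa> * (\<Sum>p\<in>?I. A p
       + (\<Sum>m\<in>?I \<inter> near a p. expectation (\<lambda>\<omega>. \<bar>(X p \<omega>)\<^sup>2 - v p\<bar> * cutoff n (X m \<omega>)))
       + expectation (\<lambda>\<omega>. (X p \<omega>)\<^sup>2 * cutoff n (X p \<omega>)) + expectation (\<lambda>\<omega>. (Y p \<omega>)\<^sup>2 * cutoff n (Y p \<omega>)))"
    unfolding A_def
    by (rule lindeberg_swap[OF finite_triangle inj_on_lex_code X(1,2) Y(1) Y2 Y1 Yv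
          measurable_sq_dev[OF z] G measurable_sq_dev_coeffs(1)[OF z] G1
          measurable_sq_dev_coeffs(2)[OF z] G2 expand lip measurable_cutoff cutoff_nonneg cutoff_le_1
          F1(1) F1' F1(3) Fa(1) Fa'])
  also have "\<dots> \<le> \<kappa> * (\<Sum>p\<in>?I. A p
       + (\<Sum>m\<in>?I \<inter> near a p. 2 * \<epsilon> * v p + 2 * L p + 2 * L m)
       + (\<epsilon> * v p + L p + L p) + (4 * \<epsilon> * v p + 2 * L p))"
  proof (intro mult_left_mono sum_mono add_mono order_refl)
    fix p assume p: "p \<in> ?I"
    show "expectation (\<lambda>\<omega>. \<bar>(X p \<omega>)\<^sup>2 - v p\<bar> * cutoff n (X m \<omega>)) \<le> 2 * \<epsilon> * v p + 2 * L p + 2 * L m" for m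
      unfolding L_def by (rule expectation_centered_square_mult_cutoff_le[OF n \<epsilon> X X(1,2)])
    show "expectation (\<lambda>\<omega>. (X p \<omega>)\<^sup>2 * cutoff n (X p \<omega>)) \<le> \<epsilon> * v p + L p + L p"
      unfolding L_def X(3)[symmetric] by (rule expectation_square_mult_cutoff_le[OF n \<epsilon> X(1,2) X(1,2)])
    show "expectation (\<lambda>\<omega>. (Y p \<omega>)\<^sup>2 * cutoff n (Y p \<omega>)) \<le> 4 * \<epsilon> * v p + 2 * L p"
      using second_moment_le_tail[OF X(1,2)[of p], of \<epsilon> n] L0[of p] v[of p] unfolding X(3) L_def
      by (intro centered_gaussian_mult_cutoff_le[OF Ym[OF p] Y(2)[OF p] n \<epsilon>])
  qed (use W1 in \<open>simp add: \<kappa>_def\<close>)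
  \<comment> \<open>Variances: 2 per neighbour, then 1 from the \<open>X\<close> remainder and 4
    from the Gaussian one. Tails: 2 + 2 per neighbour, one for each of the two entries, then 2 + 2
    from the remainders.\<close>
  also have "\<dots> \<le> \<kappa> * ((\<Sum>p\<in>?I. A p) + (2 * (2 * real a)\<^sup>2 + 5) * \<epsilon> * (\<Sum>p\<in>?I. v p)
      + (4 * (2 * real a)\<^sup>2 + 4) * (\<Sum>p\<in>?I. L p))"
  proof (rule mult_left_mono)
    let ?N = "(2 * real a)\<^sup>2"
    have 1: "(\<Sum>p\<in>?I. \<Sum>m\<in>?I \<inter> near a p. v p) \<le> ?N * (\<Sum>p\<in>?I. v p)"
      by (rule sum_near_le(1)) (use v in auto)
    have 2: "(\<Sum>p\<in>?I. \<Sum>m\<in>?I \<inter> near a p. L p) \<le> ?N * (\<Sum>p\<in>?I. L p)"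
      by (rule sum_near_le(1)) (use L0 in auto)
    have 3: "(\<Sum>p\<in>?I. \<Sum>m\<in>?I \<inter> near a p. L m) \<le> ?N * (\<Sum>p\<in>?I. L p)"
      by (rule sum_near_le(2)) (use L0 in auto)
    have 4: "2 * \<epsilon> * (\<Sum>p\<in>?I. \<Sum>m\<in>?I \<inter> near a p. v p) \<le> 2 * \<epsilon> * (?N * (\<Sum>p\<in>?I. v p))"
      using 1 \<epsilon> by (intro mult_left_mono) auto
    have "(\<Sum>p\<in>?I. A p + (\<Sum>m\<in>?I \<inter> near a p. 2 * \<epsilon> * v p + 2 * L p + 2 * L m)
        + (\<epsilon> * v p + L p + L p) + (4 * \<epsilon> * v p + 2 * L p))
      = (\<Sum>p\<in>?I. A p) + 2 * \<epsilon> * (\<Sum>p\<in>?I. \<Sum>m\<in>?I \<inter> near a p. v p)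
        + 2 * (\<Sum>p\<in>?I. \<Sum>m\<in>?I \<inter> near a p. L p) + 2 * (\<Sum>p\<in>?I. \<Sum>m\<in>?I \<inter> near a p. L m)
        + 5 * \<epsilon> * (\<Sum>p\<in>?I. v p) + 4 * (\<Sum>p\<in>?I. L p)"
      by (simp only: sum.distrib sum_distrib_left[symmetric])
    also have "\<dots> \<le> (\<Sum>p\<in>?I. A p) + 2 * \<epsilon> * (?N * (\<Sum>p\<in>?I. v p)) + 2 * (?N * (\<Sum>p\<in>?I. L p))
        + 2 * (?N * (\<Sum>p\<in>?I. L p)) + 5 * \<epsilon> * (\<Sum>p\<in>?I. v p) + 4 * (\<Sum>p\<in>?I. L p)"
      using 2 3 4 by linarith
    also have "\<dots> = (\<Sum>p\<in>?I. A p) + (2 * ?N + 5) * \<epsilon> * (\<Sum>p\<in>?I. v p) + (4 * ?N + 4) * (\<Sum>p\<in>?I. L p)"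
      by (simp add: algebra_simps)
    finally show "(\<Sum>p\<in>?I. A p + (\<Sum>m\<in>?I \<inter> near a p. 2 * \<epsilon> * v p + 2 * L p + 2 * L m)
        + (\<epsilon> * v p + L p + L p) + (4 * \<epsilon> * v p + 2 * L p))
      \<le> (\<Sum>p\<in>?I. A p) + (2 * ?N + 5) * \<epsilon> * (\<Sum>p\<in>?I. v p) + (4 * ?N + 4) * (\<Sum>p\<in>?I. L p)" .
  qed (use W1 in \<open>simp add: \<kappa>_def\<close>)
  also have "\<dots> = 144 * W^6 * ((\<Sum>p\<in>?I. A p) / (real n)\<^sup>2
      + (2 * (2 * real a)\<^sup>2 + 5) * \<epsilon> * ((\<Sum>p\<in>?I. v p) / (real n)\<^sup>2)
      + (4 * (2 * real a)\<^sup>2 + 4) * ((\<Sum>p\<in>?I. L p) / (real n)\<^sup>2))"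
    by (simp only: \<kappa>_def times_divide_eq_right times_divide_eq_left add_divide_distrib[symmetric])
  finally show ?thesis unfolding A_def L_def .
qed

end

lemma real_tendsto_zeroI:
  fixes u :: "nat \<Rightarrow> real"
  assumes "\<And>n. 0 \<le> u n" "\<And>\<eta>. \<eta> > 0 \<Longrightarrow> eventually (\<lambda>n. u n \<le> C * \<eta>) sequentially" "C > 0"
  shows "u \<longlonglongrightarrow> 0"
proof (rule tendstoI)
  fix e :: real assume e: "e > 0"
  have "eventually (\<lambda>n. u n \<le> C * (e / (2 * C))) sequentially" by (rule assms(2)) (use e assms(3) in simp)
  then show "eventually (\<lambda>n. dist (u n) 0 < e) sequentially"
  proof eventually_elim
    case (elim n)
    have "C * (e / (2 * C)) = e / 2" using assms(3) by simp
    then show ?case using elim e assms(1)[of n] by (simp add: dist_real_def)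
  qed
qed

theorem theorem1:
  fixes M :: "'a measure"
    and X :: "int \<Rightarrow> int \<Rightarrow> 'a \<Rightarrow> real"
    and Y :: "nat \<Rightarrow> nat \<Rightarrow> 'a \<Rightarrow> real"
    and \<sigma> :: "int \<Rightarrow> int \<Rightarrow> real"
  assumes "prob_space M"
    and "\<And>i j. X i j \<in> borel_measurable M"
    and "\<And>i j. integrable M (\<lambda>\<omega>. (X i j \<omega>)\<^sup>2)"
    and "\<And>i j. (\<integral>\<omega>. X i j \<omega> \<partial>M) = 0"
    and "\<And>i j. (\<integral>\<omega>. (X i j \<omega>)\<^sup>2 \<partial>M) = (\<sigma> i j)\<^sup>2"
    and "prob_space.indep_vars M (\<lambda>_. borel) (\<lambda>(i, j). Y i j) ({1..} \<times> {1..})"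
    and "\<And>i j. i \<ge> 1 \<Longrightarrow> j \<ge> 1 \<Longrightarrow>
           distr M borel (Y i j) = centered_gaussian ((\<sigma> (int i) (int j))\<^sup>2)"
    and "prob_space.indep_set M
           (sets (gen_subalgebra M (\<lambda>(i, j). X i j) UNIV))
           (sets (gen_subalgebra M (\<lambda>(i, j). Y i j) ({1..} \<times> {1..})))"
    and "\<And>i j. 1 \<le> j \<Longrightarrow> j \<le> i \<Longrightarrow>
           AE \<omega> in M. real_cond_exp M (past_algebra M X 1 i j) (X i j) \<omega> = 0"
    and "(SUP n\<in>{1..}. ereal ((\<Sum>i=1..int n. \<Sum>j=1..i. (\<sigma> i j)\<^sup>2) / (real n)\<^sup>2)) < \<infinity>"
    and "(\<lambda>a. limsup (\<lambda>n. ereal ((\<Sum>i=1..int n. \<Sum>j=1..i.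
             Lp_norm M 1 (real_cond_exp M (past_algebra M X a i j)
               (\<lambda>\<omega>. (X i j \<omega>)\<^sup>2 - (\<sigma> i j)\<^sup>2))) / (real n)\<^sup>2))) \<longlonglongrightarrow> 0"
    and "\<And>\<epsilon>. \<epsilon> > 0 \<Longrightarrow>
           (\<lambda>n. (\<Sum>i=1..int n. \<Sum>j=1..i.
             \<integral>\<omega>. (X i j \<omega>)\<^sup>2 * indicator {\<omega>. \<bar>X i j \<omega>\<bar> > \<epsilon> * sqrt (real n)} \<omega> \<partial>M)
             / (real n)\<^sup>2) \<longlonglongrightarrow> 0"
  shows "\<forall>z. Im z > 0 \<longrightarrow>
           tendsto_in_probability M
             (\<lambda>n \<omega>. stieltjes (normalized_sym_matrix n (\<lambda>i j. X (int i) (int j) \<omega>)) z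
                  - stieltjes (normalized_sym_matrix n (\<lambda>i j. Y i j \<omega>)) z)
             (\<lambda>_. 0)"
proof (intro allI impI)
  fix z :: complex assume z: "Im z > 0"
  interpret prob_space M by fact
  define W where "W = 1 + 1 / Im z"
  note W = W_def
  have W1: "1 \<le> W" by (rule W_ge_1[OF z W])
  define XX where "XX = (\<lambda>p :: int \<times> int. X (fst p) (snd p))"
  \<comment> \<open>Although \<open>nat\<close> sends nonpositive coordinates to 0, only positions
    in \<open>lower_triangle n\<close> are ever read, and there it is faithful.\<close>
  define YY where "YY = (\<lambda>p :: int \<times> int. Y (nat (fst p)) (nat (snd p)))"
  define v where "v = (\<lambda>p :: int \<times> int. (\<sigma> (fst p) (snd p))\<^sup>2)"
  define F where "F = (\<lambda>a (p :: int \<times> int). past_algebra M X a (fst p) (snd p))"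
  define sX where "sX = (\<lambda>n \<omega>. stj n z (\<lambda>q. if q \<in> lower_triangle n then XX q \<omega> else 0))"
  define sY where "sY = (\<lambda>n \<omega>. stj n z (\<lambda>q. if q \<in> lower_triangle n then YY q \<omega> else 0))"
  have XX: "XX p \<in> borel_measurable M" "integrable M (\<lambda>\<omega>. (XX p \<omega>)\<^sup>2)"
    "expectation (\<lambda>\<omega>. (XX p \<omega>)\<^sup>2) = v p" for p
    using assms(2,3,5) by (simp_all add: XX_def v_def)
  have YY_ind: "indep_vars (\<lambda>_. borel) YY (lower_triangle n)" for n
  proof -
    define f where "f = (\<lambda>p :: int \<times> int. (nat (fst p), nat (snd p)))"
    have inj: "inj_on f (lower_triangle n)" by (auto simp: inj_on_def f_def lower_triangle_def)
    have sub: "f ` lower_triangle n \<subseteq> {1..} \<times> {1..}" by (auto simp: f_def lower_triangle_def)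
    from indep_vars_reindex[OF indep_vars_subset[OF assms(6) sub] inj] show ?thesis by (simp add: YY_def f_def)
  qed
  have YY_distr: "distr M borel (YY p) = centered_gaussian (v p)" if "p \<in> lower_triangle n" for p n
    using assms(7)[of "nat (fst p)" "nat (snd p)"] that by (auto simp: YY_def v_def lower_triangle_def)
  have YY_meas: "YY p \<in> borel_measurable M" if "p \<in> lower_triangle n" for p n
    using YY_ind[of n] that by (auto simp: indep_vars_def2)
  have sub: "subalgebra M (F a p)" for a p
    unfolding F_def past_algebra_def by (rule subalgebra_gen_subalgebra) (use assms(2) in auto)
  have F_meas: "XX q \<in> borel_measurable (F a p)"
    if "q \<in> lower_triangle n" "q \<in> past_set a (fst p) (snd p)" for a p q n
    using measurable_gen_subalgebra[of q "{(u, v). (u, v) \<in> past_set a (fst p) (snd p) \<and> v \<le> u}" "\<lambda>(u, v). X u v" M] that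
    by (auto simp: F_def past_algebra_def XX_def case_prod_beta lower_triangle_def)
  \<comment> \<open>Distinct integer points are at distance at least 1, so the strict lexicographic
    past of \<open>p\<close> lies in the past set for distance 1.\<close>
  have F1_meas: "XX q \<in> borel_measurable (F 1 p)"
    if "p \<in> lower_triangle n" "q \<in> lower_triangle n" "lex_le q p" "q \<noteq> p" for p q n
    by (rule F_meas[OF that(2)])
       (use that in \<open>cases p; cases q; auto simp: past_set_def lex_le_def\<close>)
  have Fa_meas: "XX q \<in> borel_measurable (F a p)"
    if "p \<in> lower_triangle n" "q \<in> lower_triangle n" "lex_le q p" "q \<notin> near a p" for p q n a
    by (rule F_meas[OF that(2)]) (use that in \<open>auto simp: past_set_def near_def\<close>)
  have F1_zero: "AE \<omega> in M. real_cond_exp M (F 1 p) (XX p) \<omega> = 0" if "p \<in> lower_triangle n" for p n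
    using assms(9)[of "snd p" "fst p"] that by (auto simp: F_def XX_def lower_triangle_def)
  have coords: "(\<lambda>\<omega> q. if q \<in> lower_triangle n then D q \<omega> else 0) \<in> measurable M (PiM UNIV (\<lambda>_. borel))"
    if "\<And>p. p \<in> lower_triangle n \<Longrightarrow> D p \<in> borel_measurable M" for D :: "int \<times> int \<Rightarrow> 'a \<Rightarrow> real" and n
  proof (rule measurable_to_coordinates)
    show "(\<lambda>\<omega>. if i \<in> lower_triangle n then D i \<omega> else 0) \<in> borel_measurable M" for i
      by (cases "i \<in> lower_triangle n") (auto intro: that)
  qed
  have sX_meas: "sX n \<in> borel_measurable M" and sY_meas: "sY n \<in> borel_measurable M" for n
    using measurable_compose[OF coords[of n XX] measurable_stj[OF z, of n], OF XX(1)]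
      measurable_compose[OF coords[of n YY] measurable_stj[OF z, of n], OF YY_meas]
    by (simp_all add: sX_def sY_def)
  define c where "c = (\<lambda>n. expectation (sY n))"
  have c: "cmod (c n) \<le> W" for n
    unfolding c_def by (rule norm_expectation_le[OF sY_meas]) (simp add: sY_def stj_bound[OF z W])
  obtain C where C: "C > 0" "\<And>n. n \<ge> 1 \<Longrightarrow> (\<Sum>p\<in>lower_triangle n. v p) / (real n)\<^sup>2 \<le> C"
  proof -
    define S where "S = (\<lambda>n. ereal ((\<Sum>i=1..int n. \<Sum>j=1..i. (\<sigma> i j)\<^sup>2) / (real n)\<^sup>2))"
    have "(SUP n\<in>{1..}. S n) \<noteq> \<infinity>" using assms(10) unfolding S_def by (rule less_imp_neq)
    then obtain k :: nat where k: "(SUP n\<in>{1..}. S n) < ereal k"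
      unfolding less_PInf_Ex_of_nat by blast
    \<comment> \<open>The added 1 makes the constant visibly positive; it becomes a denominator in
      the choice of \<epsilon>.\<close>
    have "(\<Sum>p\<in>lower_triangle n. v p) / (real n)\<^sup>2 \<le> real k + 1" if "n \<ge> 1" for n
    proof -
      have "S n \<le> (SUP n\<in>{1..}. S n)" by (rule SUP_upper) (use that in simp)
      then have "S n < ereal k" using k by (rule le_less_trans)
      then show ?thesis by (simp add: S_def sum_triangle v_def)
    qed
    then show ?thesis using that[of "real k + 1"] by simp
  qed
  have limY: "(\<lambda>n. expectation (\<lambda>\<omega>. (cmod (sY n \<omega> - c n))\<^sup>2)) \<longlonglongrightarrow> 0"
  proof (rule real_tendsto_sandwich[OF _ _ tendsto_const])
    show "eventually (\<lambda>n. expectation (\<lambda>\<omega>. (cmod (sY n \<omega> - c n))\<^sup>2) \<le> 4 * W^4 * C / n) sequentially"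
    proof (rule eventually_sequentiallyI[of 1])
      fix n :: nat assume n: "1 \<le> n"
      have v0: "0 \<le> v p" for p by (simp add: v_def)
      note mom = centered_gaussian_moments[OF YY_meas YY_distr v0]
      have "expectation (\<lambda>\<omega>. (cmod (sY n \<omega> - c n))\<^sup>2) \<le> 4 * W^4 / n * ((\<Sum>p\<in>lower_triangle n. v p) / (real n)\<^sup>2)"
        unfolding sY_def c_def by (rule stj_variance_bound[OF z W n YY_ind mom(1,3)])
      also have "\<dots> \<le> 4 * W^4 / n * C" using C(2)[OF n] W1 by (intro mult_left_mono) auto
      finally show "expectation (\<lambda>\<omega>. (cmod (sY n \<omega> - c n))\<^sup>2) \<le> 4 * W^4 * C / n" by simp
    qed
    show "(\<lambda>n. 4 * W^4 * C / real n) \<longlonglongrightarrow> 0" by (rule lim_const_over_n)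
  qed simp
  have limX: "(\<lambda>n. expectation (\<lambda>\<omega>. (cmod (sX n \<omega> - c n))\<^sup>2)) \<longlonglongrightarrow> 0"
  proof (rule real_tendsto_zeroI[where C = "144 * W^6 * 3 + 1"])
    \<comment> \<open>Three contributions of size \<eta> inside the comparison bound, and one more
      for the Gaussian deviation.\<close>
    show "0 < 144 * W^6 * 3 + 1" using W1 by (simp add: add_pos_pos)
    fix \<eta> :: real assume \<eta>: "\<eta> > 0"
    define A where "A = (\<lambda>a n. (\<Sum>p\<in>lower_triangle n. Lp_norm M 1 (real_cond_exp M (F a p) (\<lambda>\<omega>. (XX p \<omega>)\<^sup>2 - v p))) / (real n)\<^sup>2)"
    have "(\<lambda>a. limsup (\<lambda>n. ereal (A a n))) \<longlonglongrightarrow> 0"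
      using assms(11) unfolding A_def sum_triangle by (simp add: XX_def F_def v_def)
    then have "eventually (\<lambda>a. limsup (\<lambda>n. ereal (A a n)) < ereal \<eta>) sequentially"
      using \<eta> by (intro order_tendstoD) auto
    \<comment> \<open>The distance comes first: the multiplicity \<open>N\<close> of neighbours
      depends on \<open>a\<close> but not on \<open>n\<close>, and \<epsilon> may then depend on
      \<open>N\<close>.\<close>
    then obtain a where "limsup (\<lambda>n. ereal (A a n)) < ereal \<eta>" by (auto simp: eventually_sequentially)
    from Limsup_lessD[OF this] have evA: "eventually (\<lambda>n. A a n < \<eta>) sequentially" by simp
    define N where "N = (2 * real a)\<^sup>2"
    have N: "0 \<le> N" by (simp add: N_def)
    \<comment> \<open>Tuned so that the variance term of the comparison, with the variances bounded
      by \<open>C\<close>, is at most \<eta>.\<close>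
    define \<epsilon> where "\<epsilon> = \<eta> / ((2 * N + 5) * C)"
    have \<epsilon>: "\<epsilon> > 0" using \<eta> C(1) N by (simp add: \<epsilon>_def)
    define T where "T = (\<lambda>n. (\<Sum>p\<in>lower_triangle n. tail_moment M (\<epsilon> * sqrt n) (XX p)) / (real n)\<^sup>2)"
    have "T \<longlonglongrightarrow> 0"
      using assms(12)[OF \<epsilon>] unfolding T_def by (simp add: sum_divide_distrib sum_triangle tail_moment_def XX_def)
    then have evT: "eventually (\<lambda>n. T n < \<eta> / (4 * N + 4)) sequentially"
      using \<eta> N by (intro order_tendstoD) auto
    have evY: "eventually (\<lambda>n. expectation (\<lambda>\<omega>. (cmod (sY n \<omega> - c n))\<^sup>2) < \<eta>) sequentially"
      using limY \<eta> by (rule order_tendstoD)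
    show "eventually (\<lambda>n. expectation (\<lambda>\<omega>. (cmod (sX n \<omega> - c n))\<^sup>2) \<le> (144 * W^6 * 3 + 1) * \<eta>) sequentially"
      using evA evT evY eventually_ge_at_top[of 1]
    proof eventually_elim
      case (elim n)
      have "\<bar>expectation (\<lambda>\<omega>. (cmod (sX n \<omega> - c n))\<^sup>2) - expectation (\<lambda>\<omega>. (cmod (sY n \<omega> - c n))\<^sup>2)\<bar>
          \<le> 144 * W^6 * (A a n + (2 * N + 5) * \<epsilon> * ((\<Sum>p\<in>lower_triangle n. v p) / (real n)\<^sup>2) + (4 * N + 4) * T n)"
        unfolding sX_def sY_def sq_dev_def[symmetric] A_def T_def N_def
        by (rule sq_dev_comparison[where X = XX and Y = YY and v = v and ?F1.0 = "F 1" and Fa = "F a"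
              and n = n and c = "c n", OF z W elim(4) c \<epsilon> XX YY_ind YY_distr sub F1_meas F1_zero sub Fa_meas])
      also have "\<dots> \<le> 144 * W^6 * (\<eta> + \<eta> + \<eta>)"
      proof (intro mult_left_mono add_mono)
        show "A a n \<le> \<eta>" using elim by simp
        have "(2 * N + 5) * \<epsilon> * ((\<Sum>p\<in>lower_triangle n. v p) / (real n)\<^sup>2) \<le> (2 * N + 5) * \<epsilon> * C"
          using C(2)[OF elim(4)] N \<epsilon> by (intro mult_left_mono) auto
        also have "\<dots> = \<eta>" using N C(1) by (simp add: \<epsilon>_def)
        finally show "(2 * N + 5) * \<epsilon> * ((\<Sum>p\<in>lower_triangle n. v p) / (real n)\<^sup>2) \<le> \<eta>" .
        have "(4 * N + 4) * T n \<le> (4 * N + 4) * (\<eta> / (4 * N + 4))"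
          using elim N by (intro mult_left_mono) auto
        also have "\<dots> = \<eta>" using N by simp
        finally show "(4 * N + 4) * T n \<le> \<eta>" .
      qed (use W1 in simp)
      finally show ?case using elim(3) by (simp add: algebra_simps)
    qed
  qed (simp add: Bochner_Integration.integral_nonneg)
  have "tendsto_in_probability M (\<lambda>n \<omega>. sX n \<omega> - sY n \<omega>) (\<lambda>_. 0)"
    by (rule tendsto_in_probability_of_second_moments[where K = W, OF sX_meas _ sY_meas _ limX limY])
       (simp_all add: sX_def sY_def stj_bound[OF z W])
  moreover have "stieltjes (normalized_sym_matrix n (\<lambda>i j. X (int i) (int j) \<omega>)) z = sX n \<omega>" for n \<omega>
    using stieltjes_eq_stj[OF z, of n "\<lambda>p. XX p \<omega>"] stj_cong[of n "\<lambda>p. XX p \<omega>" "\<lambda>q. if q \<in> lower_triangle n then XX q \<omega> else 0" z]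
    by (simp add: XX_def sX_def)
  moreover have "stieltjes (normalized_sym_matrix n (\<lambda>i j. Y i j \<omega>)) z = sY n \<omega>" for n \<omega>
    using stieltjes_eq_stj[OF z, of n "\<lambda>p. YY p \<omega>"] stj_cong[of n "\<lambda>p. YY p \<omega>" "\<lambda>q. if q \<in> lower_triangle n then YY q \<omega> else 0" z]
    by (simp add: YY_def sY_def)
  ultimately show "tendsto_in_probability M
      (\<lambda>n \<omega>. stieltjes (normalized_sym_matrix n (\<lambda>i j. X (int i) (int j) \<omega>)) z
        - stieltjes (normalized_sym_matrix n (\<lambda>i j. Y i j \<omega>)) z) (\<lambda>_. 0)"
    by simp
qed

end
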